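(* Let $\mathbf{G}$ be a triangular cactus graph with $\operatorname{diam}(\mathbf{G}) = 4$, and let $\mathbb{K}$ be a field. Then the edge ring $\mathbb{K}[\mathbf{G}]$ is not normal, and it satisfies Serre's condition $(S_2)$.
   Context: All graphs are finite, connected and simple (no loops, no multiple edges). A cutpoint of a connected graph $G$ is a vertex $v$ such that $G\setminus v$ (the induced subgraph on $V(G)\setminus\{v\}$) has more connected components than $G$. A connected graph without a cutpoint is non-separable, and a block of $G$ is a maximal non-separable subgraph of $G$. A triangular cactus graph is a connected graph in which every block is a cycle of length $3$. The distance between two vertices is the length of a shortest path between them, and $\operatorname{diam}(G)$ is the maximum distance between two vertices of $G$. Let $G$ have vertex set $[d]=\{1,\dots,d\}$ and edge set $E(G)$. For $e=\{i,j\}\in E(G)$ put $\mathbf{t}^e:=t_it_j\in\mathbb{K}[t_1,\dots,t_d]$. The edge ring $\mathbb{K}[G]$ is the $\mathbb{K}$-subalgebra of $\mathbb{K}[t_1,\dots,t_d]$ generated by $\{\mathbf{t}^e : e\in E(G)\}$. It is normal if it is integrally closed in its field of fractions. A Noetherian ring $A$ satisfies Serre's condition $(S_2)$ if $\operatorname{depth}(A_{\mathfrak{p}})\ge \inf\{\operatorname{height}(\mathfrak{p}),2\}$ for every prime ideal $\mathfrak{p}$ of $A$. *)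

theory Defs
  imports
    "HOL-Algebra.Ring_Divisibility"
    "HOL-Algebra.Subrings"
    "HOL-Library.Poly_Mapping"
    "HOL-Library.Extended_Nat"
    "HOL-Computational_Algebra.Polynomial_Factorial"
begin

section \<open>Graphs\<close>

text \<open>
  A graph is given by its vertex set \<open>V\<close> and its set \<open>E\<close> of edges, which are two-element
  subsets of \<open>V\<close>; in particular there are no loops and no multiple edges.
\<close>

definition simple_graph :: "'v set \<Rightarrow> 'v set set \<Rightarrow> bool" where
  "simple_graph V E \<longleftrightarrow> finite V \<and> (\<forall>e\<in>E. e \<subseteq> V \<and> card e = 2)"

definition is_path :: "'v set \<Rightarrow> 'v set set \<Rightarrow> 'v \<Rightarrow> 'v list \<Rightarrow> 'v \<Rightarrow> bool" where
  "is_path V E u p v \<longleftrightarrow>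
     p \<noteq> [] \<and> hd p = u \<and> last p = v \<and> set p \<subseteq> V \<and> distinct p \<and>
     successively (\<lambda>x y. {x, y} \<in> E) p"

definition connected_graph :: "'v set \<Rightarrow> 'v set set \<Rightarrow> bool" where
  "connected_graph V E \<longleftrightarrow>
     simple_graph V E \<and> V \<noteq> {} \<and> (\<forall>u\<in>V. \<forall>v\<in>V. \<exists>p. is_path V E u p v)"

definition connected_components :: "'v set \<Rightarrow> 'v set set \<Rightarrow> 'v set set" where
  "connected_components V E = V // {(u, v). \<exists>p. is_path V E u p v}"

definition cutpoint :: "'v set \<Rightarrow> 'v set set \<Rightarrow> 'v \<Rightarrow> bool" where
  "cutpoint V E v \<longleftrightarrow> v \<in> V \<and>
     card (connected_components (V - {v}) {e \<in> E. v \<notin> e}) > card (connected_components V E)"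

definition non_separable :: "'v set \<Rightarrow> 'v set set \<Rightarrow> bool" where
  "non_separable V E \<longleftrightarrow> connected_graph V E \<and> \<not> (\<exists>v. cutpoint V E v)"

text \<open>
  Subgraphs are not required to be induced. A subgraph \<open>(W, F)\<close> of \<open>(V, E)\<close> is itself a simple
  graph, which is part of \<^const>\<open>non_separable\<close>.
\<close>

definition block :: "'v set \<Rightarrow> 'v set set \<Rightarrow> 'v set \<Rightarrow> 'v set set \<Rightarrow> bool" where
  "block V E W F \<longleftrightarrow> W \<subseteq> V \<and> F \<subseteq> E \<and> non_separable W F \<and>
     (\<forall>W' F'. W \<subseteq> W' \<and> W' \<subseteq> V \<and> F \<subseteq> F' \<and> F' \<subseteq> E \<and> non_separable W' F' \<longrightarrow> W' = W \<and> F' = F)"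

definition is_cycle :: "nat \<Rightarrow> 'v set \<Rightarrow> 'v set set \<Rightarrow> bool" where
  "is_cycle n V E \<longleftrightarrow> n \<ge> 3 \<and>
     (\<exists>vs. length vs = n \<and> distinct vs \<and> V = set vs \<and>
        E = {{vs ! i, vs ! (Suc i mod n)} | i. i < n})"

definition triangular_cactus :: "'v set \<Rightarrow> 'v set set \<Rightarrow> bool" where
  "triangular_cactus V E \<longleftrightarrow> connected_graph V E \<and> (\<forall>W F. block V E W F \<longrightarrow> is_cycle 3 W F)"

definition graph_dist :: "'v set \<Rightarrow> 'v set set \<Rightarrow> 'v \<Rightarrow> 'v \<Rightarrow> nat" where
  "graph_dist V E u v = (LEAST n. \<exists>p. is_path V E u p v \<and> length p = Suc n)"

definition diam :: "'v set \<Rightarrow> 'v set set \<Rightarrow> nat" where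
  "diam V E = Max {graph_dist V E u v | u v. u \<in> V \<and> v \<in> V}"


section \<open>Subrings of integral domains\<close>

definition ring_on :: "'a::comm_ring_1 set \<Rightarrow> 'a ring" where
  "ring_on A = \<lparr>carrier = A, mult = (*), one = 1, zero = 0, add = (+)\<rparr>"

text \<open>
  For a subring \<open>A\<close> of the integral domain \<open>'a\<close>, all localisations of \<open>A\<close> and its field of
  fractions are realised as subsets of the field of fractions \<open>'a fract\<close> of \<open>'a\<close>.
\<close>

definition fractions :: "'a::idom set \<Rightarrow> 'a set \<Rightarrow> 'a fract set" where
  "fractions A S = {Fract a s | a s. a \<in> A \<and> s \<in> S}"

definition integral_over :: "'a::idom set \<Rightarrow> 'a fract \<Rightarrow> bool" where
  "integral_over A x \<longleftrightarrow>
     (\<exists>f::'a poly. lead_coeff f = 1 \<and> (\<forall>i. coeff f i \<in> A) \<and> poly (fract_poly f) x = 0)"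

definition normal_domain :: "'a::idom set \<Rightarrow> bool" where
  "normal_domain A \<longleftrightarrow> (\<forall>x \<in> fractions A (A - {0}). integral_over A x \<longrightarrow> x \<in> to_fract ` A)"


section \<open>Height, depth and Serre's condition\<close>

definition height :: "('a, 'b) ring_scheme \<Rightarrow> 'a set \<Rightarrow> enat" where
  "height R P = Sup {enat n | n. \<exists>Q :: nat \<Rightarrow> 'a set.
     (\<forall>i\<le>n. primeideal (Q i) R) \<and> (\<forall>i<n. Q i \<subset> Q (Suc i)) \<and> Q n = P}"

definition regular_sequence :: "('a, 'b) ring_scheme \<Rightarrow> 'a list \<Rightarrow> bool" where
  "regular_sequence R xs \<longleftrightarrow> set xs \<subseteq> carrier R \<and> genideal R (set xs) \<noteq> carrier R \<and>
     (\<forall>i<length xs. \<forall>a\<in>carrier R.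
        xs ! i \<otimes>\<^bsub>R\<^esub> a \<in> genideal R (set (take i xs)) \<longrightarrow> a \<in> genideal R (set (take i xs)))"

text \<open>The depth of a local ring \<open>R\<close> with maximal ideal \<open>M\<close>.\<close>

definition depth :: "('a, 'b) ring_scheme \<Rightarrow> 'a set \<Rightarrow> enat" where
  "depth R M = Sup {enat (length xs) | xs. regular_sequence R xs \<and> set xs \<subseteq> M}"

text \<open>
  For a prime ideal \<open>P\<close> of \<open>A\<close>, the set \<open>fractions A (A - P)\<close> is the localisation of \<open>A\<close> at
  \<open>P\<close>, and \<open>fractions P (A - P)\<close> is its maximal ideal.
\<close>

definition serre_S2 :: "'a::idom set \<Rightarrow> bool" where
  "serre_S2 A \<longleftrightarrow> noetherian_ring (ring_on A) \<and>
     (\<forall>P. primeideal P (ring_on A) \<longrightarrow>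
        depth (ring_on (fractions A (A - P))) (fractions P (A - P))
          \<ge> min (height (ring_on A) P) 2)"


section \<open>Edge rings\<close>

type_synonym 'k mpoly = "(nat \<Rightarrow>\<^sub>0 nat) \<Rightarrow>\<^sub>0 'k"

definition const :: "'k::field \<Rightarrow> 'k mpoly" where
  "const c = Poly_Mapping.single 0 c"

definition var :: "nat \<Rightarrow> 'k::field mpoly" where
  "var i = Poly_Mapping.single (Poly_Mapping.single i 1) 1"

text \<open>The polynomials in the variables indexed by \<open>V\<close> only.\<close>

definition polys :: "nat set \<Rightarrow> 'k::field mpoly set" where
  "polys V = {f. \<forall>m \<in> Poly_Mapping.keys f. Poly_Mapping.keys m \<subseteq> V}"

text \<open>
  The predicate \<open>subalgebra\<close> of HOL-Algebra only describes additive subgroups closed under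
  scalars, so subalgebras are described here as subrings containing the constants.
\<close>

definition edge_ring :: "nat set \<Rightarrow> nat set set \<Rightarrow> 'k::field mpoly set" where
  "edge_ring V E =
     (\<lambda>A. range const \<subseteq> A \<and> subring A (ring_on (polys V))) hull {\<Prod>i\<in>e. var i | e. e \<in> E}"

end

theory Submission
  imports Defs
begin

text \<open>
  A triangular cactus of diameter \<open>4\<close> has a centre \<open>c\<close> such that every vertex has distance at most
  \<open>2\<close> from \<open>c\<close>, and at least two of the triangles at \<open>c\<close> (\<^emph>\<open>branches\<close>) carry further, \<^emph>\<open>outer\<close>,
  triangles. The edge ring \<open>A\<close> is the monoid algebra of the monoid \<open>S\<close> generated by the edges. It is
  not normal, because the sum of two outer triangles in different branches is not in \<open>S\<close>, although
  it is a difference of elements of \<open>S\<close> and its double is in \<open>S\<close>.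

  For \<open>(S\<^sub>2)\<close> it suffices that \<open>P a \<subseteq> x A\<close> implies \<open>a \<in> x A\<close> for every prime \<open>P\<close> containing a prime
  \<open>0 \<noteq> Q \<subset> P\<close>. Multiplication by \<open>f = a / x\<close> then maps \<open>P\<close> or \<open>Q\<close> to itself, so \<open>f\<close> is almost integral
  over \<open>A\<close> and therefore lies in the algebra of the saturation of \<open>S\<close>. The elements of \<open>S\<close> all of
  whose branches have even coordinate sum span a normal subring \<open>A\<^sub>0\<close>. If a monomial \<open>m\<close> of \<open>f\<close> were
  not in \<open>S\<close>, then it would violate an inequality bounding its \<open>c\<close>-coordinate from below by linear
  terms of some branches and the parities of the others. A Laurent monomial shifts the part of \<open>A\<close>
  with the parities of \<open>m\<close> into \<open>A\<^sub>0\<close>, but not \<open>m\<close>. The argument above, applied to \<open>A\<^sub>0\<close> and the shifted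
  part of \<open>f\<close>, shows that this shifted part lies in \<open>A\<^sub>0\<close> nevertheless, a contradiction.
\<close>

section \<open>Subrings and the Hilbert basis theorem\<close>

text \<open>What separates \<open>S\<close> from its saturation is parity alone. An edge inside a
  branch adds 2 to the coordinate sum of the branch and an edge to \<open>c\<close> adds 1, so a
  branch with odd sum needs at least one edge to \<open>c\<close>. Each branch therefore bounds the
  \<open>c\<close>-coordinate from below by a maximum of linear terms and a parity bit, and such a
  bound becomes linear only after the parities are fixed. The primes in Serre's condition need not
  be spanned by monomials, so the condition cannot be read off from the faces of \<open>S\<close>.
  Instead the algebraic criterion itself is carried over to the even part, and two things have to
  survive: strict inclusions of primes under contraction, in characteristic 2 as well, and
  non-membership of a monomial in \<open>S\<close> under the shift. The shift exists because a
  branch whose bound is only the parity bit carries an outer triangle that can absorb the change.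
  Without outer triangles a branch is bounded by the difference of its two coordinates at distance
  one from \<open>c\<close>, which is odd whenever the sum is, so parity adds nothing there.\<close>

definition subring_set :: "'a::comm_ring_1 set \<Rightarrow> bool" where
  "subring_set A \<longleftrightarrow> 1 \<in> A \<and> (\<forall>x\<in>A. \<forall>y\<in>A. x - y \<in> A \<and> x * y \<in> A)"

lemma ring_on_simps [simp]:
  "carrier (ring_on A) = A" "mult (ring_on A) = (*)" "one (ring_on A) = 1"
  "zero (ring_on A) = 0" "add (ring_on A) = (+)"
  by (simp_all add: ring_on_def)

context
  fixes A :: "'a::comm_ring_1 set"
  assumes A: "subring_set A"
begin

lemma subring_set_one: "1 \<in> A"
  and subring_set_diff: "x \<in> A \<Longrightarrow> y \<in> A \<Longrightarrow> x - y \<in> A"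
  and subring_set_mult: "x \<in> A \<Longrightarrow> y \<in> A \<Longrightarrow> x * y \<in> A"
  using A by (auto simp: subring_set_def)

lemma subring_set_zero: "0 \<in> A"
  using subring_set_diff[OF subring_set_one subring_set_one] by simp

lemma subring_set_minus: "x \<in> A \<Longrightarrow> - x \<in> A"
  using subring_set_diff[OF subring_set_zero, of x] by simp

lemma subring_set_add: "x \<in> A \<Longrightarrow> y \<in> A \<Longrightarrow> x + y \<in> A"
  using subring_set_diff[of x "- y"] subring_set_minus[of y] by simp

lemma subring_set_power: "x \<in> A \<Longrightarrow> x ^ n \<in> A"
  by (induction n) (auto intro: subring_set_one subring_set_mult)

lemma subring_set_sum: "(\<And>i. i \<in> I \<Longrightarrow> f i \<in> A) \<Longrightarrow> sum f I \<in> A"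
  by (induction I rule: infinite_finite_induct) (auto intro: subring_set_zero subring_set_add)

lemma subring_set_prod: "(\<And>i. i \<in> I \<Longrightarrow> f i \<in> A) \<Longrightarrow> prod f I \<in> A"
  by (induction I rule: infinite_finite_induct) (auto intro: subring_set_one subring_set_mult)

lemma subring_set_of_nat: "of_nat n \<in> A"
  by (induction n) (auto intro: subring_set_zero subring_set_one subring_set_add)

lemma cring_ring_on: "cring (ring_on A)"
proof (rule cringI)
  show "abelian_group (ring_on A)"
    using subring_set_minus
    by (intro abelian_groupI)
      (auto simp: algebra_simps subring_set_zero subring_set_add intro: exI[of _ "- x" for x]
        bexI[of _ "- x" for x])
  show "Group.comm_monoid (ring_on A)"
    by (intro comm_monoidI) (auto simp: algebra_simps subring_set_one subring_set_mult)
qed (auto simp: algebra_simps)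

lemma ring_ring_on: "ring (ring_on A)"
  using cring_ring_on by (rule cring.axioms(1))

lemma ideal_ring_on_iff:
  "ideal I (ring_on A) \<longleftrightarrow> 0 \<in> I \<and> I \<subseteq> A \<and> (\<forall>x\<in>I. \<forall>y\<in>I. x + y \<in> I) \<and> (\<forall>a\<in>A. \<forall>x\<in>I. a * x \<in> I)"
proof
  assume "ideal I (ring_on A)"
  then interpret ideal I "ring_on A" .
  show "0 \<in> I \<and> I \<subseteq> A \<and> (\<forall>x\<in>I. \<forall>y\<in>I. x + y \<in> I) \<and> (\<forall>a\<in>A. \<forall>x\<in>I. a * x \<in> I)"
    using additive_subgroup.zero_closed[OF is_additive_subgroup]
      additive_subgroup.a_closed[OF is_additive_subgroup] a_subset I_l_closed by simp
next
  assume I: "0 \<in> I \<and> I \<subseteq> A \<and> (\<forall>x\<in>I. \<forall>y\<in>I. x + y \<in> I) \<and> (\<forall>a\<in>A. \<forall>x\<in>I. a * x \<in> I)"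
  have neg: "\<exists>y\<in>A. y + x = 0" "- x \<in> I" if "x \<in> I" for x
  proof -
    have "- 1 * x \<in> I"
      using I that subring_set_minus[OF subring_set_one] by blast
    then show "\<exists>y\<in>A. y + x = 0" "- x \<in> I"
      using I by (auto intro!: bexI[of _ "- x"])
  qed
  interpret ring "ring_on A" by (rule ring_ring_on)
  have inv: "\<ominus>\<^bsub>ring_on A\<^esub> x = - x" if "x \<in> A" for x
    using that subring_set_minus minus_equality[of "- x" x] by simp
  show "ideal I (ring_on A)"
  proof (rule idealI[OF ring_ring_on])
    show "subgroup I (add_monoid (ring_on A))"
    proof (rule add.subgroupI)
      fix a assume a: "a \<in> I"
      then show "\<ominus>\<^bsub>ring_on A\<^esub> a \<in> I"
        using inv neg(2) I by auto
    qed (use I in auto)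
    show "x \<otimes>\<^bsub>ring_on A\<^esub> a \<in> I" "a \<otimes>\<^bsub>ring_on A\<^esub> x \<in> I"
      if "a \<in> I" "x \<in> carrier (ring_on A)" for a x
      using I that unfolding ring_on_simps by (blast, metis mult.commute)
  qed
qed

lemma primeideal_ring_on_iff:
  "primeideal P (ring_on A) \<longleftrightarrow>
     ideal P (ring_on A) \<and> 1 \<notin> P \<and> (\<forall>a\<in>A. \<forall>b\<in>A. a * b \<in> P \<longrightarrow> a \<in> P \<or> b \<in> P)"
proof
  assume P: "primeideal P (ring_on A)"
  then interpret primeideal P "ring_on A" .
  have "1 \<notin> P"
    using one_imp_carrier I_notcarr by auto
  then show "ideal P (ring_on A) \<and> 1 \<notin> P \<and> (\<forall>a\<in>A. \<forall>b\<in>A. a * b \<in> P \<longrightarrow> a \<in> P \<or> b \<in> P)"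
    using I_prime ideal_axioms by simp
next
  assume "ideal P (ring_on A) \<and> 1 \<notin> P \<and> (\<forall>a\<in>A. \<forall>b\<in>A. a * b \<in> P \<longrightarrow> a \<in> P \<or> b \<in> P)"
  then show "primeideal P (ring_on A)"
    using cring_ring_on subring_set_one by (intro primeidealI) auto
qed

end

section \<open>Hilbert's basis theorem for adjoining one element\<close>

primrec poly_span :: "'a::comm_ring_1 set \<Rightarrow> 'a \<Rightarrow> nat \<Rightarrow> 'a set" where
  "poly_span B x 0 = {0}"
| "poly_span B x (Suc n) = {b * x ^ n + g | b g. b \<in> B \<and> g \<in> poly_span B x n}"

context
  fixes B :: "'a::comm_ring_1 set" and x :: 'a
  assumes B: "subring_set B"
begin

lemma zero_in_poly_span: "0 \<in> poly_span B x n"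
  by (induction n) (use subring_set_zero[OF B] in force)+

lemma poly_span_Suc: "g \<in> poly_span B x n \<Longrightarrow> g \<in> poly_span B x (Suc n)"
  using subring_set_zero[OF B] by force

lemma poly_span_mono: "m \<le> n \<Longrightarrow> poly_span B x m \<subseteq> poly_span B x n"
  by (rule lift_Suc_mono_le) (blast intro: poly_span_Suc)

lemma poly_span_add:
  "f \<in> poly_span B x n \<Longrightarrow> g \<in> poly_span B x n \<Longrightarrow> f + g \<in> poly_span B x n"
proof (induction n arbitrary: f g)
  case (Suc n)
  then obtain a f' b g' where *: "f = a * x ^ n + f'" "g = b * x ^ n + g'" "a \<in> B" "b \<in> B"
    "f' \<in> poly_span B x n" "g' \<in> poly_span B x n"
    by auto
  have "f + g = (a + b) * x ^ n + (f' + g')"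
    using * by (simp add: algebra_simps)
  moreover have "a + b \<in> B" "f' + g' \<in> poly_span B x n"
    using * Suc.IH subring_set_add[OF B] by auto
  ultimately show ?case by auto
qed simp

lemma poly_span_smult: "c \<in> B \<Longrightarrow> f \<in> poly_span B x n \<Longrightarrow> c * f \<in> poly_span B x n"
proof (induction n arbitrary: f)
  case (Suc n)
  then obtain a f' where *: "f = a * x ^ n + f'" "a \<in> B" "f' \<in> poly_span B x n"
    by auto
  have "c * f = (c * a) * x ^ n + c * f'"
    using * by (simp add: algebra_simps)
  moreover have "c * a \<in> B" "c * f' \<in> poly_span B x n"
    using * Suc subring_set_mult[OF B] by auto
  ultimately show ?case by auto
qed simp

lemma poly_span_diff:
  "f \<in> poly_span B x n \<Longrightarrow> g \<in> poly_span B x n \<Longrightarrow> f - g \<in> poly_span B x n"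
  using poly_span_add[of f n "- 1 * g"] poly_span_smult[OF subring_set_minus[OF B subring_set_one[OF B]]]
  by force

lemma poly_span_shift: "f \<in> poly_span B x n \<Longrightarrow> x * f \<in> poly_span B x (Suc n)"
proof (induction n arbitrary: f)
  case 0
  then show ?case using zero_in_poly_span[of 1] by simp
next
  case (Suc n)
  then obtain a f' where *: "f = a * x ^ n + f'" "a \<in> B" "f' \<in> poly_span B x n"
    by auto
  have "x * f = a * x ^ Suc n + x * f'"
    using * by (simp add: algebra_simps)
  then show ?case
    using Suc.IH[OF *(3)] *(2) by (simp del: power_Suc) blast
qed

lemma poly_span_mult_power: "f \<in> poly_span B x n \<Longrightarrow> x ^ i * f \<in> poly_span B x (i + n)"
proof (induction i)
  case (Suc i)
  then show ?case using poly_span_shift[of "x ^ i * f" "i + n"] by (simp add: mult.assoc)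
qed simp

lemma poly_span_mult:
  "f \<in> poly_span B x m \<Longrightarrow> g \<in> poly_span B x n \<Longrightarrow> f * g \<in> poly_span B x (m + n)"
proof (induction m arbitrary: f)
  case 0
  then show ?case using zero_in_poly_span by simp
next
  case (Suc m)
  then obtain a f' where *: "f = a * x ^ m + f'" "a \<in> B" "f' \<in> poly_span B x m"
    by auto
  have "a * (x ^ m * g) \<in> poly_span B x (m + n)"
    using poly_span_smult[OF *(2)] poly_span_mult_power[OF Suc.prems(2)] by blast
  then have "a * (x ^ m * g) + f' * g \<in> poly_span B x (m + n)"
    using Suc.IH[OF *(3) Suc.prems(2)] by (rule poly_span_add)
  then show ?case
    using poly_span_Suc * by (simp add: algebra_simps)
qed

lemma base_in_poly_span: "b \<in> B \<Longrightarrow> b \<in> poly_span B x (Suc 0)"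
  by auto

lemma subring_set_poly_span: "subring_set (\<Union>n. poly_span B x n)"
  unfolding subring_set_def
proof (intro conjI ballI)
  show "1 \<in> (\<Union>n. poly_span B x n)"
    using base_in_poly_span subring_set_one[OF B] by blast
next
  fix f g assume "f \<in> (\<Union>n. poly_span B x n)" "g \<in> (\<Union>n. poly_span B x n)"
  then obtain m n where "f \<in> poly_span B x m" "g \<in> poly_span B x n" by auto
  then have "f \<in> poly_span B x (m + n)" "g \<in> poly_span B x (m + n)"
    "f * g \<in> poly_span B x (m + n)"
    using poly_span_mono[of m "m + n"] poly_span_mono[of n "m + n"] poly_span_mult by auto
  then show "f - g \<in> (\<Union>n. poly_span B x n)" "f * g \<in> (\<Union>n. poly_span B x n)"
    using poly_span_diff by blast+
qed

text \<open>\<open>poly_span B x n\<close> consists of the expressions of degree below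
  \<open>n\<close>. Since \<open>x\<close> may be algebraic over \<open>B\<close>, such expressions
  are not unique; collecting every coefficient that occurs at \<open>x ^ n\<close> in some
  expression of an element of \<open>I\<close> makes degrees of elements unnecessary.\<close>

abbreviation "leading I n \<equiv> {b \<in> B. \<exists>g \<in> poly_span B x n. b * x ^ n + g \<in> I}"

lemma ideal_leading:
  assumes I: "ideal I (ring_on (\<Union>n. poly_span B x n))"
  shows "ideal (leading I n) (ring_on B)"
proof -
  note I = I[unfolded ideal_ring_on_iff[OF subring_set_poly_span]]
  show ?thesis
    unfolding ideal_ring_on_iff[OF B]
  proof (intro conjI ballI)
    show "0 \<in> leading I n"
      using I zero_in_poly_span subring_set_zero[OF B] by (auto intro!: bexI[of _ 0])
  next
    fix a b assume "a \<in> leading I n" "b \<in> leading I n"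
    then obtain f g where *: "f \<in> poly_span B x n" "a * x ^ n + f \<in> I" "a \<in> B"
      "g \<in> poly_span B x n" "b * x ^ n + g \<in> I" "b \<in> B" by auto
    then have "(a * x ^ n + f) + (b * x ^ n + g) \<in> I"
      using I by blast
    then have "(a + b) * x ^ n + (f + g) \<in> I"
      by (simp add: algebra_simps)
    then show "a + b \<in> leading I n"
      using * poly_span_add subring_set_add[OF B] by blast
  next
    fix c b assume c: "c \<in> B" and "b \<in> leading I n"
    then obtain g where *: "g \<in> poly_span B x n" "b * x ^ n + g \<in> I" "b \<in> B" by auto
    have "c \<in> (\<Union>n. poly_span B x n)"
      using base_in_poly_span[OF c] by blast
    then have "c * (b * x ^ n + g) \<in> I"
      using I * by blast
    then have "(c * b) * x ^ n + c * g \<in> I"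
      by (simp add: algebra_simps)
    then show "c * b \<in> leading I n"
      using * poly_span_smult[OF c] subring_set_mult[OF B c] by blast
  qed blast
qed

lemma leading_Suc:
  assumes I: "ideal I (ring_on (\<Union>n. poly_span B x n))"
  shows "leading I n \<subseteq> leading I (Suc n)"
proof
  note I = I[unfolded ideal_ring_on_iff[OF subring_set_poly_span]]
  fix b assume "b \<in> leading I n"
  then obtain g where *: "g \<in> poly_span B x n" "b * x ^ n + g \<in> I" "b \<in> B" by auto
  have "1 \<in> poly_span B x (Suc 0)"
    using base_in_poly_span subring_set_one[OF B] by blast
  then have "x \<in> (\<Union>n. poly_span B x n)"
    using poly_span_shift[of 1 "Suc 0"] unfolding mult_1_right by blast
  then have "x * (b * x ^ n + g) \<in> I"
    using * I by blast
  then have "b * x ^ Suc n + x * g \<in> I"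
    by (simp add: algebra_simps)
  then show "b \<in> leading I (Suc n)"
    using * poly_span_shift by blast
qed

lemma leading_mono:
  assumes "ideal I (ring_on (\<Union>n. poly_span B x n))" "m \<le> n"
  shows "leading I m \<subseteq> leading I n"
  using leading_Suc[OF assms(1)] assms(2) by (rule lift_Suc_mono_le)

text \<open>Induction on the length of an expression: an element of \<open>J\<close> with the same
  top coefficient cancels it, and the difference is again in \<open>I\<close> because
  \<open>J\<close> is contained in \<open>I\<close>.\<close>

lemma subset_of_leading_subset:
  assumes I: "ideal I (ring_on (\<Union>n. poly_span B x n))"
    and J: "ideal J (ring_on (\<Union>n. poly_span B x n))" "J \<subseteq> I"
    and sub: "\<And>n. leading I n \<subseteq> leading J n"
  shows "I \<subseteq> J"
proof -
  note I' = I[unfolded ideal_ring_on_iff[OF subring_set_poly_span]]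
  note J' = J(1)[unfolded ideal_ring_on_iff[OF subring_set_poly_span]]
  have m1: "- 1 \<in> (\<Union>n. poly_span B x n)"
    using base_in_poly_span subring_set_minus[OF B subring_set_one[OF B]] by blast
  have "f \<in> J" if "f \<in> poly_span B x n" "f \<in> I" for f n
    using that
  proof (induction n arbitrary: f)
    case 0
    then show ?case using J' by simp
  next
    case (Suc n)
    then obtain b g where f: "f = b * x ^ n + g" "b \<in> B" "g \<in> poly_span B x n" by auto
    then have "b \<in> leading J n"
      using sub[of n] Suc.prems by blast
    then obtain h where h: "h \<in> poly_span B x n" "b * x ^ n + h \<in> J" by auto
    have "- 1 * (b * x ^ n + h) \<in> I"
      using h(2) J(2) I' m1 by blast
    then have "f + - 1 * (b * x ^ n + h) \<in> I"
      using I' Suc.prems by blast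
    then have "g - h \<in> I"
      by (simp add: f)
    then have "g - h \<in> J"
      using Suc.IH f(3) h(1) poly_span_diff by blast
    then have "(g - h) + (b * x ^ n + h) \<in> J"
      using h(2) J' by blast
    then show ?case by (simp add: f algebra_simps)
  qed
  then show ?thesis using I' by blast
qed

theorem noetherian_poly_span:
  assumes noeth: "noetherian_ring (ring_on B)"
  shows "noetherian_ring (ring_on (\<Union>n. poly_span B x n))"
proof -
  define C where "C = (\<Union>n. poly_span B x n)"
  note C = subring_set_poly_span[folded C_def]
  interpret B: noetherian_ring "ring_on B" by (rule noeth)
  interpret C: ring "ring_on C" by (rule ring_ring_on[OF C])
  have "noetherian_ring (ring_on C)"
  proof (rule C.noetherian_ringI)
    fix I assume I: "ideal I (ring_on C)"
    note I' = I[unfolded C_def]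
    note IC = I[unfolded ideal_ring_on_iff[OF C]]
    have "\<Union>(range (leading I)) \<in> range (leading I)"
    proof (rule B.ideal_chain_is_trivial)
      show "subset.chain {I. ideal I (ring_on B)} (range (leading I))"
        unfolding subset_chain_def
      proof (intro conjI ballI)
        fix X Y assume "X \<in> range (leading I)" "Y \<in> range (leading I)"
        then obtain m n where "X = leading I m" "Y = leading I n" by blast
        then show "X \<subseteq> Y \<or> Y \<subseteq> X"
          using leading_mono[OF I', of m n] leading_mono[OF I', of n m] nle_le[of m n] by metis
      qed (use ideal_leading[OF I'] in blast)
    qed auto
    then obtain N where N: "\<Union>(range (leading I)) = leading I N" by blast
    have "\<exists>F. finite F \<and> F \<subseteq> B \<and> leading I n = genideal (ring_on B) F" for n
      using B.finetely_gen[OF ideal_leading[OF I', of n]] by auto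
    then obtain F where F: "\<And>n. finite (F n)" "\<And>n. F n \<subseteq> B"
      "\<And>n. leading I n = genideal (ring_on B) (F n)" by metis
    have FL: "F n \<subseteq> leading I n" for n
      using F(2,3) B.genideal_self[of "F n"] by simp
    then have "\<forall>n. \<forall>b\<in>F n. \<exists>h\<in>I. \<exists>g\<in>poly_span B x n. h = b * x ^ n + g"
      by blast
    then obtain h where h: "\<And>n b. b \<in> F n \<Longrightarrow> h n b \<in> I \<and> (\<exists>g\<in>poly_span B x n. h n b = b * x ^ n + g)"
      by metis
    \<comment> \<open>Lifts up to degree \<open>N\<close> suffice: the ideals
      \<open>leading J n\<close> grow with \<open>n\<close>, while \<open>leading I n\<close> no
      longer grows after \<open>N\<close>.\<close>
    define G where "G = (\<Union>n\<le>N. h n ` F n)"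
    have G: "finite G" "G \<subseteq> I"
      using F(1) h by (auto simp: G_def)
    define J where "J = genideal (ring_on C) G"
    have GC: "G \<subseteq> carrier (ring_on C)"
      using G(2) IC by auto
    have J: "ideal J (ring_on C)" "G \<subseteq> J" "J \<subseteq> I"
      unfolding J_def
      using C.genideal_ideal[OF GC] C.genideal_self[OF GC] C.genideal_minimal[OF I G(2)] by auto
    note J' = J(1)[unfolded C_def]
    have le: "leading I n \<subseteq> leading J n" if "n \<le> N" for n
    proof -
      have "F n \<subseteq> leading J n"
      proof
        fix b assume b: "b \<in> F n"
        then have "h n b \<in> J"
          using J(2) that by (auto simp: G_def)
        then show "b \<in> leading J n"
          using h[OF b] F(2)[of n] b by auto
      qed
      then show ?thesis
        unfolding F(3) using B.genideal_minimal[OF ideal_leading[OF J']] by blast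
    qed
    have "leading I n \<subseteq> leading J n" for n
    proof (cases "n \<le> N")
      case False
      have "leading I n \<subseteq> leading I N" using N by blast
      also have "\<dots> \<subseteq> leading J N" using le by blast
      also have "\<dots> \<subseteq> leading J n" using leading_mono[OF J'] False by simp
      finally show ?thesis .
    qed (rule le)
    then have "I \<subseteq> J"
      using subset_of_leading_subset[OF I' J' J(3)] by blast
    then show "\<exists>A\<subseteq>carrier (ring_on C). finite A \<and> I = genideal (ring_on C) A"
      using J(3) G GC unfolding J_def by blast
  qed
  then show ?thesis by (simp add: C_def)
qed

end

section \<open>A criterion for Serre's condition\<close>

context
  fixes A :: "'a::idom set" and x :: 'a
  assumes A: "subring_set A" and noeth: "noetherian_ring (ring_on A)" and x: "x \<in> A"
begin

definition colon :: "'a \<Rightarrow> 'a set" where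
  "colon a = {y \<in> A. \<exists>b\<in>A. y * a = x * b}"

definition colons :: "'a set set" where
  "colons = {colon a | a. a \<in> A \<and> \<not> (\<exists>b\<in>A. a = x * b)}"

lemma ideal_colon: "a \<in> A \<Longrightarrow> ideal (colon a) (ring_on A)"
  unfolding ideal_ring_on_iff[OF A] colon_def
  using subring_set_zero[OF A] subring_set_add[OF A] subring_set_mult[OF A]
  by (auto simp: distrib_right mult.assoc simp flip: distrib_left)

lemma maximal_colon_exists:
  assumes "I \<in> colons"
  shows "\<exists>M\<in>colons. I \<subseteq> M \<and> (\<forall>J\<in>colons. M \<subseteq> J \<longrightarrow> J = M)"
proof -
  interpret noetherian_ring "ring_on A" by (rule noeth)
  have "\<exists>M\<in>{J \<in> colons. I \<subseteq> J}. \<forall>J\<in>{J \<in> colons. I \<subseteq> J}. M \<subseteq> J \<longrightarrow> J = M"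
  proof (rule subset_Zorn)
    fix C assume C: "subset.chain {J \<in> colons. I \<subseteq> J} C"
    show "\<exists>U\<in>{J \<in> colons. I \<subseteq> J}. \<forall>X\<in>C. X \<subseteq> U"
    proof (cases "C = {}")
      case True
      then show ?thesis using assms by auto
    next
      case False
      have "subset.chain {I. ideal I (ring_on A)} C"
        using C ideal_colon unfolding subset_chain_def colons_def by auto
      then have "\<Union>C \<in> C"
        using ideal_chain_is_trivial[OF False] by blast
      then have "\<Union>C \<in> {J \<in> colons. I \<subseteq> J}"
        using conjunct1[OF C[unfolded subset_chain_def]] by (rule subsetD[rotated])
      moreover have "\<forall>X\<in>C. X \<subseteq> \<Union>C" by (simp add: Union_upper)
      ultimately show ?thesis by (rule rev_bexI)
    qed
  qed
  then obtain M where M: "M \<in> colons" "I \<subseteq> M"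
    and max: "\<forall>J\<in>{J \<in> colons. I \<subseteq> J}. M \<subseteq> J \<longrightarrow> J = M" by auto
  have "J = M" if "J \<in> colons" "M \<subseteq> J" for J
    using max that M(2) by auto
  then show ?thesis using M by auto
qed

text \<open>The maximal annihilators of nonzero classes in \<open>A / xA\<close>. Every zero divisor
  modulo \<open>x\<close> lies in one of them, so avoiding these primes gives a
  nonzerodivisor.\<close>

definition max_colons :: "'a set set" where
  "max_colons = {M \<in> colons. \<forall>J\<in>colons. M \<subseteq> J \<longrightarrow> J = M}"

text \<open>If \<open>b * c\<close> kills the class of \<open>a\<close> but \<open>c\<close> does
  not, then the annihilator of the class of \<open>c * a\<close> contains both \<open>M\<close> and
  \<open>b\<close>, and by maximality it equals \<open>M\<close>.\<close>

lemma max_colon_prime: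
  assumes "M \<in> max_colons"
  shows "primeideal M (ring_on A)"
proof -
  obtain a where a: "a \<in> A" "\<not> (\<exists>b\<in>A. a = x * b)" "M = colon a"
    using assms unfolding max_colons_def colons_def by blast
  have "b \<in> M" if bc: "b \<in> A" "c \<in> A" "b * c \<in> M" "c \<notin> M" for b c
  proof -
    have "c * a \<in> A" "\<not> (\<exists>b\<in>A. c * a = x * b)"
      using bc a subring_set_mult[OF A] by (auto simp: colon_def)
    then have "colon (c * a) \<in> colons"
      unfolding colons_def by blast
    moreover have "M \<subseteq> colon (c * a)"
    proof
      fix y assume "y \<in> M"
      then obtain d where d: "y \<in> A" "d \<in> A" "y * a = x * d"
        using a by (auto simp: colon_def)
      then have "y * (c * a) = x * (c * d)"
        by (metis mult.left_commute)
      moreover have "c * d \<in> A" using d(2) bc(2) by (intro subring_set_mult[OF A])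
      ultimately show "y \<in> colon (c * a)"
        using d(1) unfolding colon_def by blast
    qed
    ultimately have "colon (c * a) = M"
      using assms unfolding max_colons_def by blast
    moreover have "b \<in> colon (c * a)"
      using bc a by (auto simp: colon_def mult.assoc)
    ultimately show ?thesis by blast
  qed
  moreover have "1 \<notin> M"
    using a by (auto simp: colon_def)
  ultimately show ?thesis
    unfolding primeideal_ring_on_iff[OF A] using ideal_colon a by blast
qed

text \<open>For infinitely many such primes \<open>p n = colon (a n)\<close>, the ideals generated
  by the first \<open>n\<close> of the \<open>a i\<close> become stationary. Some \<open>a n\<close>
  is then killed modulo \<open>x\<close> by the intersection of the earlier \<open>p i\<close>. This
  intersection lies in the prime \<open>p n\<close>, against the incomparability of maximal
  elements.\<close>

lemma finite_max_colons: "finite max_colons"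
proof (rule ccontr)
  interpret noetherian_ring "ring_on A" by (rule noeth)
  assume "infinite max_colons"
  then obtain p :: "nat \<Rightarrow> 'a set" where p: "inj p" "range p \<subseteq> max_colons"
    using infinite_countable_subset by blast
  have "\<forall>n. \<exists>a. a \<in> A \<and> p n = colon a"
    using p(2) unfolding max_colons_def colons_def by blast
  then obtain a where a: "\<And>n. a n \<in> A" "\<And>n. p n = colon (a n)" by metis
  define I where "I n = genideal (ring_on A) (a ` {..<n})" for n
  have sub: "a ` {..<n} \<subseteq> carrier (ring_on A)" for n
    using a by auto
  have I: "ideal (I n) (ring_on A)" for n
    unfolding I_def using genideal_ideal sub by blast
  have mono: "I m \<subseteq> I n" if "m \<le> n" for m n
    unfolding I_def[of m]
  proof (rule genideal_minimal[OF I])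
    show "a ` {..<m} \<subseteq> I n"
      unfolding I_def using genideal_self[OF sub[of n]] that by force
  qed
  have "\<Union>(range I) \<in> range I"
  proof (rule ideal_chain_is_trivial)
    show "subset.chain {I. ideal I (ring_on A)} (range I)"
      unfolding subset_chain_def
    proof (intro conjI ballI)
      fix X Y assume "X \<in> range I" "Y \<in> range I"
      then obtain m n where "X = I m" "Y = I n" by blast
      then show "X \<subseteq> Y \<or> Y \<subseteq> X"
        using mono[of m n] mono[of n m] nle_le[of m n] by metis
    qed (use I in blast)
  qed simp
  then obtain n where "\<Union>(range I) = I n" by blast
  moreover have "a n \<in> I (Suc n)"
    unfolding I_def using genideal_self[OF sub[of "Suc n"]] by auto
  ultimately have an: "a n \<in> I n" by blast
  define K where "K = {y \<in> A. \<forall>i<n. y \<in> p i}"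
  have "I n \<subseteq> {b \<in> A. \<forall>y\<in>K. \<exists>c\<in>A. y * b = x * c}"
    unfolding I_def
  proof (rule genideal_minimal)
    show "ideal {b \<in> A. \<forall>y\<in>K. \<exists>c\<in>A. y * b = x * c} (ring_on A)"
      unfolding ideal_ring_on_iff[OF A]
    proof (intro conjI ballI)
      fix b c assume "b \<in> {b \<in> A. \<forall>y\<in>K. \<exists>c\<in>A. y * b = x * c}"
        "c \<in> {b \<in> A. \<forall>y\<in>K. \<exists>c\<in>A. y * b = x * c}"
      then show "b + c \<in> {b \<in> A. \<forall>y\<in>K. \<exists>c\<in>A. y * b = x * c}"
        using subring_set_add[OF A] by (auto simp: distrib_left) (metis distrib_left)
    next
      fix b c assume "b \<in> A" "c \<in> {b \<in> A. \<forall>y\<in>K. \<exists>c\<in>A. y * b = x * c}"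
      then show "b * c \<in> {b \<in> A. \<forall>y\<in>K. \<exists>c\<in>A. y * b = x * c}"
        using subring_set_mult[OF A] by auto (metis mult.left_commute)
    qed (use subring_set_zero[OF A] in auto)
    show "a ` {..<n} \<subseteq> {b \<in> A. \<forall>y\<in>K. \<exists>c\<in>A. y * b = x * c}"
      using a by (auto simp: K_def colon_def)
  qed
  then have Kp: "K \<subseteq> p n"
    using an a by (auto simp: K_def colon_def)
  have prime: "primeideal (p n) (ring_on A)"
    using max_colon_prime p(2) by blast
  note pn = prime[unfolded primeideal_ring_on_iff[OF A]]
  have "\<exists>y. y \<in> p i \<and> y \<notin> p n" if "i < n" for i
  proof (rule ccontr)
    assume "\<not> ?thesis"
    then have "p i \<subseteq> p n" by blast
    moreover have "p i \<in> max_colons" "p n \<in> colons"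
      using p(2) unfolding max_colons_def by auto
    ultimately have "p n = p i"
      unfolding max_colons_def by simp
    then show False using p(1) that by (auto dest: injD)
  qed
  then obtain y where y: "\<And>i. i < n \<Longrightarrow> y i \<in> p i \<and> y i \<notin> p n" by metis
  have pA: "p i \<subseteq> A" for i
    using a(2) by (auto simp: colon_def)
  have "prod y J \<in> A \<and> prod y J \<notin> p n" if "J \<subseteq> {..<n}" for J
    using finite_subset[OF that finite_lessThan] that
  proof (induction J rule: finite_induct)
    case empty
    then show ?case using pn subring_set_one[OF A] by simp
  next
    case (insert i J)
    then have "y i \<in> A" "y i \<notin> p n" using y pA by auto
    then show ?case
      using insert pn subring_set_mult[OF A] by auto
  qed
  then have "prod y {..<n} \<in> A" "prod y {..<n} \<notin> p n" by auto
  moreover have "prod y {..<n} \<in> p i" if "i < n" for i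
  proof -
    have "ideal (p i) (ring_on A)" using a ideal_colon by simp
    moreover have "prod y {..<n} = prod y ({..<n} - {i}) * y i"
      using prod.remove[of "{..<n}" i y] that by (simp add: mult.commute)
    moreover have "prod y ({..<n} - {i}) \<in> A"
      using y pA by (intro subring_set_prod[OF A]) blast
    ultimately show ?thesis
      using y[OF that] by (simp add: ideal_ring_on_iff[OF A])
  qed
  ultimately have "prod y {..<n} \<in> K" by (auto simp: K_def)
  then show False using Kp \<open>prod y {..<n} \<notin> p n\<close> by blast
qed

text \<open>Prime avoidance is easy here, because the primes to be avoided are pairwise incomparable.\<close>

lemma nonzerodivisor_exists:
  assumes P: "ideal P (ring_on A)"
    and crit: "\<And>a. a \<in> A \<Longrightarrow> \<forall>y\<in>P. \<exists>b\<in>A. y * a = x * b \<Longrightarrow> \<exists>b\<in>A. a = x * b"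
  shows "\<exists>y\<in>P. \<forall>a\<in>A. \<forall>b\<in>A. y * a = x * b \<longrightarrow> (\<exists>c\<in>A. a = x * c)"
proof -
  note P' = P[unfolded ideal_ring_on_iff[OF A]]
  have "\<exists>e. e \<in> P \<and> e \<notin> M" if M: "M \<in> max_colons" for M
  proof (rule ccontr)
    assume "\<not> ?thesis"
    then have "P \<subseteq> M" by blast
    obtain a where "a \<in> A" "\<not> (\<exists>b\<in>A. a = x * b)" "M = colon a"
      using M unfolding max_colons_def colons_def by blast
    then show False
      using crit[of a] \<open>P \<subseteq> M\<close> by (auto simp: colon_def)
  qed
  then obtain e where e: "\<And>M. M \<in> max_colons \<Longrightarrow> e M \<in> P \<and> e M \<notin> M" by metis
  have "\<exists>f. f \<in> N \<and> f \<notin> M" if "M \<in> max_colons" "N \<in> max_colons" "M \<noteq> N" for M N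
    using that unfolding max_colons_def by blast
  then obtain f where f: "\<And>M N. M \<in> max_colons \<Longrightarrow> N \<in> max_colons \<Longrightarrow> M \<noteq> N \<Longrightarrow> f M N \<in> N \<and> f M N \<notin> M"
    by metis
  have MA: "M \<subseteq> A" if "M \<in> max_colons" for M
    using that unfolding max_colons_def colons_def colon_def by blast
  \<comment> \<open>\<open>t M\<close> lies outside \<open>M\<close> but inside every other member
    of \<open>max_colons\<close>, so that the sum of all \<open>t M\<close> avoids each of
    them.\<close>
  define t where "t M = e M * (\<Prod>N\<in>max_colons - {M}. f M N)" for M
  have prodA: "(\<Prod>N\<in>J. f M N) \<in> A" if "M \<in> max_colons" "J \<subseteq> max_colons - {M}" for M J
    using that f MA by (intro subring_set_prod[OF A]) blast
  have tP: "t M \<in> P" if "M \<in> max_colons" for M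
    unfolding t_def using P' e[OF that] prodA[OF that order.refl] by (metis mult.commute)
  have t1: "t M \<notin> M" if M: "M \<in> max_colons" for M
  proof -
    note prime = max_colon_prime[OF M, unfolded primeideal_ring_on_iff[OF A]]
    have "(\<Prod>N\<in>J. f M N) \<notin> M" if "J \<subseteq> max_colons - {M}" for J
      using finite_subset[OF that] finite_max_colons that
    proof (induction J rule: infinite_finite_induct)
      case (insert N J)
      then have "f M N \<in> A" "f M N \<notin> M" "(\<Prod>N\<in>J. f M N) \<in> A"
        using f[OF M, of N] MA prodA[OF M, of J] by auto
      then show ?case using insert prime finite_max_colons by auto
    qed (use prime in auto)
    then show ?thesis
      unfolding t_def using prime e[OF M] prodA[OF M order.refl] P' by blast
  qed
  have t2: "t N \<in> M" if M: "M \<in> max_colons" and N: "N \<in> max_colons" and "N \<noteq> M" for M N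
  proof -
    note I = max_colon_prime[OF M, unfolded primeideal_ring_on_iff[OF A] ideal_ring_on_iff[OF A]]
    have "t N = (e N * (\<Prod>L\<in>max_colons - {N} - {M}. f N L)) * f N M"
      unfolding t_def using prod.remove[of "max_colons - {N}" M "f N"] that finite_max_colons
      by (simp add: mult_ac)
    moreover have "e N * (\<Prod>L\<in>max_colons - {N} - {M}. f N L) \<in> A"
      using e[OF N] P' prodA[OF N, of "max_colons - {N} - {M}"] by (intro subring_set_mult[OF A]) auto
    ultimately show ?thesis using I f[OF N M \<open>N \<noteq> M\<close>] by simp
  qed
  define y where "y = (\<Sum>M\<in>max_colons. t M)"
  have sum_ideal: "sum t J \<in> I" if "ideal I (ring_on A)" "\<And>M. M \<in> J \<Longrightarrow> t M \<in> I" for I J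
    using that(2) that(1)[unfolded ideal_ring_on_iff[OF A]]
    by (induction J rule: infinite_finite_induct) auto
  have yP: "y \<in> P"
    unfolding y_def using tP by (intro sum_ideal[OF P])
  have yM: "y \<notin> M" if M: "M \<in> max_colons" for M
  proof
    note I = max_colon_prime[OF M, unfolded primeideal_ring_on_iff[OF A]]
    note I' = conjunct1[OF I, unfolded ideal_ring_on_iff[OF A]]
    assume "y \<in> M"
    have "y = t M + sum t (max_colons - {M})"
      unfolding y_def using sum.remove[OF finite_max_colons M] .
    moreover have *: "sum t (max_colons - {M}) \<in> M"
      using I t2[OF M] by (intro sum_ideal) auto
    have "- 1 * sum t (max_colons - {M}) \<in> M"
      using I' * subring_set_minus[OF A subring_set_one[OF A]] by blast
    ultimately have "t M \<in> M"
      using I' \<open>y \<in> M\<close> by (metis add_diff_cancel_right' diff_conv_add_uminus mult_minus1)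
    then show False using t1[OF M] by blast
  qed
  have "\<exists>c\<in>A. a = x * c" if ab: "a \<in> A" "b \<in> A" "y * a = x * b" for a b
  proof (rule ccontr)
    assume "\<not> ?thesis"
    then have "colon a \<in> colons" using ab unfolding colons_def by blast
    then obtain M where "M \<in> max_colons" "colon a \<subseteq> M"
      using maximal_colon_exists unfolding max_colons_def by blast
    moreover have "y \<in> colon a"
      using ab yP P' by (auto simp: colon_def)
    ultimately show False using yM by blast
  qed
  then show ?thesis using yP by blast
qed

end

section \<open>Localisations and regular sequences of length at most two\<close>

lemma fractions_subring_set:
  assumes A: "subring_set A" and P: "primeideal P (ring_on A)"
  shows "subring_set (fractions A (A - P))"
proof -
  note P' = P[unfolded primeideal_ring_on_iff[OF A] ideal_ring_on_iff[OF A]]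
  have Fr: "Fract a s \<in> fractions A (A - P)" if "a \<in> A" "s \<in> A" "s \<notin> P" for a s
    using that by (auto simp: fractions_def)
  show ?thesis
    unfolding subring_set_def
  proof (intro conjI ballI)
    show "1 \<in> fractions A (A - P)"
      using Fr[OF subring_set_one[OF A] subring_set_one[OF A]] P' by (simp add: One_fract_def)
  next
    fix u v assume "u \<in> fractions A (A - P)" "v \<in> fractions A (A - P)"
    then obtain a s b t where u: "u = Fract a s" "a \<in> A" "s \<in> A" "s \<notin> P"
      and v: "v = Fract b t" "b \<in> A" "t \<in> A" "t \<notin> P"
      by (auto simp: fractions_def)
    have "s \<noteq> 0" "t \<noteq> 0" "s * t \<notin> P" "s * t \<in> A"
      using u v P' subring_set_mult[OF A] by auto
    then show "u - v \<in> fractions A (A - P)" "u * v \<in> fractions A (A - P)"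
      using u v subring_set_mult[OF A] subring_set_diff[OF A] by (auto intro!: Fr)
  qed
qed

lemma ideal_fractions:
  assumes A: "subring_set A" and P: "primeideal P (ring_on A)"
  shows "ideal (fractions P (A - P)) (ring_on (fractions A (A - P)))"
    and "1 \<notin> fractions P (A - P)"
proof -
  note P' = P[unfolded primeideal_ring_on_iff[OF A] ideal_ring_on_iff[OF A]]
  have Fr: "Fract a s \<in> fractions P (A - P)" if "a \<in> P" "s \<in> A" "s \<notin> P" for a s
    using that by (auto simp: fractions_def)
  show "ideal (fractions P (A - P)) (ring_on (fractions A (A - P)))"
    unfolding ideal_ring_on_iff[OF fractions_subring_set[OF A P]]
  proof (intro conjI ballI)
    show "0 \<in> fractions P (A - P)"
      using Fr[of 0 1] P' subring_set_one[OF A] by (simp add: Zero_fract_def)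
    show "fractions P (A - P) \<subseteq> fractions A (A - P)"
      using P' by (auto simp: fractions_def)
  next
    fix u v assume "u \<in> fractions P (A - P)" "v \<in> fractions P (A - P)"
    then obtain a s b t where u: "u = Fract a s" "a \<in> P" "s \<in> A" "s \<notin> P"
      and v: "v = Fract b t" "b \<in> P" "t \<in> A" "t \<notin> P"
      by (auto simp: fractions_def)
    have *: "s \<noteq> 0" "t \<noteq> 0" "s * t \<notin> P" "s * t \<in> A"
      using u v P' subring_set_mult[OF A] by auto
    have "t * a + s * b \<in> P"
      using u v P' by blast
    then show "u + v \<in> fractions P (A - P)"
      using u v * by (auto intro!: Fr simp: mult.commute)
  next
    fix u v assume "u \<in> fractions A (A - P)" "v \<in> fractions P (A - P)"
    then obtain a s b t where u: "u = Fract a s" "a \<in> A" "s \<in> A" "s \<notin> P"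
      and v: "v = Fract b t" "b \<in> P" "t \<in> A" "t \<notin> P"
      by (auto simp: fractions_def)
    have "s * t \<notin> P" "s * t \<in> A"
      using u v P' subring_set_mult[OF A] by auto
    then show "u * v \<in> fractions P (A - P)"
      using u v P' by (auto intro!: Fr)
  qed
  show "1 \<notin> fractions P (A - P)"
  proof
    assume "1 \<in> fractions P (A - P)"
    then obtain a s where "Fract a s = 1" "a \<in> P" "s \<in> A" "s \<notin> P"
      by (auto simp: fractions_def)
    moreover from this have "s \<noteq> 0" using P' by auto
    ultimately show False by (auto simp: One_fract_def eq_fract)
  qed
qed

lemma genideal_empty_ring_on: "subring_set A \<Longrightarrow> genideal (ring_on A) {} = {0}"
  using ring.genideal_minimal[OF ring_ring_on, of A "{0}" "{}"]
    ring.genideal_ideal[OF ring_ring_on, of A "{}"]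
    subring_set_zero[of A] by (auto simp: ideal_ring_on_iff)

lemma genideal_singleton_ring_on:
  assumes "subring_set A" "x \<in> A"
  shows "genideal (ring_on A) {x} = {x * b | b. b \<in> A}"
  using cring.cgenideal_eq_genideal[OF cring_ring_on[OF assms(1)], of x] assms(2)
  by (simp add: cgenideal_def mult.commute)

text \<open>The localisation is a domain, so a nonzero \<open>x\<close> is regular there. Clearing
  denominators turns a relation between \<open>x\<close> and \<open>y\<close> in the localisation
  into one in \<open>A\<close>, where \<open>y\<close> is a nonzerodivisor modulo
  \<open>x\<close>.\<close>

lemma depth_local_ge:
  assumes A: "subring_set A" and P: "primeideal P (ring_on A)"
    and x: "x \<in> P" "x \<noteq> 0"
  shows "depth (ring_on (fractions A (A - P))) (fractions P (A - P)) \<ge> 1"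
    and "y \<in> P \<Longrightarrow> (\<And>a b. a \<in> A \<Longrightarrow> b \<in> A \<Longrightarrow> y * a = x * b \<Longrightarrow> \<exists>c\<in>A. a = x * c) \<Longrightarrow>
      depth (ring_on (fractions A (A - P))) (fractions P (A - P)) \<ge> 2"
proof -
  note P' = P[unfolded primeideal_ring_on_iff[OF A] ideal_ring_on_iff[OF A]]
  define L where "L = fractions A (A - P)"
  define M where "M = fractions P (A - P)"
  note L = fractions_subring_set[OF A P, folded L_def]
  note M = ideal_fractions[OF A P, folded L_def M_def]
  note M' = M(1)[unfolded ideal_ring_on_iff[OF L]]
  interpret ring "ring_on L" by (rule ring_ring_on[OF L])
  have Fr: "Fract z 1 \<in> M" if "z \<in> P" for z
    using that subring_set_one[OF A] P' by (auto simp: M_def fractions_def)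
  have proper: "genideal (ring_on L) F \<noteq> L" if "F \<subseteq> M" for F
    using genideal_minimal[OF M(1) that] M(2) subring_set_one[OF L] by auto
  have x0: "Fract x 1 \<noteq> 0"
    using x(2) by (simp add: Zero_fract_def eq_fract)
  have ge: "enat (length xs) \<le> depth (ring_on L) M" if "regular_sequence (ring_on L) xs" "set xs \<subseteq> M" for xs
    unfolding depth_def using that by (intro Sup_upper) auto
  have "regular_sequence (ring_on L) [Fract x 1]"
    using Fr[OF x(1)] M' proper x0 by (auto simp: regular_sequence_def genideal_empty_ring_on[OF L])
  then show "depth (ring_on (fractions A (A - P))) (fractions P (A - P)) \<ge> 1"
    using ge[of "[Fract x 1]"] Fr[OF x(1)] by (simp add: L_def M_def one_enat_def)
  assume y: "y \<in> P" and reg: "\<And>a b. a \<in> A \<Longrightarrow> b \<in> A \<Longrightarrow> y * a = x * b \<Longrightarrow> \<exists>c\<in>A. a = x * c"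
  have "u \<in> {Fract x 1 * v | v. v \<in> L}" if u: "u \<in> L" and uv: "v \<in> L" "Fract y 1 * u = Fract x 1 * v" for u v
  proof -
    obtain a s b t where u: "u = Fract a s" "a \<in> A" "s \<in> A" "s \<notin> P"
      and v: "v = Fract b t" "b \<in> A" "t \<in> A" "t \<notin> P"
      using u uv(1) by (auto simp: L_def fractions_def)
    have *: "s \<noteq> 0" "t \<noteq> 0" "s * t \<notin> P" "s * t \<in> A"
      using u v P' subring_set_mult[OF A] by auto
    have "y * (a * t) = x * (b * s)"
      using uv(2) * by (simp add: u v eq_fract mult_ac)
    then obtain c where c: "c \<in> A" "a * t = x * c"
      using reg[of "a * t" "b * s"] u v subring_set_mult[OF A] by blast
    have "u = Fract x 1 * Fract c (s * t)"
      using c * by (simp add: u eq_fract mult_ac)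
    moreover have "Fract c (s * t) \<in> L"
      using c(1) * by (auto simp: L_def fractions_def)
    ultimately show ?thesis by blast
  qed
  moreover have "Fract x 1 \<in> L" using Fr[OF x(1)] M' by blast
  note genideal_singleton_ring_on[OF L this]
  ultimately have "regular_sequence (ring_on L) [Fract x 1, Fract y 1]"
    using Fr[OF x(1)] Fr[OF y] M' proper x0
    by (auto simp: regular_sequence_def less_Suc_eq genideal_empty_ring_on[OF L])
  then show "depth (ring_on (fractions A (A - P))) (fractions P (A - P)) \<ge> 2"
    using ge[of "[Fract x 1, Fract y 1]"] Fr[OF x(1)] Fr[OF y]
    by (simp add: L_def M_def numeral_eq_enat numeral_2_eq_2)
qed

text \<open>Height one only requires a nonzero element of \<open>P\<close>. For height at least two,
  \<open>crit\<close> says that \<open>P\<close> kills no nonzero class modulo \<open>x\<close>, so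
  \<open>P\<close> contains a nonzerodivisor modulo \<open>x\<close>; the prime \<open>Q\<close>
  strictly between zero and \<open>P\<close> comes from the chain that witnesses the height.\<close>

theorem serre_S2I:
  fixes A :: "'a::idom set"
  assumes A: "subring_set A" and noeth: "noetherian_ring (ring_on A)"
    and crit: "\<And>P Q a x. primeideal P (ring_on A) \<Longrightarrow> primeideal Q (ring_on A) \<Longrightarrow> Q \<subset> P \<Longrightarrow> Q \<noteq> {0} \<Longrightarrow>
      x \<in> A \<Longrightarrow> a \<in> A \<Longrightarrow> x \<noteq> 0 \<Longrightarrow> \<forall>y\<in>P. \<exists>b\<in>A. y * a = x * b \<Longrightarrow> \<exists>b\<in>A. a = x * b"
  shows "serre_S2 A"
  unfolding serre_S2_def
proof (intro conjI allI impI noeth)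
  fix P assume P: "primeideal P (ring_on A)"
  note P' = P[unfolded primeideal_ring_on_iff[OF A] ideal_ring_on_iff[OF A]]
  have chain: "\<exists>m Q. n \<le> m \<and> (\<forall>i\<le>m. primeideal (Q i) (ring_on A)) \<and>
      (\<forall>i<m. Q i \<subset> Q (Suc i)) \<and> Q m = P"
    if "n > 0" "enat n \<le> height (ring_on A) P" for n
  proof -
    \<comment> \<open>The height is a supremum, and only strictly below it is an actual chain
      available; its length \<open>m\<close> may exceed \<open>n\<close>.\<close>
    have "enat (n - 1) < height (ring_on A) P"
      using that by (metis Suc_ile_eq Suc_pred')
    then obtain m where m: "n - 1 < m" "\<exists>Q. (\<forall>i\<le>m. primeideal (Q i) (ring_on A)) \<and>
        (\<forall>i<m. Q i \<subset> Q (Suc i)) \<and> Q m = P"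
      unfolding height_def less_Sup_iff by (elim bexE CollectE exE conjE) (simp, blast)
    then have "n \<le> m" using that(1) by simp
    then show ?thesis using m(2) by blast
  qed
  have zero: "0 \<in> I" if "primeideal I (ring_on A)" for I
    using that by (simp add: primeideal_ring_on_iff[OF A] ideal_ring_on_iff[OF A])
  let ?d = "depth (ring_on (fractions A (A - P))) (fractions P (A - P))"
  consider "height (ring_on A) P = 0" | "1 \<le> height (ring_on A) P" "\<not> 2 \<le> height (ring_on A) P"
    | "2 \<le> height (ring_on A) P"
    by (metis ileI1 not_gr_zero one_eSuc)
  then show "min (height (ring_on A) P) 2 \<le> ?d"
  proof cases
    case 2
    then obtain m Q where *: "m \<ge> 1" "\<forall>i\<le>m. primeideal (Q i) (ring_on A)"
      "\<forall>i<m. Q i \<subset> Q (Suc i)" "Q m = P"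
      using chain[of 1] by (auto simp: one_enat_def)
    then have "Q (m - 1) \<subset> P" "primeideal (Q (m - 1)) (ring_on A)"
      by (metis Suc_diff_1 diff_Suc_less less_le_trans zero_less_one, simp)
    then obtain x where "x \<in> P" "x \<noteq> 0"
      using zero by blast
    then have "1 \<le> ?d" by (rule depth_local_ge(1)[OF A P])
    moreover have "height (ring_on A) P \<le> 1"
      using 2(2) by (cases "height (ring_on A) P") (auto simp: numeral_eq_enat one_enat_def)
    ultimately show ?thesis by (simp add: min.coboundedI1)
  next
    case 3
    then obtain m Q where *: "m \<ge> 2" "\<forall>i\<le>m. primeideal (Q i) (ring_on A)"
      "\<forall>i<m. Q i \<subset> Q (Suc i)" "Q m = P"
      using chain[of 2] by (auto simp: numeral_eq_enat)
    obtain n where n: "m = Suc (Suc n)" using *(1) by (metis add_2_eq_Suc le_Suc_ex)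
    \<comment> \<open>The last prime of the chain before \<open>P\<close>; it is nonzero because it
      strictly contains another prime.\<close>
    define Q1 where "Q1 = Q (Suc n)"
    have Q1: "Q1 \<subset> P" "primeideal Q1 (ring_on A)" "Q n \<subset> Q1" "primeideal (Q n) (ring_on A)"
      using * n by (auto simp: Q1_def)
    have "Q1 \<noteq> {0}"
      using Q1(3) zero[OF Q1(4)] by blast
    obtain x where x: "x \<in> P" "x \<noteq> 0"
      using Q1(1) zero[OF Q1(2)] by blast
    have "x \<in> A" using x P' by blast
    have "\<exists>y\<in>P. \<forall>a\<in>A. \<forall>b\<in>A. y * a = x * b \<longrightarrow> (\<exists>c\<in>A. a = x * c)"
      using crit[OF P Q1(2,1) \<open>Q1 \<noteq> {0}\<close> \<open>x \<in> A\<close> _ x(2)] P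
      by (intro nonzerodivisor_exists[OF A noeth \<open>x \<in> A\<close>]) (auto simp: primeideal_ring_on_iff[OF A])
    then have "2 \<le> ?d"
      using depth_local_ge(2)[OF A P x] by blast
    then show ?thesis by (simp add: min.coboundedI2)
  qed simp
qed

section \<open>Almost integral elements and monoid algebras\<close>

abbreviation "keys \<equiv> Poly_Mapping.keys"
abbreviation "lookup \<equiv> Poly_Mapping.lookup"
abbreviation "single \<equiv> Poly_Mapping.single"

text \<open>Let \<open>f = a / x\<close>, so that \<open>f * P\<close> lies in \<open>A\<close>. If
  \<open>f\<close> does not map \<open>P\<close> to itself, then \<open>u = f * y\<close> lies
  outside \<open>P\<close> for some \<open>y\<close> in \<open>P\<close>, and the identity
  \<open>w * u = y * (f * w)\<close> shows first that \<open>y\<close> is outside \<open>Q\<close>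
  and then that \<open>f\<close> maps \<open>Q\<close> to itself. Either way a nonzero ideal is
  stable under \<open>f\<close>, and any nonzero \<open>z\<close> in it is a common denominator for
  all powers of \<open>f\<close>.\<close>

lemma almost_integral_of_prime_chain:
  fixes A :: "'a::idom set"
  assumes A: "subring_set A"
    and P: "primeideal P (ring_on A)" and Q: "primeideal Q (ring_on A)" "Q \<subset> P" "Q \<noteq> {0}"
    and x: "x \<in> A" "x \<noteq> 0"
    and div: "\<forall>y\<in>P. \<exists>b\<in>A. y * a = x * b"
  shows "\<exists>z\<in>A. z \<noteq> 0 \<and> (\<forall>n. \<exists>y\<in>A. z * a ^ n = x ^ n * y)"
proof -
  note P' = P[unfolded primeideal_ring_on_iff[OF A] ideal_ring_on_iff[OF A]]
  note Q' = Q(1)[unfolded primeideal_ring_on_iff[OF A] ideal_ring_on_iff[OF A]]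
  have iterate: ?thesis if I: "I \<subseteq> A" "I \<noteq> {0}" "0 \<in> I" and step: "\<And>w. w \<in> I \<Longrightarrow> \<exists>w'\<in>I. w * a = x * w'" for I
  proof -
    obtain z where z: "z \<in> I" "z \<noteq> 0" using I by blast
    have "\<exists>y\<in>I. z * a ^ n = x ^ n * y" for n
    proof (induction n)
      case (Suc n)
      then obtain y where y: "y \<in> I" "z * a ^ n = x ^ n * y" by blast
      then obtain w where "w \<in> I" "y * a = x * w" using step by blast
      moreover from this y(2) have "z * a ^ Suc n = x ^ Suc n * w"
        by (simp add: mult_ac)
      ultimately show ?case by blast
    qed (use z in auto)
    then show ?thesis using z I by blast
  qed
  show ?thesis
  proof (cases "\<forall>y\<in>P. \<exists>b\<in>P. y * a = x * b")
    case True
    moreover have "P \<noteq> {0}" using Q(2) Q' by blast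
    ultimately show ?thesis
      using P' by (intro iterate[of P]) auto
  next
    case False
    then obtain y u where y: "y \<in> P" "y * a = x * u" "u \<in> A" "u \<notin> P"
      using div by blast
    have yA: "y \<in> A" using y P' by blast
    have cross: "w * u = y * w'" if "w * a = x * w'" for w w'
    proof -
      have "x * (w * u) = x * (y * w')"
        using that y(2) by (metis mult.left_commute)
      then show ?thesis using x(2) by simp
    qed
    have "y \<notin> Q"
    proof
      assume "y \<in> Q"
      have "w \<in> Q" if w: "w \<in> P" for w
      proof -
        obtain w' where w': "w' \<in> A" "w * a = x * w'" using div w by blast
        have "w * u \<in> Q"
          using cross[OF w'(2)] \<open>y \<in> Q\<close> w'(1) Q' by (metis mult.commute)
        moreover have "w \<in> A" using w P' by blast
        ultimately show ?thesis using Q' y(3,4) Q(2) by blast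
      qed
      then show False using Q(2) by blast
    qed
    show ?thesis
    proof (rule iterate[of Q])
      fix w assume w: "w \<in> Q"
      then obtain w' where w': "w' \<in> A" "w * a = x * w'" using div Q(2) by blast
      have "y * w' \<in> Q"
        using cross[OF w'(2)] w y(3) Q' by (metis mult.commute)
      then show "\<exists>w'\<in>Q. w * a = x * w'"
        using Q' yA w' \<open>y \<notin> Q\<close> by blast
    qed (use Q' Q in auto)
  qed
qed

section \<open>Leading monomials and completely integrally closed monoids\<close>

definition leading_mon :: "'k::field mpoly \<Rightarrow> nat \<Rightarrow>\<^sub>0 nat" where
  "leading_mon f = Max (keys f)"

lemma leading_mon_in_keys: "f \<noteq> 0 \<Longrightarrow> leading_mon f \<in> keys f"
  unfolding leading_mon_def by (intro Max_in) auto

lemma leading_mon_ge: "m \<in> keys f \<Longrightarrow> m \<le> leading_mon f"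
  unfolding leading_mon_def by simp

lemma leading_mon_eqI: "m \<in> keys f \<Longrightarrow> (\<And>m'. m' \<in> keys f \<Longrightarrow> m' \<le> m) \<Longrightarrow> leading_mon f = m"
  unfolding leading_mon_def by (intro Max_eqI) auto

lemma leading_mon_mult_aux:
  fixes f g :: "'k::field mpoly"
  assumes "f \<noteq> 0" "g \<noteq> 0"
  shows "lookup (f * g) (leading_mon f + leading_mon g) =
      lookup f (leading_mon f) * lookup g (leading_mon g)"
    and "m \<in> keys (f * g) \<Longrightarrow> m \<le> leading_mon f + leading_mon g"
proof -
  let ?m = "leading_mon f" and ?m' = "leading_mon g"
  define c where "c = lookup f ?m"
  define d where "d = lookup g ?m'"
  define f' where "f' = f - single ?m c"
  define g' where "g' = g - single ?m' d"
  have f': "m < ?m" if "m \<in> keys f'" for m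
  proof -
    have "m \<noteq> ?m" "m \<in> keys f"
      using that by (auto simp: f'_def c_def in_keys_iff lookup_minus lookup_single when_def split: if_splits)
    then show ?thesis using leading_mon_ge[of m f] by simp
  qed
  have g': "m < ?m'" if "m \<in> keys g'" for m
  proof -
    have "m \<noteq> ?m'" "m \<in> keys g"
      using that by (auto simp: g'_def d_def in_keys_iff lookup_minus lookup_single when_def split: if_splits)
    then show ?thesis using leading_mon_ge[of m g] by simp
  qed
  have eq: "f * g = single (?m + ?m') (c * d) + (single ?m c * g' + f' * g)"
    by (simp add: f'_def g'_def algebra_simps mult_single)
  have small: "m < ?m + ?m'" if "m \<in> keys (single ?m c * g' + f' * g)" for m
  proof -
    from that consider "m \<in> keys (single ?m c * g')" | "m \<in> keys (f' * g)"
      using keys_add[of "single ?m c * g'" "f' * g"] by blast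
    then show ?thesis
    proof cases
      case 1
      then obtain a b where "m = a + b" "a \<in> keys (single ?m c)" "b \<in> keys g'"
        using keys_mult by blast
      then show ?thesis using g' by (auto split: if_splits intro: add_strict_left_mono)
    next
      case 2
      then obtain a b where "m = a + b" "a \<in> keys f'" "b \<in> keys g"
        using keys_mult by blast
      then show ?thesis using f' leading_mon_ge by (auto intro: add_less_le_mono)
    qed
  qed
  have "lookup (single ?m c * g' + f' * g) (?m + ?m') = 0"
    using small by (metis in_keys_iff less_irrefl)
  then show "lookup (f * g) (?m + ?m') = lookup f ?m * lookup g ?m'"
    unfolding eq lookup_add by (simp add: c_def d_def)
  show "m \<le> ?m + ?m'" if "m \<in> keys (f * g)"
  proof -
    have "m \<in> keys (single (?m + ?m') (c * d)) \<or>
        m \<in> keys (single ?m c * g' + f' * g)"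
      using subsetD[OF keys_add that[unfolded eq]] unfolding Un_iff .
    then show ?thesis using small[of m] by (auto split: if_splits)
  qed
qed

lemma leading_mon_mult:
  fixes f g :: "'k::field mpoly"
  assumes "f \<noteq> 0" "g \<noteq> 0"
  shows "leading_mon (f * g) = leading_mon f + leading_mon g"
proof (rule leading_mon_eqI)
  show "leading_mon f + leading_mon g \<in> keys (f * g)"
    unfolding in_keys_iff leading_mon_mult_aux(1)[OF assms]
    using leading_mon_in_keys[of f] leading_mon_in_keys[of g] assms by (simp add: in_keys_iff)
qed (rule leading_mon_mult_aux(2)[OF assms])

lemma lookup_leading_mon_power:
  fixes f :: "'k::field mpoly"
  assumes "f \<noteq> 0"
  shows "lookup (leading_mon (f ^ n)) i = n * lookup (leading_mon f) i"
proof (induction n)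
  case 0
  have "leading_mon (1 :: 'k mpoly) = 0"
    by (rule leading_mon_eqI) auto
  then show ?case by simp
qed (use assms in \<open>simp add: leading_mon_mult lookup_add\<close>)

text \<open>The order is lexicographic with smaller indices weighing more. In infinitely many
  variables it is not well-founded, as the variables themselves form a descending sequence; on a
  finite \<open>V\<close> it embeds into the lexicographic order on lists of equal length.\<close>

lemma wf_mon_less:
  assumes "finite V"
  shows "wf {(m, m' :: nat \<Rightarrow>\<^sub>0 nat). keys m \<subseteq> V \<and> keys m' \<subseteq> V \<and> m < m'}"
proof (rule wf_subset)
  let ?vs = "sorted_list_of_set V"
  show "wf (inv_image (lex less_than) (\<lambda>m. map (lookup m) ?vs))"
    by (intro wf_inv_image wf_lex wf_less_than)
  show "{(m, m' :: nat \<Rightarrow>\<^sub>0 nat). keys m \<subseteq> V \<and> keys m' \<subseteq> V \<and> m < m'} \<subseteq>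
      inv_image (lex less_than) (\<lambda>m. map (lookup m) ?vs)"
  proof clarsimp
    fix m m' :: "nat \<Rightarrow>\<^sub>0 nat"
    assume m: "keys m \<subseteq> V" "keys m' \<subseteq> V" "m < m'"
    then obtain k where k: "lookup m k < lookup m' k" "\<And>i. i < k \<Longrightarrow> lookup m i = lookup m' i"
      unfolding less_poly_mapping.rep_eq less_fun_def by blast
    then have "k \<in> set ?vs"
      using m assms by (auto simp: in_keys_iff)
    then obtain us ws where vs: "?vs = us @ k # ws"
      by (meson split_list)
    have "sorted ?vs" "distinct ?vs" by auto
    then have "\<forall>i\<in>set us. i < k"
      unfolding vs by (auto simp: sorted_append order_less_le)
    then have "map (lookup m) us = map (lookup m') us"
      using k(2) by simp
    then show "(map (lookup m) ?vs, map (lookup m') ?vs) \<in> lex less_than"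
      unfolding vs lex_conv using k(1) by fastforce
  qed
qed

definition submonoid_set :: "'a::comm_monoid_add set \<Rightarrow> bool" where
  "submonoid_set S \<longleftrightarrow> 0 \<in> S \<and> (\<forall>x\<in>S. \<forall>y\<in>S. x + y \<in> S)"

definition monoid_algebra :: "(nat \<Rightarrow>\<^sub>0 nat) set \<Rightarrow> 'k::field mpoly set" where
  "monoid_algebra S = {f. keys f \<subseteq> S}"

lemma subring_set_monoid_algebra:
  assumes "submonoid_set S"
  shows "subring_set (monoid_algebra S)"
  unfolding subring_set_def monoid_algebra_def
proof (intro conjI ballI)
  fix f g :: "'k::field mpoly" assume fg: "f \<in> {f. keys f \<subseteq> S}" "g \<in> {f. keys f \<subseteq> S}"
  show "f - g \<in> {f. keys f \<subseteq> S}"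
    using fg keys_diff[of f g] by auto
  show "f * g \<in> {f. keys f \<subseteq> S}"
    using fg keys_mult[of f g] assms unfolding submonoid_set_def by blast
qed (use assms in \<open>auto simp: submonoid_set_def\<close>)

lemma single_in_monoid_algebra: "m \<in> S \<Longrightarrow> single m c \<in> monoid_algebra S"
  by (auto simp: monoid_algebra_def)

text \<open>In terms of differences: if \<open>w + n * (u - v)\<close> lies in \<open>S\<close> for
  all \<open>n\<close>, then so does \<open>u - v\<close>. Moving negative terms to the other side
  avoids the truncated subtraction of exponents.\<close>

definition completely_integrally_closed :: "(nat \<Rightarrow>\<^sub>0 nat) set \<Rightarrow> bool" where
  "completely_integrally_closed S \<longleftrightarrow> (\<forall>u\<in>S. \<forall>v\<in>S. \<forall>w\<in>S.
     (\<forall>n. \<exists>s\<in>S. \<forall>i. lookup w i + n * lookup u i = n * lookup v i + lookup s i) \<longrightarrow>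
     (\<exists>s\<in>S. u = v + s))"

text \<open>
  Among all \<open>a - b * q\<close> choose one with the smallest leading monomial. The hypothesis is
  inherited by it, so if it were not zero, then the complete integral closedness of \<open>S\<close> would
  show that its leading term can be cancelled by a multiple of \<open>b\<close>.
\<close>

theorem monoid_algebra_completely_integrally_closed:
  fixes a b z :: "'k::field mpoly"
  assumes S: "submonoid_set S" "completely_integrally_closed S"
    and V: "finite V" "\<And>s. s \<in> S \<Longrightarrow> keys s \<subseteq> V"
    and ab: "a \<in> monoid_algebra S" "b \<in> monoid_algebra S" "b \<noteq> 0"
    and z: "z \<in> monoid_algebra S" "z \<noteq> 0"
    and almost: "\<And>n. \<exists>y\<in>monoid_algebra S. z * a ^ n = b ^ n * y"
  shows "\<exists>q\<in>monoid_algebra S. a = b * q"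
proof (rule ccontr)
  let ?A = "monoid_algebra S :: 'k mpoly set"
  note A = subring_set_monoid_algebra[OF S(1), where 'a = 'k]
  assume no: "\<not> ?thesis"
  define R where "R = {a - b * q | q. q \<in> ?A}"
  have R0: "r \<noteq> 0" "r \<in> ?A" if "r \<in> R" for r
    using that no ab subring_set_diff[OF A] subring_set_mult[OF A] by (auto simp: R_def)
  have keysV: "keys (leading_mon r) \<subseteq> V" if "r \<in> R" for r
    using R0[OF that] leading_mon_in_keys V(2) by (auto simp: monoid_algebra_def)
  have "a - b * 0 \<in> R"
    unfolding R_def using subring_set_zero[OF A] by blast
  then obtain m where "m \<in> leading_mon ` R"
    and "\<forall>m'. (m', m) \<in> {(m, m' :: nat \<Rightarrow>\<^sub>0 nat). keys m \<subseteq> V \<and> keys m' \<subseteq> V \<and> m < m'} \<longrightarrow>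
      m' \<notin> leading_mon ` R"
    using wf_mon_less[OF V(1), unfolded wf_eq_minimal] by (metis (no_types, lifting) imageI)
  then obtain r where r: "r \<in> R" and min: "\<And>r'. r' \<in> R \<Longrightarrow> \<not> leading_mon r' < leading_mon r"
    using keysV by auto
  obtain q where q: "q \<in> ?A" "r = a - b * q" using r by (auto simp: R_def)
  \<comment> \<open>Passing from \<open>a\<close> to \<open>r\<close> changes the fraction
    \<open>a / b\<close> by the element \<open>q\<close> of the algebra, so the hypothesis on powers
    survives: each summand of the binomial expansion supplies the full factor
    \<open>b ^ n\<close>.\<close>
  have power: "\<exists>y\<in>?A. z * r ^ n = b ^ n * y" for n
  proof -
    obtain y where y: "\<And>k. y k \<in> ?A" "\<And>k. z * a ^ k = b ^ k * y k"
      using almost by metis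
    have "z * r ^ n = (\<Sum>k\<le>n. of_nat (n choose k) * (z * a ^ k) * (- (b * q)) ^ (n - k))"
      using binomial_ring[of a "- (b * q)" n] by (simp add: q(2) sum_distrib_left mult_ac)
    also have "\<dots> = (\<Sum>k\<le>n. b ^ n * (of_nat (n choose k) * y k * (- q) ^ (n - k)))"
    proof (rule sum.cong[OF refl])
      fix k assume "k \<in> {..n}"
      then have "b ^ n = b ^ k * b ^ (n - k)" by (simp flip: power_add)
      moreover have "(- (b * q)) ^ (n - k) = b ^ (n - k) * (- q) ^ (n - k)"
        by (simp flip: power_mult_distrib)
      ultimately show "of_nat (n choose k) * (z * a ^ k) * (- (b * q)) ^ (n - k) =
          b ^ n * (of_nat (n choose k) * y k * (- q) ^ (n - k))"
        by (simp add: y(2) mult_ac)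
    qed
    also have "\<dots> = b ^ n * (\<Sum>k\<le>n. of_nat (n choose k) * y k * (- q) ^ (n - k))"
      by (simp add: sum_distrib_left)
    finally have "z * r ^ n = b ^ n * (\<Sum>k\<le>n. of_nat (n choose k) * y k * (- q) ^ (n - k))" .
    moreover have "(\<Sum>k\<le>n. of_nat (n choose k) * y k * (- q) ^ (n - k)) \<in> ?A"
      using y(1) q(1)
      by (intro subring_set_sum[OF A] subring_set_mult[OF A] subring_set_of_nat[OF A]
          subring_set_power[OF A] subring_set_minus[OF A])
    ultimately show ?thesis by blast
  qed
  have lmS: "leading_mon f \<in> S" if "f \<in> ?A" "f \<noteq> 0" for f :: "'k mpoly"
    using leading_mon_in_keys[OF that(2)] that(1) by (auto simp: monoid_algebra_def)
  have "\<exists>s\<in>S. \<forall>i. lookup (leading_mon z) i + n * lookup (leading_mon r) i =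
      n * lookup (leading_mon b) i + lookup s i" for n
  proof -
    obtain y where y: "y \<in> ?A" "z * r ^ n = b ^ n * y" using power by blast
    have "y \<noteq> 0" using y(2) z(2) R0(1)[OF r] by auto
    have "leading_mon z + leading_mon (r ^ n) = leading_mon (b ^ n) + leading_mon y"
      using arg_cong[OF y(2), of leading_mon] z(2) R0(1)[OF r] ab(3) \<open>y \<noteq> 0\<close>
      by (simp add: leading_mon_mult)
    then have "\<forall>i. lookup (leading_mon z) i + n * lookup (leading_mon r) i =
        n * lookup (leading_mon b) i + lookup (leading_mon y) i"
      using R0(1)[OF r] ab(3) by (metis lookup_add lookup_leading_mon_power)
    then show ?thesis using lmS[OF y(1) \<open>y \<noteq> 0\<close>] by blast
  qed
  then obtain s where s: "s \<in> S" "leading_mon r = leading_mon b + s"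
    using S(2) lmS[OF R0(2)[OF r] R0(1)[OF r]] lmS[OF ab(2,3)] lmS[OF z]
    unfolding completely_integrally_closed_def by blast
  \<comment> \<open>Chosen so that \<open>b * t\<close> has the same leading term as
    \<open>r\<close>.\<close>
  define c where "c = lookup r (leading_mon r) / lookup b (leading_mon b)"
  define t where "t = single s c"
  define r' where "r' = r - b * t"
  have "lookup b (leading_mon b) \<noteq> 0" "lookup r (leading_mon r) \<noteq> 0"
    using leading_mon_in_keys ab(3) R0(1)[OF r] by (auto simp: in_keys_iff)
  then have c: "c \<noteq> 0" "lookup b (leading_mon b) * c = lookup r (leading_mon r)"
    by (auto simp: c_def)
  have t: "t \<noteq> 0" "leading_mon t = s" "lookup t s = c"
    using c(1) by (auto simp: t_def intro!: leading_mon_eqI) (metis lookup_single_eq lookup_zero)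
  have "r' = a - b * (q + t)"
    by (simp add: r'_def q algebra_simps)
  moreover have "q + t \<in> ?A"
    unfolding t_def using q(1) s(1) by (intro subring_set_add[OF A] single_in_monoid_algebra)
  ultimately have r': "r' \<in> R" by (auto simp: R_def)
  have "lookup (b * t) (leading_mon r) = lookup r (leading_mon r)"
    using leading_mon_mult_aux(1)[OF ab(3) t(1)] by (simp add: t s(2) c(2))
  then have "leading_mon r \<notin> keys r'"
    by (simp add: r'_def in_keys_iff lookup_minus)
  moreover have "m \<le> leading_mon r" if "m \<in> keys r'" for m
  proof -
    have "m \<in> keys r \<or> m \<in> keys (b * t)"
      using that keys_diff[of r "b * t"] by (auto simp: r'_def)
    then show ?thesis
      using leading_mon_ge[of m r] leading_mon_mult_aux(2)[OF ab(3) t(1), of m] by (auto simp: t s(2))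
  qed
  ultimately have "leading_mon r' < leading_mon r"
    using leading_mon_in_keys[OF R0(1)[OF r']] by (metis order_less_le)
  then show False using min[OF r'] by blast
qed

section \<open>Edge rings as Noetherian monoid algebras\<close>

inductive_set edge_monoid :: "nat set set \<Rightarrow> (nat \<Rightarrow>\<^sub>0 nat) set" for E where
  zero: "0 \<in> edge_monoid E"
| add: "e \<in> E \<Longrightarrow> s \<in> edge_monoid E \<Longrightarrow> (\<Sum>i\<in>e. single i 1) + s \<in> edge_monoid E"

abbreviation edge_vec :: "nat set \<Rightarrow> nat \<Rightarrow>\<^sub>0 nat" where
  "edge_vec e \<equiv> \<Sum>i\<in>e. single i 1"

lemma edge_vec_in_edge_monoid: "e \<in> E \<Longrightarrow> edge_vec e \<in> edge_monoid E"
  using edge_monoid.add[OF _ edge_monoid.zero, of e E] by simp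

lemma submonoid_edge_monoid: "submonoid_set (edge_monoid E)"
proof -
  have "s + t \<in> edge_monoid E" if "s \<in> edge_monoid E" "t \<in> edge_monoid E" for s t
    using that(1)
  proof induction
    case (add e s)
    then show ?case
      using edge_monoid.add[OF add.hyps(1) add.IH] by (simp only: add.assoc)
  qed (use that in simp)
  then show ?thesis by (auto simp: submonoid_set_def intro: edge_monoid.zero)
qed

lemma prod_var_eq: "(\<Prod>i\<in>e. var i) = (single (edge_vec e) 1 :: 'k::field mpoly)"
  by (induction e rule: infinite_finite_induct) (auto simp: var_def mult_single)

lemma subring_ring_on_iff:
  assumes "subring_set B"
  shows "subring H (ring_on B) \<longleftrightarrow> H \<subseteq> B \<and> subring_set H"
proof
  interpret cring "ring_on B" by (rule cring_ring_on[OF assms])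
  have minus: "a_inv (ring_on B) x = - x" if "x \<in> B" for x
    using minus_equality[of "- x" x] that subring_set_minus[OF assms] by simp
  {
    assume "subring H (ring_on B)"
    then interpret H: subring H "ring_on B" .
    have HB: "H \<subseteq> B" using H.subset by simp
    have "- x \<in> H" if "x \<in> H" for x
      using H.m_inv_closed[OF that] minus[OF subsetD[OF HB that]] by (simp add: a_inv_def)
    moreover have "x + y \<in> H" if "x \<in> H" "y \<in> H" for x y
      using subgroup.m_closed[OF H.subgroup_axioms that] by simp
    ultimately have "x - y \<in> H" if "x \<in> H" "y \<in> H" for x y
      using that by (metis diff_conv_add_uminus)
    then show "H \<subseteq> B \<and> subring_set H"
      using HB H.one_closed H.m_closed by (auto simp: subring_set_def)
  next
    assume "H \<subseteq> B \<and> subring_set H"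
    then show "subring H (ring_on B)"
      using minus subring_set_one subring_set_minus subring_set_mult subring_set_add
      by (intro subringI) (auto simp: subset_iff)
  }
qed

lemma polys_eq_monoid_algebra: "polys V = monoid_algebra {m. keys m \<subseteq> V}"
  by (auto simp: polys_def monoid_algebra_def)

lemma submonoid_keys_subset: "submonoid_set {m :: nat \<Rightarrow>\<^sub>0 nat. keys m \<subseteq> V}"
proof -
  have "keys (x + y) \<subseteq> V" if "keys x \<subseteq> V" "keys y \<subseteq> V" for x y :: "nat \<Rightarrow>\<^sub>0 nat"
    using keys_add[of x y] that by blast
  then show ?thesis by (simp add: submonoid_set_def)
qed

lemma keys_edge_vec: "finite e \<Longrightarrow> keys (edge_vec e) = e"
  by (auto simp: in_keys_iff lookup_sum lookup_single when_def split: if_splits)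

lemma keys_edge_monoid:
  assumes "\<And>e. e \<in> E \<Longrightarrow> finite e \<and> e \<subseteq> V" "s \<in> edge_monoid E"
  shows "keys s \<subseteq> V"
  using assms(2)
proof induction
  case (add e s)
  then show ?case
    using assms(1)[OF add(1)] keys_add[of "edge_vec e" s] keys_edge_vec[of e] by auto
qed simp

lemma poly_mapping_eq_sum_singles: "f = (\<Sum>m\<in>keys f. single m (lookup f m))"
  by (rule poly_mapping_eqI) (auto simp: lookup_sum lookup_single when_def in_keys_iff)

lemma edge_ring_eq:
  assumes "\<And>e. e \<in> E \<Longrightarrow> finite e \<and> e \<subseteq> V"
  shows "edge_ring V E = (monoid_algebra (edge_monoid E) :: 'k::field mpoly set)"
  unfolding edge_ring_def
proof (rule hull_unique)
  note polys = subring_set_monoid_algebra[OF submonoid_keys_subset, of V, folded polys_eq_monoid_algebra,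
      where 'a = 'k]
  let ?A = "monoid_algebra (edge_monoid E) :: 'k mpoly set"
  show "{prod var e | e. e \<in> E} \<subseteq> ?A"
    using edge_vec_in_edge_monoid by (auto simp: prod_var_eq intro!: single_in_monoid_algebra)
  show "range const \<subseteq> ?A \<and> subring ?A (ring_on (polys V))"
    unfolding subring_ring_on_iff[OF polys]
    using keys_edge_monoid[of E V] assms edge_monoid.zero
    by (auto simp: const_def polys_eq_monoid_algebra monoid_algebra_def split: if_splits
        intro: subring_set_monoid_algebra[OF submonoid_edge_monoid, unfolded monoid_algebra_def])
  fix B :: "'k mpoly set"
  assume gen: "{prod var e | e. e \<in> E} \<subseteq> B" and "range const \<subseteq> B \<and> subring B (ring_on (polys V))"
  then have B: "range const \<subseteq> B" "subring_set B"
    unfolding subring_ring_on_iff[OF polys] by auto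
  have mon: "single s 1 \<in> B" if "s \<in> edge_monoid E" for s
    using that
  proof induction
    case zero
    then show ?case using subring_set_one[OF B(2)] by simp
  next
    case (add e s)
    have "prod var e \<in> B" using gen add by blast
    then show ?case
      using subring_set_mult[OF B(2) _ add.IH, of "prod var e"] by (simp add: prod_var_eq mult_single)
  qed
  show "?A \<subseteq> B"
  proof
    fix f assume f: "f \<in> ?A"
    have "f = (\<Sum>m\<in>keys f. const (lookup f m) * single m 1)"
      by (subst poly_mapping_eq_sum_singles) (simp add: const_def mult_single)
    also have "\<dots> \<in> B"
      using mon f B(1) by (intro subring_set_sum[OF B(2)] subring_set_mult[OF B(2)]) (auto simp: monoid_algebra_def)
    finally show "f \<in> B" .
  qed
qed

text \<open>The base of the induction on the edges: this algebra is a copy of the field of constants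
  and has only the two trivial ideals.\<close>

lemma noetherian_scalars: "noetherian_ring (ring_on (monoid_algebra {0} :: 'k::field mpoly set))"
proof -
  let ?K = "monoid_algebra {0} :: 'k mpoly set"
  have K: "subring_set ?K"
    by (rule subring_set_monoid_algebra) (simp add: submonoid_set_def)
  interpret ring "ring_on ?K" by (rule ring_ring_on[OF K])
  show ?thesis
  proof (rule noetherian_ringI)
    fix I assume I: "ideal I (ring_on ?K)"
    note I' = I[unfolded ideal_ring_on_iff[OF K]]
    show "\<exists>A\<subseteq>carrier (ring_on ?K). finite A \<and> I = genideal (ring_on ?K) A"
    proof (cases "I = {0}")
      case True
      then show ?thesis
        using genideal_empty_ring_on[OF K] by (intro exI[of _ "{}"]) auto
    next
      case False
      then obtain f where f: "f \<in> I" "f \<noteq> 0" using I' by blast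
      then have "keys f \<subseteq> {0}" using I' by (auto simp: monoid_algebra_def)
      then have fs: "f = single 0 (lookup f 0)"
        by (intro poly_mapping_eqI) (auto simp: lookup_single when_def in_keys_iff)
      then have "lookup f 0 \<noteq> 0" using f(2) by (metis single_zero)
      have "single 0 (1 / lookup f 0) * f \<in> I"
        using I' f(1) by (auto simp: monoid_algebra_def)
      then have "1 \<in> I"
        using \<open>lookup f 0 \<noteq> 0\<close> by (subst (asm) fs) (simp add: mult_single)
      then have "I = ?K"
        using I' by (metis mult.right_neutral subsetI subset_antisym)
      then show ?thesis
        using genideal_one subring_set_one[OF K] by (intro exI[of _ "{1}"]) auto
    qed
  qed
qed

text \<open>A further edge adjoins one monomial. It may satisfy relations over the smaller algebra,
  which is why \<open>noetherian_poly_span\<close> concerns an arbitrary ring element instead of an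
  indeterminate.\<close>

lemma noetherian_edge_algebra:
  assumes "finite E"
  shows "noetherian_ring (ring_on (monoid_algebra (edge_monoid E) :: 'k::field mpoly set))"
  using assms
proof induction
  case empty
  have "edge_monoid {} = {0}"
    by (auto elim: edge_monoid.cases intro: edge_monoid.zero)
  then show ?case using noetherian_scalars by simp
next
  case (insert e E)
  let ?B = "monoid_algebra (edge_monoid E) :: 'k mpoly set"
  let ?C = "monoid_algebra (edge_monoid (insert e E)) :: 'k mpoly set"
  let ?x = "single (edge_vec e) 1 :: 'k mpoly"
  note B = subring_set_monoid_algebra[OF submonoid_edge_monoid, where 'a = 'k]
  define U where "U = (\<Union>n. poly_span ?B ?x n)"
  note U = subring_set_poly_span[OF B, of E ?x, folded U_def]
  have BU: "?B \<subseteq> U" unfolding U_def using base_in_poly_span[OF B] by blast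
  have xU: "?x \<in> U"
    unfolding U_def using poly_span_shift[OF B base_in_poly_span[OF B subring_set_one[OF B]], of ?x]
    unfolding mult_1_right by blast
  have "?C = U"
  proof
    have mon: "single s 1 \<in> U" if "s \<in> edge_monoid (insert e E)" for s
      using that
    proof induction
      case zero
      then show ?case using subring_set_one[OF U] by simp
    next
      case (add e' s)
      have "single (edge_vec e') 1 \<in> U"
      proof (cases "e' = e")
        case False
        then have "single (edge_vec e') 1 \<in> ?B"
          using add by (intro single_in_monoid_algebra edge_vec_in_edge_monoid) auto
        then show ?thesis using BU by blast
      qed (use xU in simp)
      then show ?case using subring_set_mult[OF U _ add.IH, of "single (edge_vec e') 1"]
        by (simp add: mult_single)
    qed
    show "?C \<subseteq> U"
    proof
      fix f assume f: "f \<in> ?C"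
      have "f = (\<Sum>m\<in>keys f. const (lookup f m) * single m 1)"
        by (subst poly_mapping_eq_sum_singles) (simp add: const_def mult_single)
      also have "\<dots> \<in> U"
      proof (intro subring_set_sum[OF U] subring_set_mult[OF U] mon)
        fix m
        show "const (lookup f m) \<in> U"
          unfolding const_def by (intro subsetD[OF BU] single_in_monoid_algebra edge_monoid.zero)
      qed (use f in \<open>auto simp: monoid_algebra_def\<close>)
      finally show "f \<in> U" .
    qed
    have sub: "edge_monoid E \<subseteq> edge_monoid (insert e E)"
    proof
      fix s assume "s \<in> edge_monoid E"
      then show "s \<in> edge_monoid (insert e E)"
        by induction (blast intro: edge_monoid.intros)+
    qed
    note C = subring_set_monoid_algebra[OF submonoid_edge_monoid, of "insert e E", where 'a = 'k]
    have "?x \<in> ?C"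
      by (intro single_in_monoid_algebra edge_vec_in_edge_monoid) simp
    moreover have "?B \<subseteq> ?C" using sub by (auto simp: monoid_algebra_def)
    ultimately have "poly_span ?B ?x n \<subseteq> ?C" for n
      by (induction n)
        (auto intro!: subring_set_zero[OF C] subring_set_add[OF C] subring_set_mult[OF C] subring_set_power[OF C])
    then show "U \<subseteq> ?C" unfolding U_def by blast
  qed
  then show ?case
    using noetherian_poly_span[OF B insert.IH, of ?x] unfolding U_def by simp
qed

section \<open>The edge monoid of a cactus of depth two\<close>

text \<open>Greedy choice: \<open>j\<close> receives the smallest admissible value that leaves at
  most \<open>sum hi I\<close> for the other indices. Parities agree throughout because everything
  moves in steps of two.\<close>

lemma parity_interpolation:
  fixes lo hi :: "'i \<Rightarrow> int"
  assumes "finite I" "\<And>i. i \<in> I \<Longrightarrow> lo i \<le> hi i" "\<And>i. i \<in> I \<Longrightarrow> even (hi i - lo i)"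
    and "sum lo I \<le> s" "s \<le> sum hi I" "even (s - sum hi I)"
  shows "\<exists>k. (\<forall>i\<in>I. lo i \<le> k i \<and> k i \<le> hi i \<and> even (k i - hi i)) \<and> sum k I = s"
  using assms
proof (induction I arbitrary: s rule: finite_induct)
  case (insert j I)
  define t where "t = max (lo j) (s - sum hi I)"
  have le: "sum lo I \<le> sum hi I"
    using insert.prems(1) by (intro sum_mono) simp
  have t: "lo j \<le> t" "t \<le> hi j" "even (t - hi j)"
    using insert.prems(1,2)[of j] insert.prems(4,5) insert.hyps by (auto simp: t_def max_def)
  have "\<exists>k. (\<forall>i\<in>I. lo i \<le> k i \<and> k i \<le> hi i \<and> even (k i - hi i)) \<and> sum k I = s - t"
  proof (rule insert.IH)
    show "sum lo I \<le> s - t" "s - t \<le> sum hi I"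
      using insert.prems(3) insert.hyps le by (auto simp: t_def)
    show "even (s - t - sum hi I)"
      using t(3) insert.prems(5) insert.hyps by (simp add: algebra_simps)
  qed (use insert.prems in auto)
  then obtain k where k: "\<forall>i\<in>I. lo i \<le> k i \<and> k i \<le> hi i \<and> even (k i - hi i)" "sum k I = s - t"
    by blast
  have "sum (k(j := t)) I = sum k I"
    using insert.hyps by (intro sum.cong) auto
  then show ?case
    using k t insert.hyps by (intro exI[of _ "k(j := t)"]) auto
qed simp

text \<open>The condition for weights at the corners of a triangle to be a sum of its edges.
  Nonnegativity of the weights follows by adding two of the inequalities.\<close>

definition tri :: "int \<Rightarrow> int \<Rightarrow> int \<Rightarrow> bool" where
  "tri r s k \<longleftrightarrow> k \<le> r + s \<and> r \<le> s + k \<and> s \<le> r + k \<and> even (r + s + k)"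

lemma edge_multiple_in_edge_monoid:
  assumes "{p, q} \<in> E" "p \<noteq> q"
  shows "single p n + single q n \<in> edge_monoid E"
proof (induction n)
  case (Suc n)
  have "single p (Suc n) + single q (Suc n) =
      edge_vec {p, q} + (single p n + single q n)"
    using assms(2) by (rule_tac poly_mapping_eqI) (auto simp: lookup_add lookup_single when_def)
  then show ?case using edge_monoid.add[OF assms(1) Suc.IH] by simp
qed (simp add: edge_monoid.zero)

lemma triangle_in_edge_monoid:
  assumes E: "{p, q} \<in> E" "{p, v} \<in> E" "{q, v} \<in> E" "p \<noteq> q" "p \<noteq> v" "q \<noteq> v" and "tri r s k"
  shows "single p (nat r) + single q (nat s) + single v (nat k)
    \<in> edge_monoid E"
proof -
  have "even (r + s + k)" using assms(7) by (simp only: tri_def)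
  then obtain l where l: "r + s + k = 2 * l" by (rule evenE)
  \<comment> \<open>Multiplicities of the edges \<open>{p, q}\<close>, \<open>{p, v}\<close> and
    \<open>{q, v}\<close>: half the total weight minus the weight of the opposite corner.\<close>
  define x y z where "x = nat (l - k)" "y = nat (l - s)" "z = nat (l - r)"
  have "nat r = x + y" "nat s = x + z" "nat k = y + z"
    using assms(7) l by (auto simp: tri_def x_y_z_def)
  then have "single p (nat r) + single q (nat s) + single v (nat k) =
      (single p x + single q x) +
      ((single p y + single v y) + (single q z + single v z))"
    by (simp add: single_add algebra_simps)
  then show ?thesis
    using edge_multiple_in_edge_monoid E submonoid_edge_monoid by (simp add: submonoid_set_def)
qed

lemma sum_in_submonoid: "submonoid_set S \<Longrightarrow> (\<And>i. i \<in> I \<Longrightarrow> f i \<in> S) \<Longrightarrow> sum f I \<in> S"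
  by (induction I rule: infinite_finite_induct) (auto simp: submonoid_set_def)

abbreviation vec :: "(nat \<Rightarrow>\<^sub>0 nat) \<Rightarrow> nat \<Rightarrow> int" where
  "vec m \<equiv> \<lambda>v. int (lookup m v)"

lemma vec_add: "vec (m + m') = (\<lambda>v. vec m v + vec m' v)"
  by (simp add: lookup_add)

lemma vec_edge_vec: "finite e \<Longrightarrow> vec (edge_vec e) = (\<lambda>v. of_bool (v \<in> e))"
  by (auto simp: lookup_sum lookup_single when_def)

text \<open>
  Vertices at distance \<open>1\<close> and \<open>2\<close> from the centre \<open>c\<close> form the sets \<open>N\<close> and \<open>Z\<close>; the two
  vertices other than the one nearest to \<open>c\<close> of a triangle are each other's \<open>mate\<close>, and \<open>par z\<close>
  is the neighbour of \<open>z\<close> closer to \<open>c\<close>.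
\<close>

locale shallow_cactus =
  fixes c :: nat and N Z :: "nat set" and mate par :: "nat \<Rightarrow> nat"
  assumes finite_N: "finite N" and finite_Z: "finite Z"
    and c_notin: "c \<notin> N" "c \<notin> Z" and disjoint: "N \<inter> Z = {}"
    and mate_N: "n \<in> N \<Longrightarrow> mate n \<in> N" "n \<in> N \<Longrightarrow> mate n \<noteq> n" "n \<in> N \<Longrightarrow> mate (mate n) = n"
    and mate_Z: "z \<in> Z \<Longrightarrow> mate z \<in> Z" "z \<in> Z \<Longrightarrow> mate z \<noteq> z" "z \<in> Z \<Longrightarrow> mate (mate z) = z"
    and par: "z \<in> Z \<Longrightarrow> par z \<in> N" "z \<in> Z \<Longrightarrow> par (mate z) = par z"
begin

definition verts :: "nat set" where
  "verts = insert c (N \<union> Z)"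

definition edges :: "nat set set" where
  "edges = (\<lambda>n. {c, n}) ` N \<union> (\<lambda>n. {n, mate n}) ` N \<union> (\<lambda>z. {z, par z}) ` Z \<union> (\<lambda>z. {z, mate z}) ` Z"

text \<open>An element stands for a triangle at \<open>c\<close>; the comparison selects one of its
  two other vertices. The same device is used in \<open>outer\<close>.\<close>

definition branches :: "nat set" where
  "branches = {n \<in> N. n < mate n}"

definition outer :: "nat \<Rightarrow> nat set" where
  "outer n = {z \<in> Z. par z = n \<and> z < mate z}"

definition branch :: "nat \<Rightarrow> nat set" where
  "branch i = {i, mate i} \<union> {z \<in> Z. par z = i \<or> par z = mate i}"

text \<open>
  Removing the edges of the outer triangles at \<open>n\<close> from \<open>X\<close> leaves at \<open>n\<close> a value between \<open>lo X n\<close>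
  and \<open>hi X n\<close>. All values of the right parity in this range occur as long as they are nonnegative;
  \<open>lo X n\<close> itself may be negative. Then \<open>valid X i k\<close> says that branch \<open>i\<close> of \<open>X\<close> can be covered using
  exactly \<open>k\<close> edges to \<open>c\<close>, and \<open>need X i\<close> is the smallest such \<open>k\<close>.
\<close>

definition dd :: "(nat \<Rightarrow> int) \<Rightarrow> nat \<Rightarrow> int" where
  "dd X n = (\<Sum>z\<in>outer n. \<bar>X z - X (mate z)\<bar>)"

definition ww :: "(nat \<Rightarrow> int) \<Rightarrow> nat \<Rightarrow> int" where
  "ww X n = (\<Sum>z\<in>outer n. X z + X (mate z))"

definition hi :: "(nat \<Rightarrow> int) \<Rightarrow> nat \<Rightarrow> int" where
  "hi X n = X n - dd X n"

definition lo :: "(nat \<Rightarrow> int) \<Rightarrow> nat \<Rightarrow> int" where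
  "lo X n = X n - ww X n"

text \<open>The coordinate sum over the branch. Its parity is that of the number of edges used
  between the branch and \<open>c\<close>, since all other edges of the branch contribute
  two.\<close>

definition tot :: "(nat \<Rightarrow> int) \<Rightarrow> nat \<Rightarrow> int" where
  "tot X i = X i + X (mate i) + ww X i + ww X (mate i)"

definition exc :: "(nat \<Rightarrow> int) \<Rightarrow> nat \<Rightarrow> int" where
  "exc X i = max 0 (max (lo X i - hi X (mate i)) (lo X (mate i) - hi X i))"

definition need :: "(nat \<Rightarrow> int) \<Rightarrow> nat \<Rightarrow> int" where
  "need X i = max (tot X i mod 2) (exc X i)"

definition valid :: "(nat \<Rightarrow> int) \<Rightarrow> nat \<Rightarrow> int \<Rightarrow> bool" where
  "valid X i k \<longleftrightarrow> 0 \<le> hi X i \<and> 0 \<le> hi X (mate i) \<and> exc X i \<le> k \<and>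
     k \<le> hi X i + hi X (mate i) \<and> even (tot X i + k)"

lemma outerD: "z \<in> outer n \<Longrightarrow> z \<in> Z" "z \<in> outer n \<Longrightarrow> par z = n"
  by (auto simp: outer_def)

lemma finite_outer: "finite (outer n)"
  using finite_Z by (simp add: outer_def)

lemma branchesD: "i \<in> branches \<Longrightarrow> i \<in> N"
  by (auto simp: branches_def)

lemma finite_branches: "finite branches"
  using finite_N by (simp add: branches_def)

lemma even_ww_dd: "even (ww X n - dd X n)"
  unfolding ww_def dd_def sum_subtractf[symmetric] by (intro dvd_sum) auto

lemma dd_le_ww:
  assumes "\<And>z. z \<in> Z \<Longrightarrow> 0 \<le> X z"
  shows "dd X n \<le> ww X n"
  unfolding dd_def ww_def
proof (rule sum_mono)
  fix z assume "z \<in> outer n"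
  then show "\<bar>X z - X (mate z)\<bar> \<le> X z + X (mate z)"
    using assms[of z] assms[of "mate z"] mate_Z(1) outerD(1) by force
qed

lemma even_hi_tot: "even (hi X i + hi X (mate i) + tot X i)"
  using even_ww_dd[of X i] even_ww_dd[of X "mate i"] by (simp add: hi_def tot_def)

lemma sum_N: "(\<Sum>n\<in>N. f n) = (\<Sum>i\<in>branches. f i + f (mate i))"
proof -
  have N: "N = branches \<union> mate ` branches"
    using mate_N by (auto simp: branches_def image_iff) (metis linorder_neqE_nat)
  have inj: "inj_on mate branches"
    using mate_N(3) by (metis branchesD inj_onI)
  have "branches \<inter> mate ` branches = {}"
    using mate_N(3) by (auto simp: branches_def)
  then have "(\<Sum>n\<in>N. f n) = sum f branches + sum f (mate ` branches)"
    using finite_branches by (subst N, subst sum.union_disjoint) auto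
  then show ?thesis by (simp add: sum.reindex[OF inj] sum.distrib)
qed

lemma sum_Z: "(\<Sum>z\<in>Z. f z) = (\<Sum>n\<in>N. \<Sum>z\<in>outer n. f z + f (mate z))"
proof -
  define R where "R = {z \<in> Z. z < mate z}"
  have R: "finite R" "R = (\<Union>n\<in>N. outer n)"
    using finite_Z par(1) by (auto simp: R_def outer_def)
  have Z: "Z = R \<union> mate ` R"
    using mate_Z by (auto simp: R_def image_iff) (metis linorder_neqE_nat)
  have inj: "inj_on mate R"
    using mate_Z(3) by (metis (no_types, lifting) R_def inj_onI mem_Collect_eq)
  have "R \<inter> mate ` R = {}"
    using mate_Z(3) by (auto simp: R_def)
  then have "(\<Sum>z\<in>Z. f z) = sum f R + sum f (mate ` R)"
    using R(1) by (subst Z, subst sum.union_disjoint) auto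
  also have "\<dots> = (\<Sum>z\<in>R. f z + f (mate z))"
    by (simp add: sum.reindex[OF inj] sum.distrib)
  also have "\<dots> = (\<Sum>n\<in>N. \<Sum>z\<in>outer n. f z + f (mate z))"
    unfolding R(2) using finite_N finite_outer by (intro sum.UNION_disjoint) (auto simp: outer_def)
  finally show ?thesis .
qed

lemma linear_parts:
  "ww (\<lambda>v. X v + Y v) n = ww X n + ww Y n"
  "lo (\<lambda>v. X v + Y v) n = lo X n + lo Y n"
  "tot (\<lambda>v. X v + Y v) n = tot X n + tot Y n"
  by (simp_all add: ww_def lo_def tot_def sum.distrib)

lemma dd_add: "dd (\<lambda>v. X v + Y v) n \<le> dd X n + dd Y n"
  unfolding dd_def sum.distrib[symmetric] by (rule sum_mono) auto

lemma hi_add: "hi X n + hi Y n \<le> hi (\<lambda>v. X v + Y v) n"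
  using dd_add[of X Y n] by (simp add: hi_def)

lemma exc_add: "exc (\<lambda>v. X v + Y v) i \<le> exc X i + exc Y i"
  using hi_add[of X i Y] hi_add[of X "mate i" Y] unfolding exc_def linear_parts by linarith

text \<open>The absolute values in \<open>dd\<close> make \<open>hi\<close> superadditive and
  \<open>exc\<close> subadditive, so the interval for the sum contains the sum of the
  intervals.\<close>

lemma valid_add:
  assumes "valid X i k" "valid Y i l"
  shows "valid (\<lambda>v. X v + Y v) i (k + l)"
  using assms exc_add[of X Y i] hi_add[of X i Y] hi_add[of X "mate i" Y]
  by (auto simp: valid_def linear_parts)

text \<open>Allows the branches to be modified independently of each other.\<close>

lemma local_cong:
  assumes i: "i \<in> N" and eq: "\<And>v. v \<in> branch i \<Longrightarrow> X v = Y v"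
  shows "hi X i = hi Y i" "hi X (mate i) = hi Y (mate i)" "tot X i = tot Y i" "exc X i = exc Y i"
    "need X i = need Y i" "valid X i k = valid Y i k"
proof -
  have "dd X n = dd Y n" "ww X n = ww Y n" "X n = Y n" if "n = i \<or> n = mate i" for n
    using that eq par mate_Z(1) unfolding dd_def ww_def
    by (auto intro!: sum.cong arg_cong2[where f = minus] arg_cong2[where f = plus] arg_cong[where f = abs]
        simp: outer_def branch_def)
  then show "hi X i = hi Y i" "hi X (mate i) = hi Y (mate i)" "tot X i = tot Y i" "exc X i = exc Y i"
    "need X i = need Y i" "valid X i k = valid Y i k"
    by (simp_all add: hi_def lo_def tot_def exc_def need_def valid_def)
qed

lemma valid_zero: "valid (\<lambda>_. 0) i 0"
  by (simp add: valid_def hi_def lo_def dd_def ww_def exc_def tot_def)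

lemma outer_rep: "z \<in> Z \<Longrightarrow> w \<in> outer n \<Longrightarrow> w = z \<or> mate w = z \<longleftrightarrow> w = min z (mate z)"
  using mate_Z(3)[of z] mate_Z(3)[of w] by (auto simp: outer_def min_def)

lemma sum_outer_indicator:
  assumes "z \<in> Z"
  shows "(\<Sum>w\<in>outer n. of_bool (w = z \<or> mate w = z)) = (of_bool (n = par z) :: int)"
proof -
  have "(\<Sum>w\<in>outer n. of_bool (w = z \<or> mate w = z)) = (\<Sum>w\<in>outer n. if w = min z (mate z) then 1 else 0 :: int)"
    using outer_rep[OF assms] by (intro sum.cong) auto
  also have "\<dots> = of_bool (min z (mate z) \<in> outer n)"
    using finite_outer by (simp add: sum.delta)
  also have "min z (mate z) \<in> outer n \<longleftrightarrow> n = par z"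
    using assms mate_Z[OF assms] par[OF assms] by (auto simp: outer_def min_def)
  finally show ?thesis .
qed

text \<open>The witness \<open>k i\<close> tells whether the edge joins \<open>c\<close> to branch
  \<open>i\<close>; it vanishes for all edges that do not contain \<open>c\<close>.\<close>

lemma edge_valid:
  assumes "e \<in> edges"
  shows "\<exists>k. sum k branches = vec (edge_vec e) c \<and> (\<forall>i\<in>branches. valid (vec (edge_vec e)) i (k i))"
proof -
  have fin: "finite e" using assms by (auto simp: edges_def)
  define X where "X = vec (edge_vec e)"
  have X: "X v = of_bool (v \<in> e)" for v
    using vec_edge_vec[OF fin] by (simp add: X_def fun_eq_iff)
  have NZ: "n \<noteq> z" "mate n \<noteq> z" if "n \<in> N" "z \<in> Z" for n z
    using that disjoint mate_N(1) by auto
  consider (centre) n where "n \<in> N" "e = {c, n}" | (inner) n where "n \<in> N" "e = {n, mate n}"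
    | (radial) z where "z \<in> Z" "e = {z, par z}" | (outer) z where "z \<in> Z" "e = {z, mate z}"
    using assms by (auto simp: edges_def)
  then have "\<exists>k. sum k branches = X c \<and> (\<forall>i\<in>branches. valid X i (k i))"
  proof cases
    case centre
    have zero: "X z = 0" "X (mate z) = 0" if "z \<in> outer m" for z m
    proof -
      have z: "z \<in> Z" "mate z \<in> Z" using outerD(1)[OF that] mate_Z(1) by auto
      show "X z = 0" "X (mate z) = 0"
        using NZ[OF centre(1) z(1)] NZ[OF centre(1) z(2)] z c_notin centre(2) by (auto simp: X)
    qed
    then have dw: "dd X m = 0" "ww X m = 0" for m
      by (simp_all add: dd_def ww_def)
    define k where "k i = X i + X (mate i)" for i
    have "sum k branches = sum X N"
      by (simp add: sum_N k_def)
    also have "\<dots> = (\<Sum>m\<in>N. if m = n then 1 else 0)"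
      using centre c_notin by (intro sum.cong) (auto simp: X)
    also have "\<dots> = X c"
      using centre finite_N by (simp add: X)
    finally have "sum k branches = X c" .
    moreover have "valid X i (k i)" if "i \<in> branches" for i
      using dw by (simp add: valid_def hi_def lo_def exc_def tot_def k_def X)
    ultimately show ?thesis by blast
  next
    case inner
    have zero: "X z = 0" "X (mate z) = 0" if "z \<in> outer m" for z m
    proof -
      have z: "z \<in> Z" "mate z \<in> Z" using outerD(1)[OF that] mate_Z(1) by auto
      show "X z = 0" "X (mate z) = 0"
        using NZ[OF inner(1) z(1)] NZ[OF inner(1) z(2)] inner(2) by (auto simp: X)
    qed
    then have dw: "dd X m = 0" "ww X m = 0" for m
      by (simp_all add: dd_def ww_def)
    have "X i = X (mate i)" if "i \<in> branches" for i
    proof -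
      have "mate i = n \<longleftrightarrow> i = mate n" "mate i = mate n \<longleftrightarrow> i = n"
        using mate_N(3)[OF inner(1)] mate_N(3)[OF branchesD[OF that]] by metis+
      then show ?thesis by (simp add: X inner(2) disj_commute)
    qed
    then have "valid X i 0" if "i \<in> branches" for i
      using that dw by (auto simp: valid_def hi_def lo_def exc_def tot_def X)
    then show ?thesis
      using inner c_notin mate_N by (intro exI[of _ "\<lambda>_. 0"]) (auto simp: X)
  next
    case radial
    have eq: "X w + X (mate w) = of_bool (w = z \<or> mate w = z)"
      "\<bar>X w - X (mate w)\<bar> = of_bool (w = z \<or> mate w = z)" if "w \<in> outer m" for w m
    proof -
      have w: "w \<in> Z" "mate w \<in> Z" using outerD(1)[OF that] mate_Z(1) by auto
      show "X w + X (mate w) = of_bool (w = z \<or> mate w = z)"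
        "\<bar>X w - X (mate w)\<bar> = of_bool (w = z \<or> mate w = z)"
        using NZ(1)[OF par(1)[OF radial(1)] w(1)] NZ(1)[OF par(1)[OF radial(1)] w(2)] mate_Z(2)[OF w(1)]
        by (auto simp: X radial(2))
    qed
    then have dw: "dd X m = of_bool (m = par z)" "ww X m = of_bool (m = par z)" for m
      unfolding dd_def ww_def sum_outer_indicator[OF radial(1), symmetric] by (auto intro: sum.cong)
    have "X i = of_bool (i = par z)" "X (mate i) = of_bool (mate i = par z)" if "i \<in> branches" for i
      using radial NZ branchesD[OF that] by (auto simp: X)
    then have "valid X i 0" if "i \<in> branches" for i
      using that dw by (auto simp: valid_def hi_def lo_def exc_def tot_def)
    moreover have "X c = 0"
      using radial c_notin par(1) by (auto simp: X)
    ultimately show ?thesis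
      by (intro exI[of _ "\<lambda>_. 0"]) auto
  next
    case outer
    have eq: "X w + X (mate w) = 2 * of_bool (w = z \<or> mate w = z)"
      "\<bar>X w - X (mate w)\<bar> = 0" if "w \<in> outer m" for w m
    proof -
      have "mate w = z \<longleftrightarrow> w = mate z" "mate w = mate z \<longleftrightarrow> w = z"
        using mate_Z(3)[OF outer(1)] mate_Z(3)[OF outerD(1)[OF that]] by metis+
      then show "X w + X (mate w) = 2 * of_bool (w = z \<or> mate w = z)" "\<bar>X w - X (mate w)\<bar> = 0"
        using mate_Z(2)[OF outer(1)] by (simp_all add: X outer(2) disj_commute)
    qed
    then have dw: "dd X m = 0" "ww X m = 2 * of_bool (m = par z)" for m
      unfolding dd_def ww_def sum_outer_indicator[OF outer(1), symmetric] sum_distrib_left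
      by (auto intro: sum.cong)
    have "X i = 0" "X (mate i) = 0" if "i \<in> branches" for i
      using NZ[OF branchesD[OF that] outer(1)] NZ[OF branchesD[OF that] mate_Z(1)[OF outer(1)]]
      by (simp_all add: X outer(2))
    then have "valid X i 0" if "i \<in> branches" for i
      using that dw by (auto simp: valid_def hi_def lo_def exc_def tot_def)
    moreover have "X c = 0"
      using outer c_notin mate_Z(1) by (auto simp: X)
    ultimately show ?thesis
      by (intro exI[of _ "\<lambda>_. 0"]) auto
  qed
  then show ?thesis by (simp only: X_def)
qed

lemma edges_subset: "e \<in> edges \<Longrightarrow> finite e \<and> e \<subseteq> verts"
  using mate_N(1) mate_Z(1) par(1) by (auto simp: edges_def verts_def)

lemma edge_monoid_valid:
  assumes "m \<in> edge_monoid edges"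
  shows "\<exists>k. sum k branches = vec m c \<and> (\<forall>i\<in>branches. valid (vec m) i (k i))"
  using assms
proof induction
  case zero
  then show ?case using valid_zero by (intro exI[of _ "\<lambda>_. 0"]) auto
next
  case (add e s)
  then obtain k l where "sum k branches = vec (edge_vec e) c" "\<forall>i\<in>branches. valid (vec (edge_vec e)) i (k i)"
    "sum l branches = vec s c" "\<forall>i\<in>branches. valid (vec s) i (l i)"
    using edge_valid by metis
  then show ?case
    unfolding vec_add by (intro exI[of _ "\<lambda>i. k i + l i"]) (auto simp: sum.distrib lookup_add intro: valid_add)
qed

lemma outer_distribution:
  assumes X: "\<And>z. z \<in> Z \<Longrightarrow> 0 \<le> X z" and s: "dd X n \<le> s" "s \<le> ww X n" "even (s - ww X n)"
  shows "\<exists>k. (\<forall>z\<in>outer n. tri (X z) (X (mate z)) (k z)) \<and> sum k (outer n) = s"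
proof -
  have "\<exists>k. (\<forall>z\<in>outer n. \<bar>X z - X (mate z)\<bar> \<le> k z \<and> k z \<le> X z + X (mate z) \<and> even (k z - (X z + X (mate z))))
      \<and> sum k (outer n) = s"
  proof (rule parity_interpolation[OF finite_outer])
    fix z assume "z \<in> outer n"
    then have "0 \<le> X z" "0 \<le> X (mate z)" using X outerD(1) mate_Z(1) by blast+
    then show "\<bar>X z - X (mate z)\<bar> \<le> X z + X (mate z)" by simp
  qed (use s in \<open>auto simp: dd_def ww_def\<close>)
  then show ?thesis
    by (elim exE conjE, intro exI conjI ballI) (auto simp: tri_def abs_le_iff)
qed

text \<open>Keep the largest values that the outer triangles can leave at the two vertices. If they
  violate a triangle inequality with \<open>k\<close>, lower the bigger one just enough; the bound
  of \<open>k\<close> by \<open>exc X i\<close> keeps the lowered value above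
  \<open>lo\<close>.\<close>

lemma inner_distribution:
  assumes "valid X i k" "\<And>z. z \<in> Z \<Longrightarrow> 0 \<le> X z"
  shows "\<exists>r r'. tri r r' k \<and> 0 \<le> r \<and> lo X i \<le> r \<and> r \<le> hi X i \<and> even (r - hi X i) \<and>
    0 \<le> r' \<and> lo X (mate i) \<le> r' \<and> r' \<le> hi X (mate i) \<and> even (r' - hi X (mate i))"
proof -
  let ?a = "hi X i" and ?b = "hi X (mate i)"
  have le: "lo X n \<le> hi X n" for n
    using dd_le_ww[of X n] assms(2) by (simp add: hi_def lo_def)
  have par: "even (?a + ?b + k)"
    using assms(1) even_hi_tot[of X i] unfolding valid_def by presburger
  have v: "0 \<le> ?a" "0 \<le> ?b" "0 \<le> k" "lo X i \<le> ?b + k" "lo X (mate i) \<le> ?a + k" "k \<le> ?a + ?b"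
    using assms(1) by (auto simp: valid_def exc_def)
  consider "?a \<le> ?b + k" "?b \<le> ?a + k" | "?a > ?b + k" | "?b > ?a + k" by linarith
  then show ?thesis
  proof cases
    case 1
    then show ?thesis
      using v le par by (intro exI[of _ ?a] exI[of _ ?b]) (auto simp: tri_def)
  next
    case 2
    have "even (?b + k - ?a)" using par by presburger
    with 2 show ?thesis
      using v le by (intro exI[of _ "?b + k"] exI[of _ ?b]) (auto simp: tri_def)
  next
    case 3
    have "even (?a + k - ?b)" using par by presburger
    with 3 show ?thesis
      using v le by (intro exI[of _ ?a] exI[of _ "?a + k"]) (auto simp: tri_def)
  qed
qed

text \<open>Converse of \<open>edge_monoid_valid\<close>. The inner triangle of each branch takes
  \<open>k i\<close> at \<open>c\<close> and the weights \<open>r\<close> at its two other vertices,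
  the outer triangles take what is left, and each triangle is decomposed into edges on its
  own.\<close>

lemma valid_edge_monoid:
  assumes keys: "keys m \<subseteq> verts"
    and k: "sum k branches = vec m c" "\<And>i. i \<in> branches \<Longrightarrow> valid (vec m) i (k i)"
  shows "m \<in> edge_monoid edges"
proof -
  define X where "X = vec m"
  have kc: "sum k branches = X c" using k(1) by (simp add: X_def)
  note k = k[folded X_def]
  have X0: "0 \<le> X v" for v by (simp add: X_def)
  obtain R R' where R: "\<And>i. i \<in> branches \<Longrightarrow> tri (R i) (R' i) (k i) \<and> 0 \<le> R i \<and> lo X i \<le> R i \<and> R i \<le> hi X i \<and>
      even (R i - hi X i) \<and> 0 \<le> R' i \<and> lo X (mate i) \<le> R' i \<and> R' i \<le> hi X (mate i) \<and> even (R' i - hi X (mate i))"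
    using inner_distribution[OF k(2) X0] by metis
  \<comment> \<open>Rearranges \<open>R\<close> and \<open>R'\<close>, which are indexed by
    branches, into one function on \<open>N\<close>.\<close>
  define r where "r n = (if n \<in> branches then R n else R' (mate n))" for n
  have mb: "mate i \<notin> branches" if "i \<in> branches" for i
    using that mate_N(3)[of i] by (auto simp: branches_def)
  have rb: "r i = R i" "r (mate i) = R' i" if "i \<in> branches" for i
    using mb[OF that] mate_N(3)[OF branchesD[OF that]] that by (auto simp: r_def)
  have r: "0 \<le> r n \<and> lo X n \<le> r n \<and> r n \<le> hi X n \<and> even (r n - hi X n)" if n: "n \<in> N" for n
  proof (cases "n \<in> branches")
    case True
    then show ?thesis using R rb by auto
  next
    case False
    then have "mate n \<in> branches"
      using n mate_N[OF n] by (auto simp: branches_def)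
    then show ?thesis using R[of "mate n"] rb[of "mate n"] mate_N(3)[OF n] by auto
  qed
  have "\<exists>l. (\<forall>z\<in>outer n. tri (X z) (X (mate z)) (l z)) \<and> sum l (outer n) = X n - r n" if "n \<in> N" for n
    using r[OF that] even_ww_dd[of X n] X0
    by (intro outer_distribution) (auto simp: hi_def lo_def)
  then obtain l where l: "\<And>n z. n \<in> N \<Longrightarrow> z \<in> outer n \<Longrightarrow> tri (X z) (X (mate z)) (l n z)"
    "\<And>n. n \<in> N \<Longrightarrow> sum (l n) (outer n) = X n - r n" by metis
  have l0: "0 \<le> l n z" if "n \<in> N" "z \<in> outer n" for n z
    using l(1)[OF that] by (auto simp: tri_def)
  have k0: "0 \<le> k i" if "i \<in> branches" for i
    using k(2)[OF that] by (auto simp: valid_def exc_def)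
  let ?s = "single"
  have single_sum: "?s v (nat (sum f A)) = (\<Sum>a\<in>A. ?s v (nat (f a)))" if "\<And>a. a \<in> A \<Longrightarrow> 0 \<le> f a"
    for v :: nat and f :: "nat \<Rightarrow> int" and A
    using that by (induction A rule: infinite_finite_induct) (auto simp: nat_add_distrib sum_nonneg single_add)
  have N: "?s n (nat (X n)) = ?s n (nat (r n)) + (\<Sum>z\<in>outer n. ?s n (nat (l n z)))" if "n \<in> N" for n
  proof -
    have "X n = r n + sum (l n) (outer n)" using l(2)[OF that] by simp
    then have "?s n (nat (X n)) = ?s n (nat (r n)) + ?s n (nat (sum (l n) (outer n)))"
      using r[OF that] l0[OF that] by (simp add: nat_add_distrib sum_nonneg single_add)
    then show ?thesis using single_sum[of "outer n" "l n" n] l0[OF that] by simp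
  qed
  have "m = (\<Sum>v\<in>verts. ?s v (nat (X v)))"
  proof (rule poly_mapping_eqI)
    fix v
    show "lookup m v = lookup (\<Sum>v\<in>verts. ?s v (nat (X v))) v"
      using keys finite_N finite_Z
      by (auto simp: lookup_sum lookup_single when_def X_def verts_def in_keys_iff subset_iff)
  qed
  also have "\<dots> = ?s c (nat (X c)) + ((\<Sum>n\<in>N. ?s n (nat (X n))) + (\<Sum>z\<in>Z. ?s z (nat (X z))))"
    unfolding verts_def using finite_N finite_Z c_notin disjoint
    by (subst sum.insert, simp, simp, subst sum.union_disjoint) auto
  also have "?s c (nat (X c)) = (\<Sum>i\<in>branches. ?s c (nat (k i)))"
    using single_sum[of branches k c, OF k0] kc by simp
  also have "(\<Sum>n\<in>N. ?s n (nat (X n))) =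
      (\<Sum>i\<in>branches. ?s i (nat (r i)) + ?s (mate i) (nat (r (mate i)))) +
      (\<Sum>n\<in>N. \<Sum>z\<in>outer n. ?s n (nat (l n z)))"
    using N by (simp add: sum.distrib[symmetric] sum_N[of "\<lambda>n. ?s n (nat (r n))", symmetric])
  also have "(\<Sum>z\<in>Z. ?s z (nat (X z))) =
      (\<Sum>n\<in>N. \<Sum>z\<in>outer n. ?s z (nat (X z)) + ?s (mate z) (nat (X (mate z))))"
    by (rule sum_Z)
  finally have "m =
      (\<Sum>i\<in>branches. ?s i (nat (r i)) + ?s (mate i) (nat (r (mate i))) + ?s c (nat (k i))) +
      (\<Sum>n\<in>N. \<Sum>z\<in>outer n. ?s z (nat (X z)) + ?s (mate z) (nat (X (mate z))) + ?s n (nat (l n z)))"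
    by (simp add: sum.distrib add_ac)
  also have "\<dots> \<in> edge_monoid edges"
  proof -
    have "?s i (nat (r i)) + ?s (mate i) (nat (r (mate i))) + ?s c (nat (k i)) \<in> edge_monoid edges"
      if "i \<in> branches" for i
    proof (rule triangle_in_edge_monoid)
      show "{i, mate i} \<in> edges" "{i, c} \<in> edges" "{mate i, c} \<in> edges"
        using branchesD[OF that] mate_N(1) by (auto simp: edges_def insert_commute)
      show "tri (r i) (r (mate i)) (k i)" using R[OF that] rb[OF that] by simp
      show "i \<noteq> mate i" using mate_N(2)[OF branchesD[OF that]] by metis
    qed (use branchesD[OF that] mate_N(1)[OF branchesD[OF that]] c_notin in auto)
    moreover have "?s z (nat (X z)) + ?s (mate z) (nat (X (mate z))) + ?s n (nat (l n z)) \<in> edge_monoid edges"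
      if "n \<in> N" "z \<in> outer n" for n z
    proof (rule triangle_in_edge_monoid)
      have z: "z \<in> Z" "par z = n" using outerD[OF that(2)] by auto
      then show "{z, mate z} \<in> edges" "{z, n} \<in> edges" by (auto simp: edges_def)
      show "{mate z, n} \<in> edges"
        using z mate_Z(1)[OF z(1)] par(2)[OF z(1)] by (auto simp: edges_def intro: image_eqI[of _ _ "mate z"])
      show "z \<noteq> mate z" "z \<noteq> n" "mate z \<noteq> n"
        using z that(1) mate_Z(1)[OF z(1)] mate_Z(2)[OF z(1), symmetric] disjoint by auto
    qed (use l(1)[OF that] in simp)
    ultimately show ?thesis
      using submonoid_edge_monoid[of edges] sum_in_submonoid[OF submonoid_edge_monoid]
      unfolding submonoid_set_def by (metis (no_types, lifting))
  qed
  finally show ?thesis .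
qed

end

section \<open>The saturation of the edge monoid\<close>

definition asymp_linear :: "((nat \<Rightarrow> int) \<Rightarrow> int) \<Rightarrow> bool" where
  "asymp_linear \<phi> \<longleftrightarrow>
     (\<forall>X Y. \<exists>C. \<forall>n::nat. \<bar>\<phi> (\<lambda>v. X v + int n * Y v) - int n * \<phi> Y\<bar> \<le> C)"

text \<open>A value of at most \<open>- 1\<close> at \<open>Y\<close> would outgrow the bounded
  error. This is how the inequalities of \<open>sat\<close> pass to differences that are almost
  integral. It does not apply to \<open>need\<close>, whose parity bit is not homogeneous.\<close>

lemma asymp_linear_nonneg:
  assumes "asymp_linear \<phi>" "\<And>n::nat. 0 \<le> \<phi> (\<lambda>v. X v + int n * Y v)"
  shows "0 \<le> \<phi> Y"
proof (rule ccontr)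
  obtain C where C: "\<And>n::nat. \<bar>\<phi> (\<lambda>v. X v + int n * Y v) - int n * \<phi> Y\<bar> \<le> C"
    using assms(1) unfolding asymp_linear_def by blast
  assume "\<not> 0 \<le> \<phi> Y"
  then have "\<phi> Y \<le> - 1" by simp
  define n where "n = nat (C + 1)"
  have "C \<ge> 0" using C[of 0] by (meson abs_ge_zero order_trans)
  then have "int n * \<phi> Y \<le> int n * (- 1)"
    using \<open>\<phi> Y \<le> - 1\<close> by (intro mult_left_mono) auto
  moreover have "int n = C + 1" using \<open>C \<ge> 0\<close> by (simp add: n_def)
  ultimately show False using C[of n] assms(2)[of n] by linarith
qed

lemma asymp_linear_coord: "asymp_linear (\<lambda>X. X v)"
  unfolding asymp_linear_def
proof (intro allI exI)
  show "\<bar>X v + int n * Y v - int n * Y v\<bar> \<le> \<bar>X v\<bar>" for X Y n by simp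
qed

lemma asymp_linear_zero: "asymp_linear (\<lambda>_. 0)"
  unfolding asymp_linear_def by auto

lemma asymp_linear_combine:
  assumes "asymp_linear \<phi>" "asymp_linear \<psi>"
    and hom: "\<And>n x y. f (int n * x) (int n * y) = int n * f x y"
    and lip: "\<And>x y x' y'. \<bar>f x y - f x' y'\<bar> \<le> \<bar>x - x'\<bar> + \<bar>y - y'\<bar>"
  shows "asymp_linear (\<lambda>X. f (\<phi> X) (\<psi> X))"
  unfolding asymp_linear_def
proof (intro allI)
  fix X Y
  obtain C D where *: "\<And>n::nat. \<bar>\<phi> (\<lambda>v. X v + int n * Y v) - int n * \<phi> Y\<bar> \<le> C"
    "\<And>n::nat. \<bar>\<psi> (\<lambda>v. X v + int n * Y v) - int n * \<psi> Y\<bar> \<le> D"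
    using assms(1,2) unfolding asymp_linear_def by metis
  show "\<exists>B. \<forall>n. \<bar>f (\<phi> (\<lambda>v. X v + int n * Y v)) (\<psi> (\<lambda>v. X v + int n * Y v)) - int n * f (\<phi> Y) (\<psi> Y)\<bar> \<le> B"
  proof (intro exI[of _ "C + D"] allI)
    fix n
    show "\<bar>f (\<phi> (\<lambda>v. X v + int n * Y v)) (\<psi> (\<lambda>v. X v + int n * Y v)) - int n * f (\<phi> Y) (\<psi> Y)\<bar> \<le> C + D"
      unfolding hom[symmetric]
      using lip[of "\<phi> (\<lambda>v. X v + int n * Y v)" "\<psi> (\<lambda>v. X v + int n * Y v)" "int n * \<phi> Y" "int n * \<psi> Y"]
        *(1)[of n] *(2)[of n] by linarith
  qed
qed

lemma asymp_linear_add: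
  "asymp_linear \<phi> \<Longrightarrow> asymp_linear \<psi> \<Longrightarrow> asymp_linear (\<lambda>X. \<phi> X + \<psi> X)"
  by (rule asymp_linear_combine[where f = "(+)"]) (auto simp: algebra_simps)

lemma asymp_linear_diff:
  "asymp_linear \<phi> \<Longrightarrow> asymp_linear \<psi> \<Longrightarrow> asymp_linear (\<lambda>X. \<phi> X - \<psi> X)"
  by (rule asymp_linear_combine[where f = "(-)"]) (auto simp: algebra_simps)

lemma asymp_linear_max:
  "asymp_linear \<phi> \<Longrightarrow> asymp_linear \<psi> \<Longrightarrow> asymp_linear (\<lambda>X. max (\<phi> X) (\<psi> X))"
  by (rule asymp_linear_combine[where f = max]) (auto simp: max_mult_distrib_left)

lemma asymp_linear_abs:
  "asymp_linear \<phi> \<Longrightarrow> asymp_linear (\<lambda>X. \<bar>\<phi> X\<bar>)"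
  by (rule asymp_linear_combine[where f = "\<lambda>x _. \<bar>x\<bar>" and \<psi> = \<phi>]) (auto simp: abs_mult)

lemma asymp_linear_sum:
  "(\<And>i. i \<in> I \<Longrightarrow> asymp_linear (\<phi> i)) \<Longrightarrow> asymp_linear (\<lambda>X. \<Sum>i\<in>I. \<phi> i X)"
  by (induction I rule: infinite_finite_induct)
    (auto intro: asymp_linear_zero asymp_linear_add)

lemmas asymp_linear_intros = asymp_linear_coord asymp_linear_zero
  asymp_linear_add asymp_linear_diff asymp_linear_max
  asymp_linear_abs asymp_linear_sum

context shallow_cactus
begin

definition cap :: "(nat \<Rightarrow> int) \<Rightarrow> nat \<Rightarrow> int" where
  "cap X i = hi X i + hi X (mate i)"

definition total :: "(nat \<Rightarrow> int) \<Rightarrow> int" where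
  "total X = X c + sum (tot X) branches"

text \<open>The lattice points of the edge cone with even coordinate sum, i.e. the normalization.\<close>

definition sat :: "(nat \<Rightarrow>\<^sub>0 nat) set" where
  "sat = {m. keys m \<subseteq> verts \<and> (\<forall>n\<in>N. 0 \<le> hi (vec m) n) \<and> sum (exc (vec m)) branches \<le> vec m c \<and>
     vec m c \<le> sum (cap (vec m)) branches \<and> even (total (vec m))}"

definition even_part :: "(nat \<Rightarrow>\<^sub>0 nat) set" where
  "even_part = {m \<in> edge_monoid edges. \<forall>i\<in>branches. even (tot (vec m) i)}"

lemma total_add: "total (\<lambda>v. X v + Y v) = total X + total Y"
  by (simp add: total_def linear_parts sum.distrib)

lemma valid_iff:
  "valid X i k \<longleftrightarrow> 0 \<le> hi X i \<and> 0 \<le> hi X (mate i) \<and> need X i \<le> k \<and> k \<le> cap X i \<and> even (k - cap X i)"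
proof -
  have "0 \<le> exc X i" by (simp add: exc_def)
  then have "exc X i \<le> k \<and> even (tot X i + k) \<longleftrightarrow> need X i \<le> k \<and> even (tot X i + k)"
    unfolding need_def by (auto simp: mod_2_eq_odd) presburger
  moreover have "even (tot X i + k) \<longleftrightarrow> even (k - cap X i)"
    using even_hi_tot[of X i] unfolding cap_def by presburger
  ultimately show ?thesis unfolding valid_def cap_def by blast
qed

text \<open>Eliminates the numbers \<open>k i\<close>: each ranges over an interval from
  \<open>need\<close> to \<open>cap\<close> with fixed parity, and
  \<open>parity_interpolation\<close> reaches every sum of the right parity between the sums of the
  end points.\<close>

lemma edge_monoid_iff:
  assumes "keys m \<subseteq> verts"
  shows "m \<in> edge_monoid edges \<longleftrightarrow> (\<forall>n\<in>N. 0 \<le> hi (vec m) n) \<and> sum (need (vec m)) branches \<le> vec m c \<and>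
    vec m c \<le> sum (cap (vec m)) branches \<and> even (total (vec m))"
proof -
  define X where "X = vec m"
  have Xc: "int (lookup m c) = X c" by (simp add: X_def)
  have hiN: "(\<forall>n\<in>N. 0 \<le> hi X n) \<longleftrightarrow> (\<forall>i\<in>branches. 0 \<le> hi X i \<and> 0 \<le> hi X (mate i))"
  proof
    assume r: "\<forall>i\<in>branches. 0 \<le> hi X i \<and> 0 \<le> hi X (mate i)"
    show "\<forall>n\<in>N. 0 \<le> hi X n"
    proof
      fix n assume n: "n \<in> N"
      then have "n \<in> branches \<or> mate n \<in> branches"
        using mate_N[OF n] by (auto simp: branches_def)
      then show "0 \<le> hi X n" using r mate_N(3)[OF n] by auto
    qed
  qed (use branchesD mate_N(1) in auto)
  have tot_eq: "even (total X) \<longleftrightarrow> even (X c - sum (cap X) branches)"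
  proof -
    have "even (sum (tot X) branches + sum (cap X) branches)"
      unfolding sum.distrib[symmetric] cap_def using even_hi_tot by (intro dvd_sum) (simp add: add.commute)
    then show ?thesis unfolding total_def by presburger
  qed
  have need: "need X i \<le> cap X i" "even (cap X i - need X i)"
    if "i \<in> branches" "0 \<le> hi X i \<and> 0 \<le> hi X (mate i)" for i
  proof -
    have le: "lo X n \<le> hi X n" for n
      using dd_le_ww[of X n] by (simp add: hi_def lo_def X_def)
    have "even (cap X i + tot X i)"
      using even_hi_tot unfolding cap_def .
    then have "tot X i mod 2 \<le> cap X i"
      using that(2) unfolding cap_def by presburger
    moreover have "exc X i \<le> cap X i"
      using that(2) le[of i] le[of "mate i"] unfolding exc_def cap_def by linarith
    ultimately show "need X i \<le> cap X i" by (simp add: need_def)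
    have "even (ww X n - dd X n)" for n by (rule even_ww_dd)
    then have "even (lo X i - hi X (mate i) + tot X i)" "even (lo X (mate i) - hi X i + tot X i)"
      unfolding lo_def hi_def tot_def by simp_all
    then show "even (cap X i - need X i)"
      using \<open>even (cap X i + tot X i)\<close> unfolding need_def exc_def max_def by presburger
  qed
  show ?thesis
    unfolding X_def[symmetric] Xc
  proof
    assume "m \<in> edge_monoid edges"
    then obtain k where k: "sum k branches = X c" "\<And>i. i \<in> branches \<Longrightarrow> valid X i (k i)"
      using edge_monoid_valid unfolding X_def by blast
    have "even (sum k branches - sum (cap X) branches)"
      unfolding sum_subtractf[symmetric] using k(2) by (intro dvd_sum) (auto simp: valid_iff)
    then show "(\<forall>n\<in>N. 0 \<le> hi X n) \<and> sum (need X) branches \<le> X c \<and>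
        X c \<le> sum (cap X) branches \<and> even (total X)"
      unfolding hiN tot_eq k(1)[symmetric] using k(2) by (auto simp: valid_iff intro: sum_mono)
  next
    assume r: "(\<forall>n\<in>N. 0 \<le> hi X n) \<and> sum (need X) branches \<le> X c \<and>
        X c \<le> sum (cap X) branches \<and> even (total X)"
    then have h: "0 \<le> hi X i \<and> 0 \<le> hi X (mate i)" if "i \<in> branches" for i
      using hiN that by blast
    have "\<exists>k. (\<forall>i\<in>branches. need X i \<le> k i \<and> k i \<le> cap X i \<and> even (k i - cap X i)) \<and> sum k branches = X c"
      using r need h tot_eq by (intro parity_interpolation finite_branches) (auto simp: need_def)
    then obtain k where "\<forall>i\<in>branches. valid X i (k i)" "sum k branches = X c"
      using h by (auto simp: valid_iff)
    then show "m \<in> edge_monoid edges"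
      using valid_edge_monoid[OF assms] unfolding X_def by blast
  qed
qed

lemma edge_monoid_keys: "m \<in> edge_monoid edges \<Longrightarrow> keys m \<subseteq> verts"
  using keys_edge_monoid edges_subset by blast

lemma exc_le_need: "exc X i \<le> need X i"
  by (simp add: need_def)

lemma edge_monoid_subset_sat: "edge_monoid edges \<subseteq> sat"
proof
  fix m assume m: "m \<in> edge_monoid edges"
  have "sum (exc (vec m)) branches \<le> sum (need (vec m)) branches"
    by (intro sum_mono exc_le_need)
  then show "m \<in> sat"
    using m edge_monoid_iff[OF edge_monoid_keys[OF m]] edge_monoid_keys[OF m] by (auto simp: sat_def)
qed

text \<open>On an even branch the parity bit vanishes and \<open>need\<close> coincides with
  \<open>exc\<close>, so here the edge monoid agrees with its saturation.\<close>

lemma even_part_eq: "even_part = {m \<in> sat. \<forall>i\<in>branches. even (tot (vec m) i)}"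
proof -
  have "m \<in> edge_monoid edges" if m: "m \<in> sat" "\<forall>i\<in>branches. even (tot (vec m) i)" for m
  proof -
    have "sum (need (vec m)) branches = sum (exc (vec m)) branches"
      using m(2) by (intro sum.cong) (auto simp: need_def exc_def mod_2_eq_odd)
    then show ?thesis
      using m(1) edge_monoid_iff[of m] by (auto simp: sat_def)
  qed
  then show ?thesis using edge_monoid_subset_sat by (auto simp: even_part_def)
qed

lemma submonoid_sat: "submonoid_set sat"
  unfolding submonoid_set_def
proof (intro conjI ballI)
  show "0 \<in> sat" using edge_monoid_subset_sat edge_monoid.zero by blast
next
  fix m m' assume "m \<in> sat" "m' \<in> sat"
  note * = this[unfolded sat_def mem_Collect_eq]
  define X Y where "X = vec m" "Y = vec m'"
  have "int (lookup m c) = X c" "int (lookup m' c) = Y c" by (simp_all add: X_Y_def)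
  note * = *[folded X_Y_def, unfolded this]
  have XY: "vec (m + m') = (\<lambda>v. X v + Y v)"
    unfolding X_Y_def by (rule vec_add)
  have "keys (m + m') \<subseteq> verts"
    using * keys_add[of m m'] by blast
  moreover have "0 \<le> hi (\<lambda>v. X v + Y v) n" if "n \<in> N" for n
  proof -
    have "0 \<le> hi X n" "0 \<le> hi Y n" using * that by blast+
    then show ?thesis using hi_add[of X n Y] by linarith
  qed
  moreover have "sum (exc (\<lambda>v. X v + Y v)) branches \<le> X c + Y c"
  proof -
    have "sum (exc (\<lambda>v. X v + Y v)) branches \<le> (\<Sum>i\<in>branches. exc X i + exc Y i)"
      by (intro sum_mono exc_add)
    then show ?thesis using * unfolding sum.distrib by linarith
  qed
  moreover have "X c + Y c \<le> sum (cap (\<lambda>v. X v + Y v)) branches"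
  proof -
    have "(\<Sum>i\<in>branches. cap X i + cap Y i) \<le> sum (cap (\<lambda>v. X v + Y v)) branches"
      unfolding cap_def using hi_add[of X _ Y] by (intro sum_mono) (smt (verit))
    then show ?thesis using * unfolding sum.distrib by linarith
  qed
  ultimately show "m + m' \<in> sat"
    using * unfolding sat_def mem_Collect_eq XY total_add by (simp add: X_Y_def lookup_add)
qed

lemma submonoid_even_part: "submonoid_set even_part"
  using submonoid_edge_monoid[of edges]
  by (auto simp: even_part_def submonoid_set_def vec_add linear_parts) (auto simp: tot_def ww_def)

lemma asymp_linear_parts:
  "asymp_linear (\<lambda>X. hi X n)" "asymp_linear (\<lambda>X. lo X n)"
  "asymp_linear (\<lambda>X. exc X n)" "asymp_linear (\<lambda>X. cap X n)"
  unfolding hi_def lo_def exc_def cap_def dd_def ww_def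
  by (intro asymp_linear_intros)+

text \<open>The \<open>s n\<close> lie on a ray with direction \<open>u - v\<close>, which inherits
  their inequalities; its parity is read off from \<open>s 0\<close> and \<open>s 1\<close>. The
  subtraction is not truncated, because a coordinate in which \<open>v\<close> exceeds
  \<open>u\<close> would become negative along the ray.\<close>

lemma difference_quotient:
  assumes "\<And>n. s n \<in> sat" "\<And>n i. lookup w i + n * lookup u i = n * lookup v i + lookup (s n) i"
    and "keys u \<subseteq> verts"
  shows "u - v \<in> sat" "u = v + (u - v)" "vec (s n) = (\<lambda>i. vec w i + int n * vec (u - v) i)"
proof -
  have le: "lookup v i \<le> lookup u i" for i
  proof (rule ccontr)
    assume "\<not> ?thesis"
    then have "lookup u i + 1 \<le> lookup v i" by simp
    \<comment> \<open>For \<open>n = Suc (lookup w i)\<close> the deficit at \<open>i\<close>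
      exceeds what \<open>w\<close> can make up for.\<close>
    then have "Suc (lookup w i) * (lookup u i + 1) \<le> Suc (lookup w i) * lookup v i"
      by (rule mult_le_mono2)
    then show False using assms(2)[of i "Suc (lookup w i)"] by (simp add: algebra_simps)
  qed
  then show eq: "u = v + (u - v)"
    by (intro poly_mapping_eqI) (simp add: lookup_add lookup_minus)
  have vd: "vec (u - v) = (\<lambda>i. vec u i - vec v i)"
    using le by (simp add: lookup_minus of_nat_diff)
  show vs: "vec (s n) = (\<lambda>i. vec w i + int n * vec (u - v) i)" for n
  proof
    fix i
    have "int (lookup w i + n * lookup u i) = int (n * lookup v i + lookup (s n) i)"
      using assms(2) by simp
    then show "vec (s n) i = vec w i + int n * vec (u - v) i"
      using le[of i] by (simp add: lookup_minus of_nat_diff algebra_simps)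
  qed
  define Y where "Y = vec (u - v)"
  define W where "W = vec w"
  have S: "(\<forall>n\<in>N. 0 \<le> hi (\<lambda>i. W i + int k * Y i) n) \<and>
      sum (exc (\<lambda>i. W i + int k * Y i)) branches \<le> W c + int k * Y c \<and>
      W c + int k * Y c \<le> sum (cap (\<lambda>i. W i + int k * Y i)) branches \<and> even (total (\<lambda>i. W i + int k * Y i))" for k
    using assms(1)[of k] vs[of k] fun_cong[OF vs[of k], of c] unfolding sat_def Y_def W_def by simp
  have "keys (u - v) \<subseteq> verts"
    using assms(3) by (auto simp: in_keys_iff lookup_minus)
  moreover have "0 \<le> hi Y n" if "n \<in> N" for n
    using S that
    by (rule_tac asymp_linear_nonneg[of "\<lambda>Y. hi Y n" W, OF asymp_linear_parts(1)]) blast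
  moreover have "0 \<le> Y c - sum (exc Y) branches"
  proof (rule asymp_linear_nonneg[of "\<lambda>Y. Y c - sum (exc Y) branches" W])
    show "asymp_linear (\<lambda>Y. Y c - sum (exc Y) branches)"
      by (intro asymp_linear_intros asymp_linear_parts)
  qed (use S in simp)
  moreover have "0 \<le> sum (cap Y) branches - Y c"
  proof (rule asymp_linear_nonneg[of "\<lambda>Y. sum (cap Y) branches - Y c" W])
    show "asymp_linear (\<lambda>Y. sum (cap Y) branches - Y c)"
      by (intro asymp_linear_intros asymp_linear_parts)
  qed (use S in simp)
  moreover have "even (total Y)"
    using S[of 0] S[of 1] total_add[of W Y] by simp
  ultimately show "u - v \<in> sat"
    by (simp add: sat_def Y_def)
qed

lemma sat_keys: "m \<in> sat \<Longrightarrow> keys m \<subseteq> verts"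
  by (simp add: sat_def)

lemma cic_sat: "completely_integrally_closed sat"
  unfolding completely_integrally_closed_def
proof (intro ballI impI)
  fix u v w assume "u \<in> sat" and "\<forall>n. \<exists>s\<in>sat. \<forall>i. lookup w i + n * lookup u i = n * lookup v i + lookup s i"
  then obtain s where "\<And>n. s n \<in> sat" "\<And>n i. lookup w i + n * lookup u i = n * lookup v i + lookup (s n) i"
    by metis
  then show "\<exists>s\<in>sat. u = v + s"
    using difference_quotient(1,2)[of s w u v] sat_keys[OF \<open>u \<in> sat\<close>] by blast
qed

lemma cic_even_part: "completely_integrally_closed even_part"
  unfolding completely_integrally_closed_def
proof (intro ballI impI)
  fix u v w assume u: "u \<in> even_part"
    and "\<forall>n. \<exists>s\<in>even_part. \<forall>i. lookup w i + n * lookup u i = n * lookup v i + lookup s i"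
  then obtain s where s: "\<And>n. s n \<in> even_part"
    "\<And>n i. lookup w i + n * lookup u i = n * lookup v i + lookup (s n) i"
    by metis
  have sat: "\<And>n. s n \<in> sat" "keys u \<subseteq> verts"
    using s(1) u sat_keys unfolding even_part_eq by auto
  note q = difference_quotient[of s w u v, OF sat(1) s(2) sat(2)]
  have "even (tot (vec (u - v)) i)" if "i \<in> branches" for i
  proof -
    have "even (tot (vec (s 0)) i)" "even (tot (vec (s 1)) i)"
      using s(1) that by (auto simp: even_part_def)
    then show ?thesis
      unfolding q(3) by (simp add: linear_parts)
  qed
  then have "u - v \<in> even_part"
    using q(1) unfolding even_part_eq by simp
  then show "\<exists>s\<in>even_part. u = v + s"
    using q(2) by blast
qed

end

section \<open>Serre's condition for the edge algebra\<close>

context shallow_cactus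
begin

section \<open>Shifts that make a branch even\<close>

lemma add_inner_vertex:
  assumes a: "a \<in> N" and Y: "\<And>v. Y v = X v + of_bool (v = a)"
  shows "hi Y n = hi X n + of_bool (n = a)" "lo Y n = lo X n + of_bool (n = a)"
    "tot Y n = tot X n + of_bool (n = a) + of_bool (mate n = a)"
proof -
  have "Y z = X z" "Y (mate z) = X (mate z)" if "z \<in> outer k" for z k
    using outerD(1)[OF that] mate_Z(1) a disjoint by (auto simp: Y)
  then have "dd Y k = dd X k" "ww Y k = ww X k" for k
    unfolding dd_def ww_def by (auto intro: sum.cong)
  then show "hi Y n = hi X n + of_bool (n = a)" "lo Y n = lo X n + of_bool (n = a)"
    "tot Y n = tot X n + of_bool (n = a) + of_bool (mate n = a)"
    by (simp_all add: hi_def lo_def tot_def Y)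
qed

text \<open>The triangle raises its base vertex by one and \<open>ww\<close> there by two but leaves
  \<open>dd\<close> unchanged, so the range from \<open>lo\<close> to \<open>hi\<close> widens by
  one on both sides, while the weight three changes the parity of the branch.\<close>

lemma add_outer_triangle:
  assumes z: "z \<in> Z" and Y: "\<And>v. Y v = X v + of_bool (v = par z) + of_bool (v = z \<or> v = mate z)"
    and n: "n \<in> N"
  shows "hi Y n = hi X n + of_bool (n = par z)" "lo Y n = lo X n - of_bool (n = par z)"
    "tot Y n = tot X n + 3 * of_bool (n = par z) + 3 * of_bool (mate n = par z)"
proof -
  have w: "Y w = X w + of_bool (w = z \<or> mate w = z)" "Y (mate w) = X (mate w) + of_bool (w = z \<or> mate w = z)"
    if "w \<in> outer k" for w k
  proof -
    have wZ: "w \<in> Z" "mate w \<in> Z" using outerD(1)[OF that] mate_Z(1) by auto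
    have "w \<noteq> par z" "mate w \<noteq> par z"
      using wZ par(1)[OF z] disjoint by auto
    moreover have "mate w = z \<longleftrightarrow> w = mate z" "mate w = mate z \<longleftrightarrow> w = z"
      using mate_Z(3)[OF z] mate_Z(3)[OF wZ(1)] by metis+
    ultimately show "Y w = X w + of_bool (w = z \<or> mate w = z)"
      "Y (mate w) = X (mate w) + of_bool (w = z \<or> mate w = z)"
      by (simp_all add: Y disj_commute)
  qed
  have dd: "dd Y k = dd X k" for k
    unfolding dd_def using w by (auto intro: sum.cong)
  have "ww Y k = (\<Sum>w\<in>outer k. X w + X (mate w) + 2 * of_bool (w = z \<or> mate w = z))" for k
    unfolding ww_def using w by (intro sum.cong) auto
  then have ww: "ww Y k = ww X k + 2 * of_bool (k = par z)" for k
    unfolding sum.distrib sum_distrib_left[symmetric] sum_outer_indicator[OF z] by (simp add: ww_def sum.distrib)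
  have "Y k = X k + of_bool (k = par z)" if "k \<in> N" for k
    using that z mate_Z(1)[OF z] disjoint by (auto simp: Y)
  then show "hi Y n = hi X n + of_bool (n = par z)" "lo Y n = lo X n - of_bool (n = par z)"
    "tot Y n = tot X n + 3 * of_bool (n = par z) + 3 * of_bool (mate n = par z)"
    using n mate_N(1)[OF n] by (simp_all add: hi_def lo_def tot_def dd ww)
qed

text \<open>The shift adds \<open>\<delta>\<close> to the branch and \<open>e\<close> to its number
  of edges to \<open>c\<close>. The last inequality keeps a violated lower bound violated, and
  \<open>- 1 \<le> e\<close> means that one extra \<open>c\<close> per branch makes all exponents
  nonnegative.\<close>

definition twists :: "(nat \<Rightarrow> int) \<Rightarrow> nat \<Rightarrow> (nat \<Rightarrow>\<^sub>0 nat) \<Rightarrow> int \<Rightarrow> bool" where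
  "twists X i \<delta> e \<longleftrightarrow> keys \<delta> \<subseteq> branch i \<and> - 1 \<le> e \<and>
     (\<forall>Y k. valid Y i k \<longrightarrow> even (tot Y i) = even (tot X i) \<longrightarrow>
        valid (\<lambda>v. Y v + vec \<delta> v) i (k + e) \<and> even (tot (\<lambda>v. Y v + vec \<delta> v) i)) \<and>
     need X i + e \<le> need (\<lambda>v. X v + vec \<delta> v) i"

lemma twistsI:
  assumes "keys \<delta> \<subseteq> branch i" "- 1 \<le> e"
    "\<And>Y k. valid Y i k \<Longrightarrow> even (tot Y i) = even (tot X i) \<Longrightarrow>
      valid (\<lambda>v. Y v + vec \<delta> v) i (k + e) \<and> even (tot (\<lambda>v. Y v + vec \<delta> v) i)"
    "need X i + e \<le> need (\<lambda>v. X v + vec \<delta> v) i"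
  shows "\<exists>\<delta> e. twists X i \<delta> e"
  using assms unfolding twists_def by blast

lemma twistsD:
  assumes "twists X i \<delta> e"
  shows "keys \<delta> \<subseteq> branch i" "- 1 \<le> e"
    "valid Y i k \<Longrightarrow> even (tot Y i) = even (tot X i) \<Longrightarrow>
      valid (\<lambda>v. Y v + vec \<delta> v) i (k + e) \<and> even (tot (\<lambda>v. Y v + vec \<delta> v) i)"
    "need X i + e \<le> need (\<lambda>v. X v + vec \<delta> v) i"
  using assms by (simp_all add: twists_def)

text \<open>
  The correction needed to make a branch even without leaving the facet that cuts it out: if
  branch \<open>i\<close> enters the facet inequality through its parity, an edge to \<open>c\<close> is traded for an
  outer triangle; if it enters linearly, an edge from \<open>c\<close> to the extremal vertex is added.
\<close>

lemma branch_twist: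
  assumes i: "i \<in> branches" and X0: "\<And>z. z \<in> Z \<Longrightarrow> 0 \<le> X z"
  shows "\<exists>\<delta> e. twists X i \<delta> e"
proof -
  have iN: "i \<in> N" "mate i \<in> N" "mate i \<noteq> i" "i \<noteq> mate i" "mate (mate i) = i"
    using branchesD[OF i] mate_N[of i] by auto
  have le: "lo X n \<le> hi X n" for n
    using dd_le_ww[of X n] X0 by (simp add: hi_def lo_def)
  consider (even) "even (tot X i)"
    | (parity) "odd (tot X i)" "lo X i < hi X (mate i)" "lo X (mate i) < hi X i"
    | (linear) "odd (tot X i)" "lo X i \<ge> hi X (mate i) \<or> lo X (mate i) \<ge> hi X i"
    by linarith
  then show ?thesis
  proof cases
    case even
    then show ?thesis by (intro twistsI[of 0 _ 0]) auto
  next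
    case linear
    then obtain a where a: "a = i \<or> a = mate i" "lo X a \<ge> hi X (mate a)" "mate a \<in> N" "a \<in> N"
      using iN by metis
    define \<delta> :: "nat \<Rightarrow>\<^sub>0 nat" where "\<delta> = single a 1"
    have add: "hi (\<lambda>v. Y v + vec \<delta> v) n = hi Y n + of_bool (n = a)"
      "lo (\<lambda>v. Y v + vec \<delta> v) n = lo Y n + of_bool (n = a)"
      "tot (\<lambda>v. Y v + vec \<delta> v) n = tot Y n + of_bool (n = a) + of_bool (mate n = a)" for Y n
      using a(4) by (intro add_inner_vertex; simp add: \<delta>_def lookup_single when_def)+
    show ?thesis
    proof (rule twistsI[of \<delta> _ 1])
      show "keys \<delta> \<subseteq> branch i" using a(1) by (auto simp: \<delta>_def branch_def)
      show "valid (\<lambda>v. Y v + vec \<delta> v) i (k + 1) \<and> even (tot (\<lambda>v. Y v + vec \<delta> v) i)"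
        if "valid Y i k" "even (tot Y i) = even (tot X i)" for Y k
        using that linear(1) a(1) iN by (auto simp: valid_def exc_def add)
      have "lo X (mate a) - hi X a \<le> 0" using a(2) le[of a] le[of "mate a"] by linarith
      have "even (ww X n - dd X n)" for n by (rule even_ww_dd)
      then have "even (lo X i - hi X (mate i) + tot X i)" "even (lo X (mate i) - hi X i + tot X i)"
        unfolding lo_def hi_def tot_def by simp_all
      then have "odd (lo X a - hi X (mate a))"
        using linear(1) a(1) iN(5) by auto
      \<comment> \<open>Being odd and nonnegative, the linear term is at least one, so it determines
        \<open>need X i\<close> and the parity bit does not.\<close>
      then have "lo X a - hi X (mate a) \<ge> 1" using a(2) by presburger
      then have "need X i = lo X a - hi X (mate a)"
        using linear(1) a(1) iN(5) \<open>lo X (mate a) - hi X a \<le> 0\<close>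
        by (auto simp: need_def exc_def mod_2_eq_odd)
      moreover have "exc (\<lambda>v. X v + vec \<delta> v) i \<ge> lo X a + 1 - hi X (mate a)"
        using a(1) iN by (auto simp: exc_def add)
      ultimately show "need X i + 1 \<le> need (\<lambda>v. X v + vec \<delta> v) i"
        using exc_le_need[of "\<lambda>v. X v + vec \<delta> v" i] by linarith
    qed simp
  next
    case parity
    \<comment> \<open>Without outer triangles \<open>lo\<close> and \<open>hi\<close> are both the
      coordinate itself, and the two strict inequalities contradict each other.\<close>
    have "outer i \<noteq> {} \<or> outer (mate i) \<noteq> {}"
      using parity(2,3) by (auto simp: lo_def hi_def dd_def ww_def)
    then obtain z where z: "z \<in> Z" "par z = i \<or> par z = mate i"
      by (auto simp: outer_def)
    define \<delta> :: "nat \<Rightarrow>\<^sub>0 nat" where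
      "\<delta> = single (par z) 1 + single z 1 + single (mate z) 1"
    have vec: "vec \<delta> v = of_bool (v = par z) + of_bool (v = z \<or> v = mate z)" for v
      using mate_Z(2)[OF z(1)] by (auto simp: \<delta>_def lookup_add lookup_single when_def)
    have add: "hi (\<lambda>v. Y v + vec \<delta> v) n = hi Y n + of_bool (n = par z)"
      "lo (\<lambda>v. Y v + vec \<delta> v) n = lo Y n - of_bool (n = par z)"
      "tot (\<lambda>v. Y v + vec \<delta> v) n = tot Y n + 3 * of_bool (n = par z) + 3 * of_bool (mate n = par z)"
      if "n \<in> N" for Y n
      using that by (intro add_outer_triangle[OF z(1)]; simp add: vec)+
    show ?thesis
    proof (rule twistsI[of \<delta> _ "- 1"])
      show "keys \<delta> \<subseteq> branch i"
      proof
        fix v assume "v \<in> keys \<delta>"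
        then have "vec \<delta> v \<noteq> 0" by (simp add: in_keys_iff)
        then have "v = par z \<or> v = z \<or> v = mate z" unfolding vec by (auto split: if_splits)
        then show "v \<in> branch i"
          using z par(2)[OF z(1)] mate_Z(1)[OF z(1)] by (auto simp: branch_def)
      qed
      show "valid (\<lambda>v. Y v + vec \<delta> v) i (k + - 1) \<and> even (tot (\<lambda>v. Y v + vec \<delta> v) i)"
        if Y: "valid Y i k" "even (tot Y i) = even (tot X i)" for Y k
      proof -
        \<comment> \<open>An odd branch uses at least one edge to \<open>c\<close>, so one can be
          given up.\<close>
        have "odd k" "0 \<le> k" using Y parity(1) by (auto simp: valid_def exc_def)
        then have "1 \<le> k" by presburger
        have v: "0 \<le> hi Y i" "0 \<le> hi Y (mate i)" "lo Y i - hi Y (mate i) \<le> k" "lo Y (mate i) - hi Y i \<le> k"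
          "k \<le> hi Y i + hi Y (mate i)" "odd (tot Y i)"
          using Y parity(1) by (auto simp: valid_def exc_def)
        show ?thesis
          unfolding valid_def exc_def add[OF iN(1), of Y] add[OF iN(2), of Y]
          using z(2) iN(3,4,5) v \<open>odd k\<close> \<open>1 \<le> k\<close> by (elim disjE) simp_all
      qed
      have "need X i = 1"
        using parity by (simp add: need_def exc_def mod_2_eq_odd)
      moreover have "0 \<le> need (\<lambda>v. X v + vec \<delta> v) i"
        by (simp add: need_def)
      ultimately show "need X i + - 1 \<le> need (\<lambda>v. X v + vec \<delta> v) i" by simp
    qed simp
  qed
qed

lemma branch_disjoint:
  assumes "i \<in> branches" "i' \<in> branches" "v \<in> branch i" "v \<in> branch i'"
  shows "i = i'"
proof -
  have inv: "mate (mate i) = i" "mate (mate i') = i'" and lt: "i < mate i" "i' < mate i'"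
    and N: "i \<in> N" "i' \<in> N" "mate i \<in> N" "mate i' \<in> N"
    using assms(1,2) mate_N by (auto simp: branches_def)
  have eq: "i = i'" if "n = i \<or> n = mate i" "n = i' \<or> n = mate i'" for n
    using that inv lt by (metis less_asym)
  show ?thesis
  proof (cases "v \<in> Z")
    case True
    then have "par v = i \<or> par v = mate i" "par v = i' \<or> par v = mate i'"
      using assms(3,4) N disjoint by (auto simp: branch_def)
    then show ?thesis by (rule eq)
  next
    case False
    then have "v = i \<or> v = mate i" "v = i' \<or> v = mate i'"
      using assms(3,4) by (auto simp: branch_def)
    then show ?thesis by (rule eq)
  qed
qed

lemma branch_subset: "i \<in> branches \<Longrightarrow> branch i \<subseteq> verts - {c}"
  using branchesD[of i] mate_N(1)[of i] c_notin by (auto simp: branch_def verts_def)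

text \<open>The branch corrections combine into a Laurent monomial with exponent
  \<open>j - single c p\<close>; the \<open>p = card branches\<close> copies of \<open>c\<close> on
  the other side compensate for negative \<open>e i\<close>. For \<open>m\<close> the shift can be
  undone, because the sum of the \<open>need\<close> grows at least as much as the
  \<open>c\<close>-coordinate.\<close>

lemma twist:
  assumes m: "m \<in> sat"
  obtains j p where
    "\<And>s. s \<in> edge_monoid edges \<Longrightarrow> \<forall>i\<in>branches. even (tot (vec s) i) = even (tot (vec m) i) \<Longrightarrow>
      \<exists>s'\<in>even_part. s + j = single c p + s'"
    "\<And>s. s \<in> edge_monoid edges \<Longrightarrow> m + j = single c p + s \<Longrightarrow> m \<in> edge_monoid edges"
proof -
  define X where "X = vec m"
  have "\<exists>\<delta> e. twists X i \<delta> e" if "i \<in> branches" for i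
    by (rule branch_twist[OF that]) (simp add: X_def)
  then obtain \<delta> e where "\<And>i. i \<in> branches \<Longrightarrow> twists X i (\<delta> i) (e i)"
    by metis
  note \<delta> = this[THEN twistsD(1)] this[THEN twistsD(2)] this[THEN twistsD(3)] this[THEN twistsD(4)]
  define p where "p = card branches"
  define q where "q = nat (int p + sum e branches)"
  have "0 \<le> (\<Sum>i\<in>branches. 1 + e i)"
  proof (rule sum_nonneg)
    fix i assume "i \<in> branches"
    then show "0 \<le> 1 + e i" using \<delta>(2)[of i] by simp
  qed
  then have q: "int q = int p + sum e branches"
    by (simp add: q_def p_def sum.distrib)
  define j where "j = single c q + sum \<delta> branches"
  have \<delta>0: "lookup (\<delta> i) v = 0" if "i \<in> branches" "v \<notin> branch i" for i v
    using \<delta>(1)[OF that(1)] that(2) by (auto simp: in_keys_iff)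
  have jc: "lookup j c = q"
  proof -
    have "(\<Sum>i\<in>branches. lookup (\<delta> i) c) = 0"
      using \<delta>0 branch_subset by (intro sum.neutral ballI) blast
    then show ?thesis by (simp add: j_def lookup_add lookup_sum)
  qed
  have jb: "lookup j v = lookup (\<delta> i) v" if "i \<in> branches" "v \<in> branch i" for i v
  proof -
    have "v \<noteq> c" using branch_subset that by blast
    moreover have "(\<Sum>i'\<in>branches. lookup (\<delta> i') v) = (\<Sum>i'\<in>branches. if i' = i then lookup (\<delta> i) v else 0)"
    proof (rule sum.cong[OF refl])
      fix i' assume "i' \<in> branches"
      then show "lookup (\<delta> i') v = (if i' = i then lookup (\<delta> i) v else 0)"
        using \<delta>0[of i' v] branch_disjoint[of i' i v] that by fastforce
    qed
    ultimately show ?thesis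
      using that finite_branches by (simp add: j_def lookup_add lookup_sum lookup_single when_def)
  qed
  have "keys (sum \<delta> branches) \<subseteq> verts"
    using keys_sum[of \<delta> branches] \<delta>(1) branch_subset by blast
  then have jkeys: "keys j \<subseteq> verts"
    unfolding j_def using keys_add[of "single c q" "sum \<delta> branches"]
    by (auto simp: verts_def split: if_splits)
  show ?thesis
  proof (rule that[of j p])
    fix s assume s: "s \<in> edge_monoid edges" and par: "\<forall>i\<in>branches. even (tot (vec s) i) = even (tot (vec m) i)"
    obtain k where k: "sum k branches = vec s c" "\<And>i. i \<in> branches \<Longrightarrow> valid (vec s) i (k i)"
      using edge_monoid_valid[OF s] by blast
    have new: "valid (\<lambda>v. vec s v + vec (\<delta> i) v) i (k i + e i)"
      "even (tot (\<lambda>v. vec s v + vec (\<delta> i) v) i)" if "i \<in> branches" for i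
      using \<delta>(3)[OF that k(2)[OF that]] par that by (auto simp: X_def)
    have "0 \<le> (\<Sum>i\<in>branches. k i + e i)"
      using new(1) by (intro sum_nonneg) (auto simp: valid_def exc_def)
    then have "0 \<le> vec s c + sum e branches"
      by (simp add: sum.distrib k(1))
    then have ge: "p \<le> lookup (s + j) c"
      using q by (simp add: lookup_add jc)
    define s' where "s' = s + j - single c p"
    have eq: "s + j = single c p + s'"
      using ge by (intro poly_mapping_eqI) (auto simp: s'_def lookup_add lookup_minus lookup_single when_def)
    have s'c: "vec s' c = vec s c + sum e branches"
      using ge q by (simp add: s'_def lookup_add lookup_minus jc of_nat_diff)
    have s'b: "vec s' v = vec s v + vec (\<delta> i) v" if "i \<in> branches" "v \<in> branch i" for i v
      using jb[OF that] branch_subset that by (auto simp: s'_def lookup_add lookup_minus lookup_single when_def)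
    have "s' \<in> edge_monoid edges"
    proof (rule valid_edge_monoid)
      show "keys s' \<subseteq> verts"
      proof
        fix v assume "v \<in> keys s'"
        then have "v \<in> keys (s + j)"
          by (auto simp: s'_def in_keys_iff lookup_minus)
        then show "v \<in> verts"
          using keys_add[of s j] jkeys edge_monoid_keys[OF s] by blast
      qed
      show "(\<Sum>i\<in>branches. k i + e i) = vec s' c"
        unfolding s'c by (simp add: sum.distrib k(1))
      show "valid (vec s') i (k i + e i)" if "i \<in> branches" for i
        using new(1)[OF that] local_cong(6)[OF branchesD[OF that] s'b[OF that]] by simp
    qed
    moreover have "even (tot (vec s') i)" if "i \<in> branches" for i
      using new(2)[OF that] local_cong(3)[OF branchesD[OF that] s'b[OF that]] by simp
    ultimately have "s' \<in> even_part" by (simp add: even_part_def)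
    then show "\<exists>s'\<in>even_part. s + j = single c p + s'"
      using eq by blast
  next
    fix s assume s: "s \<in> edge_monoid edges" and eq: "m + j = single c p + s"
    have "lookup m c + q = p + lookup s c"
      using arg_cong[OF eq, of "\<lambda>f. lookup f c"] by (simp add: lookup_add jc)
    then have sc: "vec s c = vec m c + sum e branches"
      using q by linarith
    have sb: "vec s v = X v + vec (\<delta> i) v" if "i \<in> branches" "v \<in> branch i" for i v
      using arg_cong[OF eq, of "\<lambda>f. lookup f v"] jb[OF that] branch_subset that
      by (auto simp: lookup_add X_def lookup_single when_def split: if_splits)
    have "sum (need X) branches + sum e branches \<le> sum (need (vec s)) branches"
      unfolding sum.distrib[symmetric]
    proof (rule sum_mono)
      fix i assume i: "i \<in> branches"
      show "need X i + e i \<le> need (vec s) i"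
        using \<delta>(4)[OF i] local_cong(5)[OF branchesD[OF i] sb[OF i]] by simp
    qed
    moreover have "sum (need (vec s)) branches \<le> vec s c"
      using s edge_monoid_iff[OF edge_monoid_keys[OF s]] by blast
    ultimately have "sum (need X) branches \<le> vec m c"
      using sc by linarith
    then show "m \<in> edge_monoid edges"
      using edge_monoid_iff[OF sat_keys[OF m]] m by (auto simp: sat_def X_def)
  qed
qed

end

section \<open>Parity components and the transfer to the even part\<close>

definition restrict_keys :: "'k::field mpoly \<Rightarrow> (nat \<Rightarrow>\<^sub>0 nat) set \<Rightarrow> 'k mpoly" where
  "restrict_keys f T = (\<Sum>m\<in>keys f \<inter> T. single m (lookup f m))"

lemma lookup_restrict_keys: "lookup (restrict_keys f T) m = (if m \<in> T then lookup f m else 0)"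
  unfolding restrict_keys_def by (auto simp: lookup_sum lookup_single when_def in_keys_iff)

lemma keys_restrict_keys: "keys (restrict_keys f T) = keys f \<inter> T"
  by (auto simp: in_keys_iff lookup_restrict_keys split: if_splits)

lemma restrict_keys_split: "f = restrict_keys f T + restrict_keys f (- T)"
  by (rule poly_mapping_eqI) (simp add: lookup_add lookup_restrict_keys)

lemma restrict_keys_eqI:
  assumes "f = g + h" "keys g \<subseteq> T" "keys h \<subseteq> - T"
  shows "restrict_keys f T = g"
proof (rule poly_mapping_eqI)
  fix m
  have "lookup g m = 0" if "m \<notin> T" using assms(2) that by (auto simp: in_keys_iff)
  moreover have "lookup h m = 0" if "m \<in> T" using assms(3) that by (auto simp: in_keys_iff)
  ultimately show "lookup (restrict_keys f T) m = lookup g m"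
    by (simp add: lookup_restrict_keys assms(1) lookup_add)
qed

lemma lookup_single_mult:
  fixes g :: "'k::field mpoly"
  shows "lookup (single j 1 * g) (j + m) = lookup g m"
proof -
  have "single j 1 * g = (\<Sum>k\<in>keys g. single (j + k) (lookup g k))"
    by (subst poly_mapping_eq_sum_singles[of g]) (simp add: sum_distrib_left mult_single)
  then show ?thesis
    by (auto simp: lookup_sum lookup_single when_def in_keys_iff)
qed

context shallow_cactus
begin

text \<open>
  Contracting primes to the even part keeps inclusions strict. One branch is made even at a
  time: if \<open>u\<close> and \<open>v\<close> are the even and odd part of \<open>z\<close>, then \<open>z * (u - v) = u\<^sup>2 - v\<^sup>2\<close> is even,
  and if \<open>u - v \<in> Q\<close> then \<open>z\<close> is congruent to \<open>2 * u\<close> modulo \<open>Q\<close>, so that \<open>u\<close> can be used instead.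
\<close>

lemma even_part_separates:
  fixes P Q :: "'k::field mpoly set"
  defines "A \<equiv> monoid_algebra (edge_monoid edges)"
  assumes P: "ideal P (ring_on A)" and Q: "primeideal Q (ring_on A)" "Q \<subset> P"
  shows "\<exists>z\<in>P - Q. z \<in> monoid_algebra even_part"
proof -
  note A = subring_set_monoid_algebra[OF submonoid_edge_monoid, of edges, where 'a = 'k, folded A_def]
  note P' = P[unfolded ideal_ring_on_iff[OF A]]
  note Q' = Q(1)[unfolded primeideal_ring_on_iff[OF A] ideal_ring_on_iff[OF A]]
  have "\<exists>z\<in>P - Q. \<forall>m\<in>keys z. \<forall>i\<in>B. even (tot (vec m) i)" if "finite B" "B \<subseteq> branches" for B
    using that
  proof (induction B rule: finite_induct)
    case empty
    then show ?case using Q(2) by auto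
  next
    case (insert i B)
    then obtain z where z: "z \<in> P" "z \<notin> Q" and even: "\<And>m i. m \<in> keys z \<Longrightarrow> i \<in> B \<Longrightarrow> even (tot (vec m) i)"
      by auto
    define T where "T = {m. even (tot (vec m) i)}"
    define u where "u = restrict_keys z T"
    define v where "v = restrict_keys z (- T)"
    have zuv: "z = u + v" unfolding u_def v_def by (rule restrict_keys_split)
    have zA: "z \<in> A" using z P' by blast
    have uv: "u \<in> A" "v \<in> A"
      using zA by (auto simp: u_def v_def A_def monoid_algebra_def keys_restrict_keys)
    have keysP: "\<forall>m\<in>keys (f * g). \<forall>i\<in>insert i B. even (tot (vec m) i)"
      if "keys f \<subseteq> keys z" "keys g \<subseteq> keys z" "keys f \<subseteq> T \<and> keys g \<subseteq> T \<or> keys f \<subseteq> - T \<and> keys g \<subseteq> - T" for f g :: "'k mpoly"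
    proof (intro ballI)
      fix m i' assume "m \<in> keys (f * g)" and i': "i' \<in> insert i B"
      then obtain a b where ab: "m = a + b" "a \<in> keys f" "b \<in> keys g"
        using keys_mult[of f g] by blast
      have "even (tot (vec a) i') = even (tot (vec b) i')"
      proof (cases "i' \<in> B")
        case True
        then show ?thesis using even ab that(1,2) by blast
      next
        case False
        then have "i' = i" using i' by blast
        then show ?thesis using ab that(3) by (auto simp: T_def)
      qed
      then show "even (tot (vec m) i')"
        unfolding ab(1) vec_add linear_parts by simp
    qed
    have ku: "keys u = keys z \<inter> T" "keys v = keys z \<inter> - T"
      by (simp_all add: u_def v_def keys_restrict_keys)
    show ?case
    proof (cases "u - v \<in> Q")
      case False
      have eq: "z * (u - v) = u * u - v * v"
        by (simp add: zuv algebra_simps)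
      have "u - v \<in> A" using uv subring_set_diff[OF A] by blast
      then have "(u - v) * z \<in> P" using P' z(1) by blast
      moreover have "z * (u - v) \<notin> Q" using Q' False z(2) zA \<open>u - v \<in> A\<close> by blast
      moreover have "\<forall>m\<in>keys (u * u - v * v). \<forall>i\<in>insert i B. even (tot (vec m) i)"
        using keysP[of u u] keysP[of v v] ku keys_diff[of "u * u" "v * v"] by blast
      ultimately show ?thesis
        using eq by (metis DiffI mult.commute)
    next
      case True
      have "u - v \<in> P" using True Q(2) by blast
      have 2: "2 * u = z + (u - v)" by (simp add: zuv)
      have notQ: "u \<notin> Q"
      proof
        assume "u \<in> Q"
        have "- 1 * (u - v) \<in> Q"
          using Q' True subring_set_minus[OF A subring_set_one[OF A]] by blast
        moreover have "2 * u \<in> Q"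
          using Q' \<open>u \<in> Q\<close> by (metis mult_2)
        ultimately have "2 * u + - 1 * (u - v) \<in> Q" using Q' by blast
        then show False using z(2) by (simp add: zuv)
      qed
      have inP: "2 * u \<in> P"
        unfolding 2 using P' z(1) \<open>u - v \<in> P\<close> by blast
      have two: "2 * u = single 0 2 * u"
        by simp
      \<comment> \<open>In characteristic 2 the equation \<open>2 * u = z + (u - v)\<close> would
        put \<open>z\<close> into \<open>Q\<close>, so this case arises only where \<open>2\<close>
        is invertible.\<close>
      have "(2 :: 'k) \<noteq> 0"
      proof
        assume "(2 :: 'k) = 0"
        then have "2 * u = 0"
          using two by (metis mult_zero_left single_zero)
        then have "z + (u - v) = 0" using 2 by (simp only:)
        then have "z = - 1 * (u - v)" by (simp only: mult_minus1 eq_neg_iff_add_eq_0)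
        then show False
          using z(2) Q' True subring_set_minus[OF A subring_set_one[OF A]] by metis
      qed
      then have "u = single 0 (1 / 2) * (2 * u)"
        unfolding two mult.assoc[symmetric] mult_single by simp
      moreover have "single 0 (1 / 2) \<in> A"
        unfolding A_def by (intro single_in_monoid_algebra edge_monoid.zero)
      ultimately have "u \<in> P" using P' inP by metis
      moreover have "\<forall>m\<in>keys u. \<forall>i\<in>insert i B. even (tot (vec m) i)"
        using even ku by (auto simp: T_def)
      ultimately show ?thesis using notQ by blast
    qed
  qed
  from this[OF finite_branches order.refl]
  obtain z where z: "z \<in> P - Q" "\<forall>m\<in>keys z. \<forall>i\<in>branches. even (tot (vec m) i)" by blast
  then have "z \<in> monoid_algebra even_part"
    using P' by (auto simp: monoid_algebra_def even_part_def A_def)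
  then show ?thesis using z(1) by blast
qed

theorem serre_criterion_edge_algebra:
  fixes P Q :: "'k::field mpoly set"
  defines "A \<equiv> monoid_algebra (edge_monoid edges)"
  assumes P: "primeideal P (ring_on A)" and Q: "primeideal Q (ring_on A)" "Q \<subset> P" "Q \<noteq> {0}"
    and x: "x \<in> A" "a \<in> A" "x \<noteq> 0" and div: "\<forall>y\<in>P. \<exists>b\<in>A. y * a = x * b"
  shows "\<exists>b\<in>A. a = x * b"
proof -
  define A0 :: "'k mpoly set" where "A0 = monoid_algebra even_part"
  note A = subring_set_monoid_algebra[OF submonoid_edge_monoid, of edges, where 'a = 'k, folded A_def]
  note A0 = subring_set_monoid_algebra[OF submonoid_even_part, where 'a = 'k, folded A0_def]
  note P' = P[unfolded primeideal_ring_on_iff[OF A] ideal_ring_on_iff[OF A]]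
  note Q' = Q(1)[unfolded primeideal_ring_on_iff[OF A] ideal_ring_on_iff[OF A]]
  have A0A: "A0 \<subseteq> A"
    by (auto simp: A0_def A_def monoid_algebra_def even_part_def)
  have Asat: "A \<subseteq> monoid_algebra sat"
    using edge_monoid_subset_sat by (auto simp: A_def monoid_algebra_def)
  have fin: "finite verts"
    using finite_N finite_Z by (simp add: verts_def)
  obtain z where z: "z \<in> A" "z \<noteq> 0" "\<And>n. \<exists>y\<in>A. z * a ^ n = x ^ n * y"
    using almost_integral_of_prime_chain[OF A P Q x(1,3) div] by blast
  have "\<exists>f\<in>monoid_algebra sat. a = x * f"
  proof (rule monoid_algebra_completely_integrally_closed[OF submonoid_sat cic_sat fin sat_keys])
    show "\<exists>y\<in>monoid_algebra sat. z * a ^ n = x ^ n * y" for n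
      using z(3)[of n] Asat by blast
  qed (use x z Asat in auto)
  then obtain f where f: "f \<in> monoid_algebra sat" "a = x * f" by blast
  have Pf: "y * f \<in> A" if "y \<in> P" for y
  proof -
    obtain b where "b \<in> A" "y * a = x * b" using div \<open>y \<in> P\<close> by blast
    moreover from this have "x * (y * f) = x * b"
      unfolding f(2) by (simp add: mult_ac)
    ultimately show ?thesis using x(3) by simp
  qed
  have "m \<in> edge_monoid edges" if m: "m \<in> keys f" for m
  proof -
    have "m \<in> sat" using f(1) m by (auto simp: monoid_algebra_def)
    then obtain j p where tw:
      "\<And>s. s \<in> edge_monoid edges \<Longrightarrow> \<forall>i\<in>branches. even (tot (vec s) i) = even (tot (vec m) i) \<Longrightarrow>
        \<exists>s'\<in>even_part. s + j = single c p + s'"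
      "\<And>s. s \<in> edge_monoid edges \<Longrightarrow> m + j = single c p + s \<Longrightarrow> m \<in> edge_monoid edges"
      using twist[of m thesis] by blast
    \<comment> \<open>\<open>g\<close> is the component of \<open>f\<close> with the branch parities
      of \<open>m\<close>. Multiplication by elements of \<open>A0\<close> preserves these
      components.\<close>
    define T where "T = {s. \<forall>i\<in>branches. even (tot (vec s) i) = even (tot (vec m) i)}"
    define g where "g = restrict_keys f T"
    define tj where "tj = single j (1 :: 'k)"
    define tp where "tp = single (single c p) (1 :: 'k)"
    have tp0: "tp \<noteq> 0"
      unfolding tp_def by (metis lookup_single_eq lookup_zero zero_neq_one)
    have twisted: "\<exists>y'\<in>A0. tj * (y * g) = tp * y'" if y: "y \<in> P \<inter> A0" for y
    proof -
      have even: "even (tot (vec u) i)" if "u \<in> keys y" "i \<in> branches" for u i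
        using y that by (auto simp: A0_def monoid_algebra_def even_part_def)
      have "restrict_keys (y * f) T = y * g"
      proof (rule restrict_keys_eqI)
        show "y * f = y * g + y * restrict_keys f (- T)"
          unfolding g_def distrib_left[symmetric] restrict_keys_split[symmetric] ..
        have shift: "u + w \<in> T \<longleftrightarrow> w \<in> T" if "u \<in> keys y" for u w
          using even[OF that] by (simp add: T_def vec_add linear_parts)
        show "keys (y * g) \<subseteq> T"
          using keys_mult[of y g] shift by (auto simp: g_def keys_restrict_keys)
        show "keys (y * restrict_keys f (- T)) \<subseteq> - T"
          using keys_mult[of y "restrict_keys f (- T)"] shift by (auto simp: keys_restrict_keys)
      qed
      then have keys: "keys (y * g) \<subseteq> edge_monoid edges \<inter> T"
        using Pf[of y] y keys_restrict_keys[of "y * f" T] by (auto simp: A_def monoid_algebra_def)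
      have "\<forall>s\<in>keys (y * g). \<exists>s'\<in>even_part. s + j = single c p + s'"
      proof
        fix s assume "s \<in> keys (y * g)"
        then have "s \<in> edge_monoid edges" "s \<in> T" using keys by blast+
        then show "\<exists>s'\<in>even_part. s + j = single c p + s'"
          unfolding T_def mem_Collect_eq by (rule tw(1))
      qed
      then obtain s' where s': "\<And>s. s \<in> keys (y * g) \<Longrightarrow> s' s \<in> even_part \<and> s + j = single c p + s' s"
        by metis
      define y' where "y' = (\<Sum>s\<in>keys (y * g). single (s' s) (lookup (y * g) s))"
      have "y' \<in> A0"
        unfolding y'_def A0_def using s'
        by (intro subring_set_sum[OF A0[unfolded A0_def]] single_in_monoid_algebra) blast
      have "tj * (y * g) = (\<Sum>s\<in>keys (y * g). single (s + j) (lookup (y * g) s))"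
        unfolding tj_def by (subst (1) poly_mapping_eq_sum_singles[of "y * g"])
          (simp add: sum_distrib_left mult_single add.commute)
      also have "\<dots> = (\<Sum>s\<in>keys (y * g). single (single c p + s' s) (lookup (y * g) s))"
        using s' by (intro sum.cong) auto
      also have "\<dots> = tp * y'"
        unfolding tp_def y'_def by (simp add: sum_distrib_left mult_single)
      finally show ?thesis using \<open>y' \<in> A0\<close> by blast
    qed
    have prime: "primeideal (R \<inter> A0) (ring_on A0)" if "primeideal R (ring_on A)" for R
    proof -
      note R = that[unfolded primeideal_ring_on_iff[OF A] ideal_ring_on_iff[OF A]]
      show ?thesis
        unfolding primeideal_ring_on_iff[OF A0] ideal_ring_on_iff[OF A0]
      proof (intro conjI ballI impI)
        show "0 \<in> R \<inter> A0" "R \<inter> A0 \<subseteq> A0" "1 \<notin> R \<inter> A0"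
          using R subring_set_zero[OF A0] by auto
      next
        fix u v assume "u \<in> R \<inter> A0" "v \<in> R \<inter> A0"
        then show "u + v \<in> R \<inter> A0" using R subring_set_add[OF A0] by simp
      next
        fix u v assume "u \<in> A0" "v \<in> R \<inter> A0"
        then show "u * v \<in> R \<inter> A0" using R A0A subring_set_mult[OF A0, of u v] by auto
      next
        fix u v assume "u \<in> A0" "v \<in> A0" "u * v \<in> R \<inter> A0"
        moreover from this have "u \<in> A" "v \<in> A" using A0A by auto
        ultimately show "u \<in> R \<inter> A0 \<or> v \<in> R \<inter> A0" using R by simp
      qed
    qed
    \<comment> \<open>With zero as the smaller prime, \<open>even_part_separates\<close> yields a
      nonzero element of \<open>Q\<close> in the even part.\<close>
    have "primeideal {0} (ring_on A)"
      unfolding primeideal_ring_on_iff[OF A] ideal_ring_on_iff[OF A]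
      using subring_set_zero[OF A] by auto
    moreover have "{0} \<subset> Q" using Q' Q(3) by blast
    ultimately obtain w where w: "w \<in> Q - {0}" "w \<in> A0"
      using even_part_separates[of Q "{0}", folded A_def A0_def] Q' Q(1)[unfolded primeideal_ring_on_iff[OF A]]
      by meson
    obtain w' where w': "w' \<in> P - Q" "w' \<in> A0"
      using even_part_separates[of P Q, folded A_def A0_def] P[unfolded primeideal_ring_on_iff[OF A]] Q(1,2)
      by meson
    have chain: "Q \<inter> A0 \<subset> P \<inter> A0" "Q \<inter> A0 \<noteq> {0}"
      using w w' Q(2) by blast+
    have wP: "w \<in> P \<inter> A0" "w \<noteq> 0" using w Q(2) by auto
    \<comment> \<open>The shifted component \<open>tj * g / tp\<close> is not yet known to be a
      polynomial, so it is represented as the fraction \<open>a' / w\<close> over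
      \<open>A0\<close>.\<close>
    obtain a' where a': "a' \<in> A0" "tj * (w * g) = tp * a'"
      using twisted[OF wP(1)] by blast
    have "\<forall>y\<in>P \<inter> A0. \<exists>b\<in>A0. y * a' = w * b"
    proof
      fix y assume "y \<in> P \<inter> A0"
      then obtain y' where y': "y' \<in> A0" "tj * (y * g) = tp * y'" using twisted by blast
      have "tp * (y * a') = y * (tj * (w * g))"
        unfolding a'(2) by (simp add: mult_ac)
      also have "\<dots> = w * (tj * (y * g))" by (simp add: mult_ac)
      also have "\<dots> = tp * (w * y')" unfolding y'(2) by (simp add: mult_ac)
      finally show "\<exists>b\<in>A0. y * a' = w * b" using tp0 y'(1) by auto
    qed
    then obtain z' where z': "z' \<in> A0" "z' \<noteq> 0" "\<And>n. \<exists>y\<in>A0. z' * a' ^ n = w ^ n * y"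
      using almost_integral_of_prime_chain[OF A0 prime[OF P] prime[OF Q(1)] chain w(2) wP(2)] by blast
    have "\<exists>h\<in>A0. a' = w * h"
      unfolding A0_def
    proof (rule monoid_algebra_completely_integrally_closed[OF submonoid_even_part cic_even_part fin])
      show "keys s \<subseteq> verts" if "s \<in> even_part" for s
        using that edge_monoid_keys by (auto simp: even_part_def)
      show "\<exists>y\<in>monoid_algebra even_part. z' * a' ^ n = w ^ n * y" for n
        using z'(3)[of n] unfolding A0_def .
    qed (use a' w z' in \<open>auto simp: A0_def\<close>)
    then obtain h where h: "h \<in> A0" "a' = w * h" by blast
    have "w * (tj * g) = w * (tp * h)"
      using a'(2) unfolding h(2) by (simp add: mult_ac)
    then have "tj * g = tp * h" using wP(2) by simp
    \<comment> \<open>The monomial \<open>m\<close> of \<open>f\<close> survives in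
      \<open>g\<close>; its shift must therefore come from an element of the even part, and this
      brings \<open>m\<close> back into the edge monoid.\<close>
    moreover have "lookup (tj * g) (j + m) \<noteq> 0"
      using m unfolding tj_def lookup_single_mult by (simp add: g_def lookup_restrict_keys T_def in_keys_iff)
    ultimately have "j + m \<in> keys (tp * h)" by (simp add: in_keys_iff)
    then obtain s where "s \<in> keys h" "j + m = single c p + s"
      using keys_mult[of tp h] unfolding tp_def by (auto split: if_splits)
    then show ?thesis
      using tw(2)[of s] h(1) by (auto simp: A0_def monoid_algebra_def even_part_def add.commute)
  qed
  then have "f \<in> A" by (auto simp: A_def monoid_algebra_def)
  then show ?thesis using f(2) by blast
qed

theorem serre_S2_edge_algebra:
  "serre_S2 (monoid_algebra (edge_monoid edges) :: 'k::field mpoly set)"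
proof (rule serre_S2I)
  show "noetherian_ring (ring_on (monoid_algebra (edge_monoid edges) :: 'k mpoly set))"
    using finite_N finite_Z by (intro noetherian_edge_algebra) (simp add: edges_def)
qed (use subring_set_monoid_algebra[OF submonoid_edge_monoid] serre_criterion_edge_algebra in blast)+

end

section \<open>The shape of a triangular cactus of diameter four\<close>

context shallow_cactus
begin

theorem edge_algebra_not_normal:
  assumes z: "z \<in> Z" "z' \<in> Z" and branches: "par z \<noteq> par z'" "mate (par z) \<noteq> par z'"
  shows "\<not> normal_domain (monoid_algebra (edge_monoid edges) :: 'k::field mpoly set)"
proof
  let ?A = "monoid_algebra (edge_monoid edges) :: 'k mpoly set"
  let ?mon = "\<lambda>m :: nat \<Rightarrow>\<^sub>0 nat. single m (1 :: 'k)"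
  let ?t = "\<lambda>v :: nat. single v (1 :: nat)"
  let ?S = "edge_monoid edges"
  assume normal: "normal_domain ?A"
  define D where "D w = ?t (par w) + ?t w + ?t (mate w)" for w
  define x where "x = ?mon (D z + D z')"
  have edge: "?t a + ?t b \<in> ?S" if "{a, b} \<in> edges" "a \<noteq> b" for a b
    using edge_vec_in_edge_monoid[OF that(1)] that(2) by simp
  have add: "s + s' \<in> ?S" if "s \<in> ?S" "s' \<in> ?S" for s s'
    using that submonoid_edge_monoid by (auto simp: submonoid_set_def)
  have tri: "?t (par w) + ?t w \<in> ?S" "?t (par w) + ?t (mate w) \<in> ?S" "?t w + ?t (mate w) \<in> ?S"
    "?t c + ?t (par w) \<in> ?S" if w: "w \<in> Z" for w
  proof -
    have "{par w, w} \<in> edges" "{par w, mate w} \<in> edges" "{w, mate w} \<in> edges" "{c, par w} \<in> edges"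
      using w mate_Z(1)[OF w] par(1)[OF w] par(2)[OF w]
      by (auto simp: edges_def insert_commute intro: image_eqI[of _ _ "mate w"])
    moreover have "par w \<noteq> w" "par w \<noteq> mate w" "w \<noteq> mate w" "c \<noteq> par w"
      using w mate_Z(1)[OF w] mate_Z(2)[OF w, symmetric] par(1)[OF w] disjoint c_notin by auto
    ultimately show "?t (par w) + ?t w \<in> ?S" "?t (par w) + ?t (mate w) \<in> ?S" "?t w + ?t (mate w) \<in> ?S"
      "?t c + ?t (par w) \<in> ?S"
      using edge by blast+
  qed
  have mon0: "?mon m \<noteq> 0" for m
    by (metis lookup_single_eq lookup_zero zero_neq_one)
  \<comment> \<open>Its end at \<open>par z\<close> lets \<open>D z\<close> split into two edges,
    while its end at \<open>c\<close> is joined to \<open>par z'\<close> so that \<open>D z'\<close>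
    splits as well.\<close>
  define e where "e = ?t c + ?t (par z)"
  have "e + (D z + D z') = ((?t (par z) + ?t z) + (?t (par z) + ?t (mate z))) +
      ((?t c + ?t (par z')) + (?t z' + ?t (mate z')))"
    by (simp add: e_def D_def add_ac)
  also have "\<dots> \<in> ?S"
    by (intro add[OF add[OF tri(1)[OF z(1)] tri(2)[OF z(1)]] add[OF tri(4)[OF z(2)] tri(3)[OF z(2)]]])
  finally have num: "?mon e * x \<in> ?A"
    unfolding x_def mult_single by (intro single_in_monoid_algebra) simp
  have "e \<in> ?S" using tri z by (simp add: e_def)
  then have "?mon e \<in> ?A - {0}"
    using mon0 by (auto intro: single_in_monoid_algebra)
  moreover have "to_fract x = Fract (?mon e * x) (?mon e)"
    using mon0 by (simp add: to_fract_def eq_fract mult.commute)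
  ultimately have "to_fract x \<in> fractions ?A (?A - {0})"
    using num by (auto simp: fractions_def)
  moreover have "integral_over ?A (to_fract x)"
    unfolding integral_over_def
  proof (intro exI conjI allI)
    let ?f = "[:- (x * x), 0, 1:]"
    \<comment> \<open>Twice a triangle is the sum of its three edges; this gives the integral
      equation.\<close>
    have "D w + D w = (?t (par w) + ?t w) + ((?t (par w) + ?t (mate w)) + (?t w + ?t (mate w)))" for w
      by (simp add: D_def add_ac)
    then have "D w + D w \<in> ?S" if "w \<in> Z" for w
      using tri[OF that] add by metis
    then have "(D z + D z) + (D z' + D z') \<in> ?S" using z add by blast
    then have xx: "x * x \<in> ?A"
      unfolding x_def mult_single by (intro single_in_monoid_algebra) (simp add: add_ac)
    note A = subring_set_monoid_algebra[OF submonoid_edge_monoid, of edges, where 'a = 'k]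
    show "coeff ?f i \<in> ?A" for i
      using subring_set_minus[OF A xx] subring_set_zero[OF A] subring_set_one[OF A]
      by (auto simp: coeff_pCons split: nat.split)
    show "lead_coeff ?f = 1" by simp
    show "poly (fract_poly ?f) (to_fract x) = 0"
      by (simp add: map_poly_pCons)
  qed
  ultimately have "to_fract x \<in> to_fract ` ?A"
    using normal by (auto simp: normal_domain_def)
  then have "x \<in> ?A" by auto
  then have "D z + D z' \<in> ?S"
    by (simp add: x_def monoid_algebra_def)
  then obtain k where k: "sum k branches = vec (D z + D z') c"
    "\<And>i. i \<in> branches \<Longrightarrow> valid (vec (D z + D z')) i (k i)"
    using edge_monoid_valid by blast
  \<comment> \<open>With coordinate zero at \<open>c\<close> no branch may use an edge to
    \<open>c\<close>, but the branch of \<open>z\<close> has the odd coordinate sum three.\<close>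
  have "vec (D z + D z') c = 0"
    using z par(1) mate_Z(1) c_notin by (auto simp: D_def lookup_add lookup_single when_def)
  moreover have "0 \<le> k i" if "i \<in> branches" for i
    using k(2)[OF that] by (auto simp: valid_def exc_def)
  ultimately have k0: "k i = 0" if "i \<in> branches" for i
    using k(1) that sum_nonneg_eq_0_iff[OF finite_branches, of k] by auto
  define i where "i = min (par z) (mate (par z))"
  have n: "par z \<in> N" "mate (par z) \<in> N" "mate (par z) \<noteq> par z" "mate (mate (par z)) = par z"
    using z par(1) mate_N by blast+
  then have i: "i \<in> branches" "i \<in> N"
    by (auto simp: i_def branches_def min_def)
  have vD: "vec (D w) v = of_bool (v = par w) + of_bool (v = w \<or> v = mate w)" if "w \<in> Z" for w v
    using mate_Z(2)[OF that] by (auto simp: D_def lookup_add lookup_single when_def)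
  have "tot (vec (D z + D z')) i =
      tot (vec (D z)) i + 3 * of_bool (i = par z') + 3 * of_bool (mate i = par z')"
    using vD[OF z(2)] by (intro add_outer_triangle(3)[OF z(2) _ i(2)]) (simp add: lookup_add)
  also have "tot (vec (D z)) i =
      tot (\<lambda>_. 0) i + 3 * of_bool (i = par z) + 3 * of_bool (mate i = par z)"
    using vD[OF z(1)] by (intro add_outer_triangle(3)[OF z(1) _ i(2)]) simp
  also have "tot (\<lambda>_. 0) i = 0" by (simp add: tot_def ww_def)
  finally have "tot (vec (D z + D z')) i = 3"
    using branches n by (auto simp: i_def min_def)
  then show False using k(2)[OF i(1)] k0[OF i(1)] by (simp add: valid_def)
qed

end

section \<open>Paths, blocks and cycles in a triangular cactus\<close>

lemma rtrancl_imp_path: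
  assumes "(x, y) \<in> R\<^sup>*"
  shows "\<exists>p. p \<noteq> [] \<and> hd p = x \<and> last p = y \<and> distinct p \<and> successively (\<lambda>a b. (a, b) \<in> R) p"
  using assms
proof (induction rule: converse_rtrancl_induct)
  case base
  then show ?case by (intro exI[of _ "[y]"]) auto
next
  case (step x x')
  then obtain p where p: "p \<noteq> []" "hd p = x'" "last p = y" "distinct p" "successively (\<lambda>a b. (a, b) \<in> R) p"
    by blast
  show ?case
  proof (cases "x \<in> set p")
    case False
    then show ?thesis
      using p step(1) by (intro exI[of _ "x # p"]) (auto simp: successively_Cons)
  next
    case True
    then obtain as bs where "p = as @ x # bs" by (meson split_list)
    then show ?thesis
      using p by (intro exI[of _ "x # bs"]) (auto simp: successively_append_iff)
  qed
qed

lemma successively_imp_rtrancl: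
  "successively (\<lambda>a b. (a, b) \<in> R) p \<Longrightarrow> p \<noteq> [] \<Longrightarrow> (hd p, last p) \<in> R\<^sup>*"
proof (induction p rule: induct_list012)
  case (3 x y zs)
  then show ?case by (auto intro: converse_rtrancl_into_rtrancl)
qed auto

lemma is_path_rev: "is_path V E u p v \<Longrightarrow> is_path V E v (rev p) u"
  by (simp add: is_path_def hd_rev last_rev insert_commute)

lemma is_path_within_list:
  assumes "distinct ws" "successively (\<lambda>x y. {x, y} \<in> F) ws" "set ws \<subseteq> W" "x \<in> set ws" "y \<in> set ws"
  shows "\<exists>p. is_path W F x p y"
proof -
  have *: "\<exists>p. is_path W F a p b" if ws: "ws = as @ a # bs" and b: "b \<in> set (a # bs)" for a b as bs
  proof (cases "a = b")
    case True
    then show ?thesis using assms ws b by (intro exI[of _ "[a]"]) (auto simp: is_path_def)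
  next
    case False
    then obtain cs ds where bs: "bs = cs @ b # ds" using b by (auto dest: split_list)
    have "ws = as @ (a # cs @ [b]) @ ds" using ws bs by simp
    then have "successively (\<lambda>x y. {x, y} \<in> F) (a # cs @ [b])"
      using assms(2) by (simp only: successively_append_iff)
    then have "is_path W F a (a # cs @ [b]) b"
      using assms(1,3) unfolding ws bs is_path_def by auto
    then show ?thesis by blast
  qed
  obtain as bs where ws: "ws = as @ x # bs" using assms(4) by (meson split_list)
  show ?thesis
  proof (cases "y \<in> set (x # bs)")
    case True
    then show ?thesis using * ws by blast
  next
    case False
    then have "y \<in> set as" using assms(5) ws by auto
    then obtain cs ds where "as = cs @ y # ds" by (meson split_list)
    then have "ws = cs @ y # (ds @ x # bs)" using ws by simp
    then obtain p where "is_path W F y p x" using *[of cs y "ds @ x # bs" x] by auto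
    then show ?thesis using is_path_rev[of W F y p x] by (intro exI)
  qed
qed

text \<open>The empty case occurs when the only vertex of a graph is deleted; it yields no component
  and hence no cutpoint.\<close>

lemma connected_components_connected:
  assumes "\<And>x y. x \<in> V \<Longrightarrow> y \<in> V \<Longrightarrow> \<exists>p. is_path V E x p y"
  shows "connected_components V E = (if V = {} then {} else {V})"
proof -
  have "{(u, v). \<exists>p. is_path V E u p v} `` {u} = V" if "u \<in> V" for u
    using assms[OF that] by (auto simp: is_path_def)
  then show ?thesis
    unfolding connected_components_def quotient_def by auto
qed

lemma non_separableI:
  assumes "simple_graph W F" "W \<noteq> {}"
    and "\<And>x y. x \<in> W \<Longrightarrow> y \<in> W \<Longrightarrow> \<exists>p. is_path W F x p y"
    and "\<And>v x y. v \<in> W \<Longrightarrow> x \<in> W - {v} \<Longrightarrow> y \<in> W - {v} \<Longrightarrow> \<exists>p. is_path (W - {v}) {e \<in> F. v \<notin> e} x p y"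
  shows "non_separable W F"
proof -
  have "\<not> cutpoint W F v" for v
    using connected_components_connected[OF assms(3)] connected_components_connected[OF assms(4), of v] assms(2)
    by (auto simp: cutpoint_def)
  then show ?thesis
    using assms(1-3) by (auto simp: non_separable_def connected_graph_def)
qed

text \<open>Among the non-separable subgraphs that contain the given one, one with the largest
  number of vertices plus edges is maximal.\<close>

lemma block_exists:
  assumes G: "simple_graph V E" and W: "W \<subseteq> V" "F \<subseteq> E" "non_separable W F"
  shows "\<exists>W' F'. W \<subseteq> W' \<and> F \<subseteq> F' \<and> block V E W' F'"
proof -
  have fin: "finite V" "finite E"
    using G finite_subset[of E "Pow V"] by (auto simp: simple_graph_def)
  define \<C> where "\<C> = {(W', F'). W \<subseteq> W' \<and> F \<subseteq> F' \<and> W' \<subseteq> V \<and> F' \<subseteq> E \<and> non_separable W' F'}"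
  have "finite \<C>"
    by (rule finite_subset[of _ "Pow V \<times> Pow E"]) (use fin in \<open>auto simp: \<C>_def\<close>)
  moreover have "(W, F) \<in> \<C>" using W by (auto simp: \<C>_def)
  moreover define size where "size C = card (fst C) + card (snd C)" for C :: "'a set \<times> 'a set set"
  ultimately have "Max (size ` \<C>) \<in> size ` \<C>" "\<And>C. C \<in> \<C> \<Longrightarrow> size C \<le> Max (size ` \<C>)"
    by (auto intro!: Max_in)
  then obtain C where C: "C \<in> \<C>" "\<And>C'. C' \<in> \<C> \<Longrightarrow> size C' \<le> size C"
    by (metis imageE)
  obtain W' F' where [simp]: "C = (W', F')" by fastforce
  have C': "W \<subseteq> W'" "F \<subseteq> F'" "W' \<subseteq> V" "F' \<subseteq> E" "non_separable W' F'"
    using C(1) by (auto simp: \<C>_def)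
  have "W'' = W' \<and> F'' = F'"
    if *: "W' \<subseteq> W''" "W'' \<subseteq> V" "F' \<subseteq> F''" "F'' \<subseteq> E" "non_separable W'' F''" for W'' F''
  proof -
    have "(W'', F'') \<in> \<C>" using * C' by (auto simp: \<C>_def)
    then have "card W'' + card F'' \<le> card W' + card F'" using C(2)[of "(W'', F'')"] by (simp add: size_def)
    moreover have "finite W''" "finite F''"
      using * fin finite_subset by blast+
    ultimately show ?thesis
      using * card_mono[of W'' W'] card_mono[of F'' F'] card_seteq[of W'' W'] card_seteq[of F'' F'] by auto
  qed
  then have "block V E W' F'" using C' by (auto simp: block_def)
  then show ?thesis using C' by blast
qed

context
  fixes V :: "'v set" and E :: "'v set set"
  assumes cactus: "triangular_cactus V E"
begin

lemma cactus_simple: "simple_graph V E"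
  using cactus by (simp add: triangular_cactus_def connected_graph_def)

lemma cactus_no_loop: "{x, y} \<in> E \<Longrightarrow> x \<noteq> y"
  using cactus_simple by (auto simp: simple_graph_def)

lemma cactus_edge_subset: "{x, y} \<in> E \<Longrightarrow> x \<in> V \<and> y \<in> V"
  using cactus_simple by (auto simp: simple_graph_def)

text \<open>The subgraph on the vertices of a cycle is non-separable, as deleting a vertex leaves an
  arc through the others. It lies in a block, and blocks have three vertices.\<close>

lemma cactus_cycle_length:
  assumes "distinct vs" "successively (\<lambda>x y. {x, y} \<in> E) vs" "{last vs, hd vs} \<in> E"
  shows "length vs \<le> 3"
proof (cases "vs = []")
  case ne: False
  define F where "F = {e \<in> E. e \<subseteq> set vs}"
  have subV: "set vs \<subseteq> V"
  proof
    fix v assume "v \<in> set vs"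
    then obtain as bs where vs: "vs = as @ v # bs" by (meson split_list)
    show "v \<in> V"
    proof (cases bs)
      case Nil
      then show ?thesis using assms(3) cactus_edge_subset[of v "hd vs"] vs by auto
    next
      case (Cons b bs')
      then show ?thesis using assms(2) vs cactus_edge_subset[of v b] by (auto simp: successively_append_iff)
    qed
  qed
  have F: "successively (\<lambda>x y. {x, y} \<in> F) vs"
    by (rule successively_mono[OF assms(2)]) (auto simp: F_def)
  have "non_separable (set vs) F"
  proof (rule non_separableI)
    show "simple_graph (set vs) F"
      using cactus_simple by (auto simp: simple_graph_def F_def)
    show "\<exists>p. is_path (set vs) F x p y" if "x \<in> set vs" "y \<in> set vs" for x y
      using is_path_within_list[OF assms(1) F order.refl that] .
    fix v x y assume v: "v \<in> set vs" and xy: "x \<in> set vs - {v}" "y \<in> set vs - {v}"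
    obtain as bs where vs: "vs = as @ v # bs" using v by (meson split_list)
    \<comment> \<open>The cycle cut open at \<open>v\<close>; the closing edge links
      \<open>bs\<close> to \<open>as\<close>.\<close>
    have set: "set (bs @ as) = set vs - {v}" "distinct (bs @ as)"
      using assms(1) vs by auto
    have "successively (\<lambda>x y. {x, y} \<in> E) (bs @ as)"
    proof -
      have "vs = as @ [v] @ bs" using vs by simp
      then have "successively (\<lambda>x y. {x, y} \<in> E) as" "successively (\<lambda>x y. {x, y} \<in> E) bs"
        using assms(2) by (simp_all only: successively_append_iff)
      moreover have "{last bs, hd as} \<in> E" if "bs \<noteq> []" "as \<noteq> []"
        using assms(3) that unfolding vs by simp
      ultimately show ?thesis unfolding successively_append_iff by blast
    qed
    then have "successively (\<lambda>x y. {x, y} \<in> {e \<in> F. v \<notin> e}) (bs @ as)"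
    proof (rule successively_mono)
      fix x y assume xy: "x \<in> set (bs @ as)" "y \<in> set (bs @ as)" "{x, y} \<in> E"
      then show "{x, y} \<in> {e \<in> F. v \<notin> e}"
        unfolding set(1) F_def by blast
    qed
    from is_path_within_list[OF set(2) this, of "set vs - {v}" x y]
    show "\<exists>p. is_path (set vs - {v}) {e \<in> F. v \<notin> e} x p y"
      using xy unfolding set(1) by auto
  qed (use ne in auto)
  then obtain W' F' where "set vs \<subseteq> W'" "block V E W' F'"
    using block_exists[OF cactus_simple subV, of F] by (auto simp: F_def)
  then have W': "set vs \<subseteq> W'" "is_cycle 3 W' F'"
    using cactus by (auto simp: triangular_cactus_def)
  then obtain ws where ws: "length ws = 3" "W' = set ws"
    unfolding is_cycle_def by blast
  have "length vs = card (set vs)" using assms(1) by (simp add: distinct_card)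
  also have "\<dots> \<le> card (set ws)" using W'(1) ws(2) by (intro card_mono) auto
  also have "\<dots> \<le> 3" using card_length[of ws] ws(1) by simp
  finally show ?thesis .
qed simp

text \<open>A single edge is non-separable, so it lies in a block, which is a triangle.\<close>

lemma cactus_triangle:
  assumes "{u, v} \<in> E"
  shows "\<exists>w. {u, w} \<in> E \<and> {v, w} \<in> E"
proof -
  have uv: "u \<noteq> v" "u \<in> V" "v \<in> V"
    using assms cactus_no_loop cactus_edge_subset by auto
  have "non_separable {u, v} {{u, v}}"
  proof (rule non_separableI)
    show "simple_graph {u, v} {{u, v}}" using uv by (auto simp: simple_graph_def)
    show "\<exists>p. is_path {u, v} {{u, v}} x p y" if "x \<in> {u, v}" "y \<in> {u, v}" for x y
      using is_path_within_list[of "[u, v]" "{{u, v}}" "{u, v}" x y] uv that by auto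
    show "\<exists>p. is_path ({u, v} - {w}) {e \<in> {{u, v}}. w \<notin> e} x p y"
      if "w \<in> {u, v}" "x \<in> {u, v} - {w}" "y \<in> {u, v} - {w}" for w x y
      using that by (intro exI[of _ "[x]"]) (auto simp: is_path_def)
  qed simp
  then obtain W F where WF: "{{u, v}} \<subseteq> F" "block V E W F"
    using block_exists[OF cactus_simple, of "{u, v}" "{{u, v}}"] uv assms by auto
  then have "is_cycle 3 W F" "F \<subseteq> E"
    using cactus by (auto simp: triangular_cactus_def block_def)
  then obtain ws where ws: "length ws = 3" "F = {{ws ! i, ws ! (Suc i mod 3)} | i. i < 3}"
    unfolding is_cycle_def by blast
  obtain a b c where abc: "ws = [a, b, c]"
    using ws(1) by (auto simp: numeral_3_eq_3 length_Suc_conv)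
  have "{i. i < 3} = {0, 1, 2 :: nat}" by auto
  then have "F = (\<lambda>i. {ws ! i, ws ! (Suc i mod 3)}) ` {0, 1, 2}"
    unfolding ws(2) by blast
  then have F: "F = {{a, b}, {b, c}, {c, a}}"
    by (simp add: abc)
  then have E: "{a, b} \<in> E" "{b, c} \<in> E" "{c, a} \<in> E" using \<open>F \<subseteq> E\<close> by auto
  have "{u, v} = {a, b} \<or> {u, v} = {b, c} \<or> {u, v} = {c, a}"
    using WF(1) F(1) by auto
  then show ?thesis
    using E by (auto simp: doubleton_eq_iff insert_commute)
qed

lemma graph_dist_le: "is_path V E u p v \<Longrightarrow> graph_dist V E u v \<le> length p - 1"
  unfolding graph_dist_def by (intro Least_le exI[of _ p]) (auto simp: is_path_def)

lemma graph_dist_path: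
  assumes "u \<in> V" "v \<in> V"
  shows "\<exists>p. is_path V E u p v \<and> length p = Suc (graph_dist V E u v)"
proof -
  obtain p where "is_path V E u p v"
    using cactus assms unfolding triangular_cactus_def connected_graph_def by blast
  moreover from this have "length p = Suc (length p - 1)"
    by (auto simp: is_path_def)
  ultimately have "\<exists>n p. is_path V E u p v \<and> length p = Suc n" by blast
  then show ?thesis
    unfolding graph_dist_def by (rule LeastI_ex)
qed

text \<open>A path from \<open>x\<close> to \<open>y\<close> avoiding \<open>c\<close> closes up
  through \<open>c\<close>; the resulting cycle has at least four vertices because \<open>x\<close>
  and \<open>y\<close> are not adjacent.\<close>

lemma cactus_path_cycle:
  assumes "{c, x} \<in> E" "{c, y} \<in> E" "x \<noteq> y" "{x, y} \<notin> E"
  shows "(x, y) \<notin> {(a, b). {a, b} \<in> E \<and> a \<noteq> c \<and> b \<noteq> c}\<^sup>*"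
proof
  let ?R = "{(a, b). {a, b} \<in> E \<and> a \<noteq> c \<and> b \<noteq> c}"
  assume "(x, y) \<in> ?R\<^sup>*"
  from rtrancl_imp_path[OF this]
  obtain p where p: "p \<noteq> []" "hd p = x" "last p = y" "distinct p" "successively (\<lambda>a b. (a, b) \<in> ?R) p"
    by blast
  have E: "successively (\<lambda>a b. {a, b} \<in> E) p"
    by (rule successively_mono[OF p(5)]) auto
  obtain a b ps where ps: "p = a # b # ps"
    using p(1-3) assms(3) by (cases p; cases "tl p") auto
  have "c \<notin> set p"
  proof
    assume "c \<in> set p"
    then obtain as bs where *: "p = as @ c # bs" by (meson split_list)
    show False
    proof (cases bs)
      case Nil
      then show False using p(3) * assms(2) cactus_no_loop[of c c] by auto
    next
      case (Cons d ds)
      then show False using p(5) * by (auto simp: successively_append_iff)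
    qed
  qed
  moreover have "ps \<noteq> []"
  proof
    assume "ps = []"
    then have "p = [x, y]" using ps p(2,3) by simp
    then show False using E assms(4) by simp
  qed
  ultimately have "distinct (c # p)" "length (c # p) > 3" using p(4) ps by (auto simp: Suc_lessI)
  moreover have "successively (\<lambda>a b. {a, b} \<in> E) (c # p)"
    using E assms(1) p(1,2) by (simp add: successively_Cons)
  moreover have "{last (c # p), hd (c # p)} \<in> E"
    using p(1,3) assms(2) by (simp add: insert_commute)
  ultimately show False using cactus_cycle_length[of "c # p"] by simp
qed

section \<open>Distance levels around a centre\<close>

context
  fixes c :: 'v
  assumes near: "\<And>z. z \<in> V \<Longrightarrow> \<exists>p. is_path V E c p z \<and> length p \<le> 3" and c: "c \<in> V"
begin

definition level1 :: "'v set" where "level1 = {n. {c, n} \<in> E}"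
definition level2 :: "'v set" where "level2 = V - {c} - level1"
text \<open>The third vertex of the triangle formed by \<open>x\<close> and its neighbour closer to
  \<open>c\<close>; the choice is unique by \<open>partner_unique\<close>.\<close>

definition partner :: "'v \<Rightarrow> 'v" where
  "partner x = (SOME y. {x, y} \<in> E \<and> y \<noteq> c \<and> (y \<in> level1 \<longleftrightarrow> x \<in> level1))"
definition parent :: "'v \<Rightarrow> 'v" where
  "parent z = (SOME n. n \<in> level1 \<and> {n, z} \<in> E)"

lemma c_notin_level1: "c \<notin> level1"
  using cactus_no_loop[of c c] by (auto simp: level1_def)

lemma level1_subset: "level1 \<subseteq> V"
  using cactus_edge_subset by (auto simp: level1_def)

lemma parent: "z \<in> level2 \<Longrightarrow> parent z \<in> level1 \<and> {parent z, z} \<in> E"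
proof -
  assume z: "z \<in> level2"
  then obtain p where p: "is_path V E c p z" "length p \<le> 3"
    using near by (auto simp: level2_def)
  have "\<exists>n. n \<in> level1 \<and> {n, z} \<in> E"
  proof -
    have "hd p = c" "last p = z" "p \<noteq> []" "successively (\<lambda>x y. {x, y} \<in> E) p"
      using p(1) by (auto simp: is_path_def)
    moreover have "z \<noteq> c" "{c, z} \<notin> E" using z by (auto simp: level2_def level1_def)
    moreover have "p = [] \<or> (\<exists>x. p = [x]) \<or> (\<exists>x y. p = [x, y]) \<or> (\<exists>x y w. p = [x, y, w])"
      using p(2) by (auto simp: numeral_3_eq_3 le_Suc_eq length_Suc_conv)
    ultimately show ?thesis by (auto simp: level1_def)
  qed
  then show ?thesis unfolding parent_def by (rule someI_ex)
qed

text \<open>Two such neighbours would form a cycle of four vertices with \<open>c\<close> and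
  \<open>z\<close>.\<close>

lemma parent_unique:
  assumes "n \<in> level1" "n' \<in> level1" "{n, z} \<in> E" "{n', z} \<in> E" "z \<noteq> c"
  shows "n = n'"
proof (rule ccontr)
  assume "n \<noteq> n'"
  moreover have "n \<noteq> z" "n' \<noteq> z" "c \<noteq> n" "c \<noteq> n'"
    using assms cactus_no_loop c_notin_level1 by auto
  ultimately show False
    using cactus_cycle_length[of "[c, n, z, n']"] assms c_notin_level1
    by (auto simp: level1_def insert_commute)
qed

lemma parent_eqI: "z \<in> level2 \<Longrightarrow> n \<in> level1 \<Longrightarrow> {n, z} \<in> E \<Longrightarrow> parent z = n"
  using parent parent_unique[of "parent z" n z] by (auto simp: level2_def)

lemma level2_edge_parent:
  assumes "z \<in> level2" "z' \<in> level2" "{z, z'} \<in> E"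
  shows "parent z = parent z'"
proof (rule ccontr)
  assume "parent z \<noteq> parent z'"
  moreover have "z \<noteq> z'" using assms cactus_no_loop by auto
  moreover have "parent z \<noteq> z'" "parent z' \<noteq> z" "parent z \<noteq> z" "parent z' \<noteq> z'" "z \<noteq> c" "z' \<noteq> c"
    "parent z \<noteq> c" "parent z' \<noteq> c"
    using parent[OF assms(1)] parent[OF assms(2)] assms(1,2) c_notin_level1 by (auto simp: level2_def)
  ultimately show False
    using cactus_cycle_length[of "[c, parent z, z, z', parent z']"] assms(3)
      parent[OF assms(1)] parent[OF assms(2)]
    by (auto simp: level1_def insert_commute)
qed

lemma common_neighbours:
  assumes "{a, x} \<in> E" "{a, y} \<in> E" "{a, b} \<in> E" "{b, x} \<in> E" "{b, y} \<in> E"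
  shows "x = y"
proof (rule ccontr)
  assume "x \<noteq> y"
  then show False
    using cactus_cycle_length[of "[a, x, b, y]"] assms cactus_no_loop
    by (auto simp: insert_commute)
qed

lemma partner_exists:
  assumes "x \<in> V" "x \<noteq> c"
  shows "\<exists>y. {x, y} \<in> E \<and> y \<noteq> c \<and> (y \<in> level1 \<longleftrightarrow> x \<in> level1)"
proof (cases "x \<in> level1")
  case True
  then obtain w where "{c, w} \<in> E" "{x, w} \<in> E"
    using cactus_triangle[of c x] by (auto simp: level1_def)
  then show ?thesis using True c_notin_level1 by (auto simp: level1_def)
next
  case False
  then have x: "x \<in> level2" using assms by (auto simp: level2_def)
  then obtain w where w: "{parent x, w} \<in> E" "{x, w} \<in> E"
    using cactus_triangle parent by blast
  have "w \<noteq> c" using w False by (auto simp: level1_def insert_commute)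
  moreover have "w \<notin> level1"
  proof
    assume "w \<in> level1"
    then have "parent x = w" using parent_eqI[OF x] w(2) by (simp add: insert_commute)
    then show False using w(1) cactus_no_loop by blast
  qed
  ultimately show ?thesis using w False by blast
qed

lemma partner:
  assumes "x \<in> V" "x \<noteq> c"
  shows "{x, partner x} \<in> E" "partner x \<noteq> c" "partner x \<in> level1 \<longleftrightarrow> x \<in> level1"
  using someI_ex[OF partner_exists[OF assms]] unfolding partner_def by blast+

text \<open>Two candidates would both be adjacent to \<open>x\<close> and to the neighbour of
  \<open>x\<close> closer to \<open>c\<close>, giving a cycle of four vertices. On the second level
  this uses that adjacent vertices have the same parent.\<close>

lemma partner_unique:
  assumes "x \<in> V" "x \<noteq> c" "{x, y} \<in> E" "y \<noteq> c" "y \<in> level1 \<longleftrightarrow> x \<in> level1"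
  shows "y = partner x"
proof (cases "x \<in> level1")
  case True
  then show ?thesis
    using partner[OF assms(1,2)] assms common_neighbours[of c y "partner x" x]
    by (auto simp: level1_def)
next
  case False
  have V: "y \<in> V" "partner x \<in> V"
    using assms(3) partner(1)[OF assms(1,2)] cactus_edge_subset by auto
  then have l2: "x \<in> level2" "y \<in> level2" "partner x \<in> level2"
    using False assms partner[OF assms(1,2)] by (auto simp: level2_def)
  have "parent y = parent x" "parent (partner x) = parent x"
    using level2_edge_parent[OF l2(1,2) assms(3)] level2_edge_parent[OF l2(1,3) partner(1)[OF assms(1,2)]]
    by simp_all
  then show ?thesis
    using common_neighbours[of "parent x" y "partner x" x] parent[OF l2(1)] parent[OF l2(2)] parent[OF l2(3)]
      assms(3) partner(1)[OF assms(1,2)] by simp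
qed

lemma partner_props:
  assumes "x \<in> V" "x \<noteq> c"
  shows "partner x \<noteq> x" "partner (partner x) = x" "partner x \<in> V"
proof -
  show pV: "partner x \<in> V" using partner(1)[OF assms] cactus_edge_subset by blast
  show "partner x \<noteq> x" using partner(1)[OF assms] cactus_no_loop by metis
  show "partner (partner x) = x"
    using partner_unique[of "partner x" x] pV partner[OF assms] assms by (simp add: insert_commute)
qed

lemma edges_of_levels:
  "E = (\<lambda>n. {c, n}) ` level1 \<union> (\<lambda>n. {n, partner n}) ` level1 \<union> (\<lambda>z. {z, parent z}) ` level2 \<union>
    (\<lambda>z. {z, partner z}) ` level2" (is "_ = ?E")
proof
  show "?E \<subseteq> E"
  proof (intro Un_least image_subsetI)
    show "{c, n} \<in> E" if "n \<in> level1" for n using that by (simp add: level1_def)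
    show "{n, partner n} \<in> E" if "n \<in> level1" for n
      using that level1_subset c_notin_level1 by (intro partner(1)) auto
    show "{z, parent z} \<in> E" if "z \<in> level2" for z
      using parent[OF that] by (simp add: insert_commute)
    show "{z, partner z} \<in> E" if "z \<in> level2" for z
      using that by (intro partner(1)) (auto simp: level2_def)
  qed
  show "E \<subseteq> ?E"
  proof
    fix e assume e: "e \<in> E"
    then have "card e = 2" using cactus_simple by (auto simp: simple_graph_def)
    then obtain x y where xy: "e = {x, y}" "x \<noteq> y" by (meson card_2_iff)
    have E: "{x, y} \<in> E" "{y, x} \<in> E" using e xy by (auto simp: insert_commute)
    then have V: "x \<in> V" "y \<in> V" using cactus_edge_subset by auto
    consider "x = c" | "y = c" | "x \<noteq> c" "y \<noteq> c" "x \<in> level1" "y \<in> level1"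
      | "x \<noteq> c" "y \<noteq> c" "x \<in> level1" "y \<in> level2" | "x \<noteq> c" "y \<noteq> c" "x \<in> level2" "y \<in> level1"
      | "x \<noteq> c" "y \<noteq> c" "x \<in> level2" "y \<in> level2"
      using V by (auto simp: level2_def)
    then show "e \<in> ?E"
    proof cases
      case 1
      then show ?thesis using E xy by (auto simp: level1_def)
    next
      case 2
      then show ?thesis using E xy by (auto simp: level1_def insert_commute)
    next
      case 3
      then show ?thesis using partner_unique[of x y] V E xy by auto
    next
      case 4
      then show ?thesis using parent_eqI[of y x] E xy by (auto simp: insert_commute)
    next
      case 5
      then show ?thesis using parent_eqI[of x y] E xy by (auto simp: insert_commute)
    next
      case 6
      then have "y = partner x"
        using partner_unique[of x y] V E by (auto simp: level2_def)
      then show ?thesis using 6 xy by auto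
    qed
  qed
qed

end

text \<open>The centre is the midpoint of a shortest path between two vertices \<open>u\<close> and
  \<open>v\<close> at distance four. A shortest path from \<open>z\<close> to one of them that runs
  through \<open>c\<close> spends at least two of its at most four edges after \<open>c\<close>. If
  both avoid \<open>c\<close>, they connect the nonadjacent neighbours \<open>w\<close> and
  \<open>w'\<close> of \<open>c\<close> without meeting \<open>c\<close>, which
  \<open>cactus_path_cycle\<close> excludes.\<close>

lemma cactus_centre:
  assumes diam: "diam V E = 4"
  obtains u w c w' v where "{u, w} \<in> E" "{w, c} \<in> E" "{c, w'} \<in> E" "{w', v} \<in> E"
    "u \<noteq> c" "v \<noteq> c" "w \<noteq> w'" "{w, w'} \<notin> E" "{c, u} \<notin> E" "{c, v} \<notin> E"
    "\<And>z. z \<in> V \<Longrightarrow> \<exists>p. is_path V E c p z \<and> length p \<le> 3"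
proof -
  define S where "S = {graph_dist V E u v | u v. u \<in> V \<and> v \<in> V}"
  have "S = (\<lambda>(u, v). graph_dist V E u v) ` (V \<times> V)" by (auto simp: S_def)
  moreover have "finite V" "V \<noteq> {}"
    using cactus by (auto simp: triangular_cactus_def connected_graph_def simple_graph_def)
  ultimately have S: "finite S" "S \<noteq> {}" by auto
  have max: "Max S = 4" using diam by (simp add: diam_def S_def)
  then have "4 \<in> S" using Max_in[OF S] by simp
  then obtain u v where uv: "u \<in> V" "v \<in> V" "graph_dist V E u v = 4"
    by (auto simp: S_def)
  have dist_le: "graph_dist V E x y \<le> 4" if "x \<in> V" "y \<in> V" for x y
    using Max_ge[OF S(1)] that max by (auto simp: S_def)
  have short: "\<exists>p. is_path V E x p y \<and> length p \<le> 5" if "x \<in> V" "y \<in> V" for x y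
    using graph_dist_path[OF that] dist_le[OF that] by fastforce
  have long: "length p \<ge> 5" if "is_path V E u p v" for p
    using graph_dist_le[OF that] that uv(3) by (cases p) (auto simp: is_path_def)
  obtain p where "is_path V E u p v" "length p = 5"
    using graph_dist_path[OF uv(1,2)] uv(3) by auto
  then obtain w c w' where p: "is_path V E u [u, w, c, w', v] v"
    by (auto simp: is_path_def numeral_eq_Suc length_Suc_conv)
  have E: "{u, w} \<in> E" "{w, c} \<in> E" "{c, w'} \<in> E" "{w', v} \<in> E"
    and V: "w \<in> V" "c \<in> V" "w' \<in> V"
    and dist: "distinct [u, w, c, w', v]"
    using p by (auto simp: is_path_def)
  \<comment> \<open>Each of these edges would give a path of length three from \<open>u\<close> to
    \<open>v\<close>.\<close>
  have not: "{w, w'} \<notin> E" "{c, u} \<notin> E" "{c, v} \<notin> E"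
    using long[of "[u, w, w', v]"] long[of "[u, c, w', v]"] long[of "[u, w, c, v]"] E V uv dist
    by (auto simp: is_path_def insert_commute)
  show ?thesis
  proof (rule that[OF E])
    show "\<exists>p. is_path V E c p z \<and> length p \<le> 3" if z: "z \<in> V" for z
    proof -
      have half: "\<exists>p. is_path V E c p z \<and> length p \<le> 3"
        if p: "is_path V E z p x" "length p \<le> 5" "c \<in> set p" "x \<noteq> c" "{c, x} \<notin> E" for p x
      proof -
        obtain as bs where as: "p = as @ c # bs" using p(3) by (meson split_list)
        have "length bs \<ge> 2"
          using p(1,4,5) unfolding as is_path_def
          by (cases bs; cases "tl bs") (auto simp: successively_append_iff)
        have "is_path V E z (as @ [c]) c"
        proof -
          have "p = (as @ [c]) @ bs" using as by simp
          then have "successively (\<lambda>x y. {x, y} \<in> E) (as @ [c])"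
            using p(1) by (simp only: is_path_def successively_append_iff)
          moreover have "hd (as @ [c]) = z" using p(1) as by (cases as) (auto simp: is_path_def)
          ultimately show ?thesis using p(1) as by (auto simp: is_path_def)
        qed
        then have "is_path V E c (rev (as @ [c])) z" by (rule is_path_rev)
        moreover have "length (rev (as @ [c])) \<le> 3"
          using p(2) \<open>length bs \<ge> 2\<close> unfolding as by simp
        ultimately show ?thesis by blast
      qed
      obtain p q where p: "is_path V E z p u" "length p \<le> 5" and q: "is_path V E z q v" "length q \<le> 5"
        using short[OF z uv(1)] short[OF z uv(2)] by blast
      show ?thesis
      proof (cases "c \<in> set p \<or> c \<in> set q")
        case True
        then show ?thesis using half[OF p] half[OF q] dist not by auto
      next
        case False
        let ?R = "{(a, b). {a, b} \<in> E \<and> a \<noteq> c \<and> b \<noteq> c}"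
        have reach: "(z, x) \<in> ?R\<^sup>*" if "is_path V E z r x" "c \<notin> set r" for r x
        proof -
          have "successively (\<lambda>a b. (a, b) \<in> ?R) r"
          proof (rule successively_mono)
            show "successively (\<lambda>a b. {a, b} \<in> E) r" using that by (simp add: is_path_def)
          qed (use that in auto)
          then show ?thesis
            using successively_imp_rtrancl[of ?R r] that(1) by (auto simp: is_path_def)
        qed
        have "sym ?R" by (auto simp: sym_def insert_commute)
        then have "sym (?R\<^sup>*)" by (rule sym_rtrancl)
        then have "(u, v) \<in> ?R\<^sup>*"
          using reach[OF p(1)] reach[OF q(1)] False by (meson rtrancl_trans symE)
        moreover have "(w, u) \<in> ?R" "(v, w') \<in> ?R"
          using E dist by (auto simp: insert_commute)
        ultimately have "(w, w') \<in> ?R\<^sup>*"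
          by (meson converse_rtrancl_into_rtrancl rtrancl.rtrancl_into_rtrancl)
        then show ?thesis
          using cactus_path_cycle[of c w w'] E dist not by (auto simp: insert_commute)
      qed
    qed
  qed (use dist not in auto)
qed

end

theorem theorem3p2:
  fixes d :: nat and E :: "nat set set"
  assumes "triangular_cactus {1..d} E"
    and "diam {1..d} E = 4"
  shows "\<not> normal_domain (edge_ring {1..d} E :: 'k::field mpoly set) \<and>
         serre_S2 (edge_ring {1..d} E :: 'k::field mpoly set)"
proof -
  note cactus = assms(1)
  obtain u w c w' v where E: "{u, w} \<in> E" "{w, c} \<in> E" "{c, w'} \<in> E" "{w', v} \<in> E"
    and ne: "u \<noteq> c" "v \<noteq> c" "w \<noteq> w'" "{w, w'} \<notin> E" "{c, u} \<notin> E" "{c, v} \<notin> E"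
    and near: "\<And>z. z \<in> {1..d} \<Longrightarrow> \<exists>p. is_path {1..d} E c p z \<and> length p \<le> 3"
    using cactus_centre[OF assms, of thesis] by blast
  have V: "c \<in> {1..d}" "u \<in> {1..d}" "v \<in> {1..d}"
    using E cactus_edge_subset[OF cactus] by blast+
  note hyps = cactus near V(1)
  let ?N = "level1 E c" and ?Z = "level2 {1..d} E c"
  let ?mate = "partner E c" and ?par = "parent E c"
  have N: "?N \<subseteq> {1..d} - {c}"
    using level1_subset[OF hyps] c_notin_level1[OF hyps] by blast
  have N_eq: "?N = {n. {c, n} \<in> E}" by (rule level1_def[OF hyps])
  have Z: "?Z = {1..d} - {c} - ?N" by (rule level2_def[OF hyps])
  interpret shallow_cactus c ?N ?Z ?mate ?par
  proof
    show "finite ?N" "finite ?Z" "c \<notin> ?N" "c \<notin> ?Z" "?N \<inter> ?Z = {}"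
      using N Z finite_subset[OF N] by auto
  next
    fix n assume n: "n \<in> ?N"
    then have nV: "n \<in> {1..d}" "n \<noteq> c" using N by auto
    show "?mate n \<in> ?N" using partner(3)[OF hyps nV] n by simp
    show "?mate n \<noteq> n" "?mate (?mate n) = n" using partner_props[OF hyps nV] by simp_all
  next
    fix z assume z: "z \<in> ?Z"
    then have zV: "z \<in> {1..d}" "z \<noteq> c" "z \<notin> ?N" using Z by auto
    show mz: "?mate z \<in> ?Z"
      using partner(2,3)[OF hyps zV(1,2)] partner_props(3)[OF hyps zV(1,2)] zV(3) unfolding Z by simp
    show "?mate z \<noteq> z" "?mate (?mate z) = z" using partner_props[OF hyps zV(1,2)] by simp_all
    show "?par z \<in> ?N" using parent[OF hyps z] by blast
    show "?par (?mate z) = ?par z"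
      using level2_edge_parent[OF hyps z mz partner(1)[OF hyps zV(1,2)]] by simp
  qed
  have edges: "edges = E"
    unfolding edges_def using edges_of_levels[OF hyps] by simp
  have ring: "edge_ring {1..d} E = (monoid_algebra (edge_monoid E) :: 'k mpoly set)"
    using cactus_simple[OF cactus] by (intro edge_ring_eq) (auto simp: simple_graph_def intro: finite_subset)
  have wN: "w \<in> ?N" "w' \<in> ?N"
    using E unfolding N_eq by (auto simp: insert_commute)
  have uv: "u \<in> ?Z" "v \<in> ?Z"
    using V ne unfolding Z N_eq by auto
  have par: "?par u = w" "?par v = w'"
    using parent_eqI[OF hyps uv(1) wN(1)] parent_eqI[OF hyps uv(2) wN(2)] E by (auto simp: insert_commute)
  \<comment> \<open>Since \<open>w\<close> and \<open>w'\<close> are not adjacent, \<open>u\<close>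
    and \<open>v\<close> lie in different branches.\<close>
  have "{w, ?mate w} \<in> E"
    using partner(1)[OF hyps, of w] wN(1) N by blast
  then have "?mate w \<noteq> w'" using ne(4) by metis
  then have "\<not> normal_domain (monoid_algebra (edge_monoid E) :: 'k mpoly set)"
    using edge_algebra_not_normal[OF uv] ne(3) unfolding par edges by blast
  moreover have "serre_S2 (monoid_algebra (edge_monoid E) :: 'k mpoly set)"
    using serre_S2_edge_algebra unfolding edges .
  ultimately show ?thesis unfolding ring ..
qed

end
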